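(* Let $n\geq 3$ be an integer, let $u=x_1^{a_1}\cdots x_n^{a_n}$ and $v=x_1^{b_1}\cdots x_n^{b_n}$, with $a_1>b_1\geq 0$, be monomials of degree $d\ge 2$ in $S=k[x_1,\ldots,x_n]$, and let $I=(\mathcal{L}(u,v))\subset S$ be the lexsegment ideal defined by $u$ and $v$. Assume that $\dim(S/I)\geq 1$. Then $I$ is Cohen--Macaulay if and only if one of the following conditions is fulfilled: (a) $u=x_1x_n^{d-1}$ and $v=x_2^d$; (b) $v=x_{n-1}^a x_n^{d-a}$ for some $a>0$ and $x_n u/x_1<_{lex}v$.
   Context: $S=k[x_1,\ldots,x_n]$ is a polynomial ring over a field $k$, with monomials ordered lexicographically with $x_1>x_2>\cdots>x_n$. $d\geq 2$ is an integer and $\mathcal{M}_d$ is the set of monomials of degree $d$ in $S$. For $u,v\in\mathcal{M}_d$ with $u\geq_{lex}v$, $\mathcal{L}(u,v)=\{w\in\mathcal{M}_d : u\geq_{lex}w\geq_{lex}v\}$; the ideal it generates is a lexsegment ideal. The ideal $I$ is called Cohen--Macaulay if the ring $S/I$ is Cohen--Macaulay. *)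

theory Defs
  imports "HOL-Library.Poly_Mapping" "HOL-Library.Extended_Nat" "HOL-Algebra.Ring_Divisibility"
begin

section \<open>The polynomial ring and lexsegment ideals\<close>

text \<open>
  The monomial \<open>x\<^sub>1^a\<^sub>1 \<cdots> x\<^sub>n^a\<^sub>n\<close> is represented by its exponent vector, a finitely supported
  function on \<open>nat\<close> that vanishes outside \<open>{1..n}\<close>; products of monomials are sums of exponent
  vectors. The linear order of \<open>nat \<Rightarrow>\<^sub>0 nat\<close> in \<open>HOL-Library.Poly_Mapping\<close> compares two exponent
  vectors at the smallest index where they differ, so that on monomials it is the lexicographic
  order with \<open>x\<^sub>1 > x\<^sub>2 > \<cdots> > x\<^sub>n\<close> (see \<open>less_monomial_iff\<close> below).
\<close>

type_synonym monomial = "nat \<Rightarrow>\<^sub>0 nat"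

type_synonym 'k mpoly = "monomial \<Rightarrow>\<^sub>0 'k"

lemma less_monomial_iff:
  fixes w w' :: monomial
  shows "w < w' \<longleftrightarrow>
    (\<exists>i. Poly_Mapping.lookup w i < Poly_Mapping.lookup w' i \<and>
      (\<forall>j<i. Poly_Mapping.lookup w j = Poly_Mapping.lookup w' j))"
  by (simp add: less_poly_mapping.rep_eq less_fun_def)

definition mon_degree :: "monomial \<Rightarrow> nat" where
  "mon_degree w = (\<Sum>i\<in>Poly_Mapping.keys w. Poly_Mapping.lookup w i)"

definition monomials :: "nat \<Rightarrow> nat \<Rightarrow> monomial set" where
  "monomials n d = {w. Poly_Mapping.keys w \<subseteq> {1..n} \<and> mon_degree w = d}"

text \<open>The ring \<open>k[x\<^sub>1, \<dots>, x\<^sub>n]\<close>, inside the type of polynomials in variables indexed by \<open>nat\<close>.\<close>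

definition poly_ring :: "nat \<Rightarrow> 'k::field mpoly ring" where
  "poly_ring n =
    \<lparr> carrier = {p. \<forall>w \<in> Poly_Mapping.keys p. Poly_Mapping.keys w \<subseteq> {1..n}},
      mult = (*), one = 1, zero = 0, add = (+) \<rparr>"

lemma cring_poly_ring: "cring (poly_ring n :: 'k::field mpoly ring)"
proof (rule cringI)
  let ?R = "poly_ring n :: 'k mpoly ring"
  have add: "p + q \<in> carrier ?R" if "p \<in> carrier ?R" "q \<in> carrier ?R" for p q
    using that Poly_Mapping.keys_add[of p q] by (auto simp: poly_ring_def dest!: subsetD)
  have mult: "p * q \<in> carrier ?R" if pq: "p \<in> carrier ?R" "q \<in> carrier ?R" for p q
  proof -
    have "Poly_Mapping.keys w \<subseteq> {1..n}" if w: "w \<in> Poly_Mapping.keys (p * q)" for w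
    proof -
      obtain a b where ab: "w = a + b" "a \<in> Poly_Mapping.keys p" "b \<in> Poly_Mapping.keys q"
        using w keys_mult[of p q] by blast
      have "Poly_Mapping.keys a \<subseteq> {1..n}" "Poly_Mapping.keys b \<subseteq> {1..n}"
        using pq ab by (simp_all add: poly_ring_def)
      then show ?thesis
        using Poly_Mapping.keys_add[of a b] ab(1) by blast
    qed
    then show ?thesis by (simp add: poly_ring_def)
  qed
  have uminus: "- p \<in> carrier ?R" if "p \<in> carrier ?R" for p
    using that by (simp add: poly_ring_def)
  show "abelian_group ?R"
  proof (rule abelian_groupI)
    show "p \<oplus>\<^bsub>?R\<^esub> q \<in> carrier ?R" if "p \<in> carrier ?R" "q \<in> carrier ?R" for p q
      using add[OF that] by (simp add: poly_ring_def)
    show "\<exists>q\<in>carrier ?R. q \<oplus>\<^bsub>?R\<^esub> p = \<zero>\<^bsub>?R\<^esub>" if "p \<in> carrier ?R" for p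
      using uminus[OF that] by (intro bexI[of _ "- p"]) (simp_all add: poly_ring_def)
  qed (simp_all add: poly_ring_def add_ac)
  show "comm_monoid ?R"
  proof (rule comm_monoidI)
    show "p \<otimes>\<^bsub>?R\<^esub> q \<in> carrier ?R" if "p \<in> carrier ?R" "q \<in> carrier ?R" for p q
      using mult[OF that] by (simp add: poly_ring_def)
  qed (simp_all add: poly_ring_def mult_ac)
  show "(p \<oplus>\<^bsub>?R\<^esub> q) \<otimes>\<^bsub>?R\<^esub> r = p \<otimes>\<^bsub>?R\<^esub> r \<oplus>\<^bsub>?R\<^esub> q \<otimes>\<^bsub>?R\<^esub> r" for p q r
    by (simp add: poly_ring_def distrib_right)
qed

definition lexsegment :: "nat \<Rightarrow> nat \<Rightarrow> monomial \<Rightarrow> monomial \<Rightarrow> monomial set" where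
  "lexsegment n d u v = {w \<in> monomials n d. v \<le> w \<and> w \<le> u}"

definition lexsegment_ideal ::
    "nat \<Rightarrow> nat \<Rightarrow> monomial \<Rightarrow> monomial \<Rightarrow> 'k::field mpoly set" where
  "lexsegment_ideal n d u v =
    genideal (poly_ring n) ((\<lambda>w. Poly_Mapping.single w 1) ` lexsegment n d u v)"

section \<open>Krull dimension, depth and Cohen--Macaulay rings\<close>

definition prime_chain :: "('a, 'm) ring_scheme \<Rightarrow> nat \<Rightarrow> (nat \<Rightarrow> 'a set) \<Rightarrow> bool" where
  "prime_chain R l P \<longleftrightarrow> (\<forall>i\<le>l. primeideal (P i) R) \<and> (\<forall>i<l. P i \<subset> P (Suc i))"

text \<open>By this definition the zero ring has dimension \<open>0\<close>.\<close>

definition krull_dim :: "('a, 'm) ring_scheme \<Rightarrow> enat" where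
  "krull_dim R = Sup {enat l | l. \<exists>P. prime_chain R l P}"

definition height :: "('a, 'm) ring_scheme \<Rightarrow> 'a set \<Rightarrow> enat" where
  "height R Q = Sup {enat l | l. \<exists>P. prime_chain R l P \<and> P l = Q}"

text \<open>
  A sequence is regular on \<open>R\<close> if each entry is a nonzerodivisor modulo the ideal generated by the
  previous entries, and all the entries together generate a proper ideal.
\<close>

definition regular_sequence :: "('a, 'm) ring_scheme \<Rightarrow> 'a list \<Rightarrow> bool" where
  "regular_sequence R xs \<longleftrightarrow>
    set xs \<subseteq> carrier R \<and>
    (\<forall>i<length xs. \<forall>r\<in>carrier R.
      xs ! i \<otimes>\<^bsub>R\<^esub> r \<in> genideal R (set (take i xs)) \<longrightarrow> r \<in> genideal R (set (take i xs))) \<and>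
    genideal R (set xs) \<noteq> carrier R"

definition depth :: "('a, 'm) ring_scheme \<Rightarrow> 'a set \<Rightarrow> enat" where
  "depth R J = Sup {enat (length xs) | xs. set xs \<subseteq> J \<and> regular_sequence R xs}"

text \<open>
  This is Eisenbud's definition (Commutative Algebra, Section 18.2). For a maximal ideal \<open>P\<close> of a
  Noetherian ring, \<open>depth R P\<close> and \<open>height R P\<close> are the depth and the dimension of the local
  ring \<open>R\<^sub>P\<close>, so the condition says that all localizations of \<open>R\<close> at maximal ideals are
  Cohen--Macaulay local rings.
\<close>

definition cohen_macaulay_ring :: "('a, 'm) ring_scheme \<Rightarrow> bool" where
  "cohen_macaulay_ring R \<longleftrightarrow>
    cring R \<and> noetherian_ring R \<and> (\<forall>P. maximalideal P R \<longrightarrow> depth R P = height R P)"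

end

theory Submission
  imports Defs
begin

text \<open>
  If \<open>x\<^sub>n u / x\<^sub>1 \<ge> v\<close>, then \<open>u / x\<^sub>1\<close> is annihilated modulo \<open>I\<close> by all variables, so the depth of \<open>S/I\<close>
  at the origin is \<open>0\<close>, while the dimension there is positive. Otherwise \<open>a\<^sub>1 = b\<^sub>1 + 1\<close>, and unless (a)
  or (b) holds there are an \<open>m\<close> with \<open>I \<subseteq> (x\<^sub>1, \<dots>, x\<^sub>m)\<close> and a monomial \<open>f \<notin> I\<close> annihilated modulo \<open>I\<close>
  by more than \<open>m\<close> variables. Then the height at the origin is at least \<open>n - m\<close>, and the depth is
  less than \<open>n - m\<close>.

  Conversely, in the cases (a) and (b) let \<open>W\<close> be the set of the \<open>j\<close> for which \<open>x\<^sub>j\<close> occurs in no generator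
  (\<open>{3..n-1}\<close> in case (a), empty in case (b)), and let \<open>r = |W| + 1\<close>. There are so few monomials
  outside \<open>I\<close> that any \<open>r + 1\<close> elements of \<open>S/I\<close> are algebraically dependent, hence \<open>dim S/I \<le> r\<close>. By
  Zariski's lemma a maximal ideal contains a nonzero \<open>g\<^sub>i \<in> k[x\<^sub>i]\<close> for each \<open>i\<close>, and
  \<open>x\<^sub>1 g\<^sub>1 + x\<^sub>n g\<^sub>n\<close> followed by the \<open>g\<^sub>j\<close> with \<open>j \<in> W\<close> is a regular sequence of length \<open>r\<close>. Since the depth
  never exceeds the height, both are \<open>r\<close>.
\<close>

section \<open>Regular sequences and chains of primes\<close>

lemma (in cring) cring_idealI:
  assumes "J \<subseteq> carrier R" "\<zero> \<in> J"
    and add: "\<And>a b. a \<in> J \<Longrightarrow> b \<in> J \<Longrightarrow> a \<oplus> b \<in> J"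
    and mult: "\<And>r a. r \<in> carrier R \<Longrightarrow> a \<in> J \<Longrightarrow> r \<otimes> a \<in> J"
  shows "ideal J R"
proof (rule idealI)
  have "\<ominus> a \<in> J" if "a \<in> J" for a
    using mult[OF _ that, of "\<ominus> \<one>"] assms(1) that by (auto simp: l_minus)
  then show "subgroup J (add_monoid R)"
    using assms by (intro subgroup.intro) (auto simp flip: a_inv_def)
  show "a \<otimes> x \<in> J" if "a \<in> J" "x \<in> carrier R" for a x
    using mult[OF that(2,1)] assms(1) that m_comm[of x a] by auto
qed (use mult ring_axioms in auto)

lemma (in cring) add_principal_ideal:
  assumes J: "ideal J R" and x: "x \<in> carrier R"
  shows "ideal {j \<oplus> x \<otimes> r | j r. j \<in> J \<and> r \<in> carrier R} R" (is "ideal ?K R")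
proof (rule cring_idealI)
  interpret J: ideal J R by fact
  show "?K \<subseteq> carrier R" using x by auto
  show "\<zero> \<in> ?K"
    using x by (auto intro!: exI[of _ \<zero>])
  show "a \<oplus> b \<in> ?K" if ab: "a \<in> ?K" "b \<in> ?K" for a b
  proof -
    obtain j r j' r' where *: "a = j \<oplus> x \<otimes> r" "b = j' \<oplus> x \<otimes> r'" "j \<in> J" "j' \<in> J"
      "r \<in> carrier R" "r' \<in> carrier R" using ab by auto
    then have "a \<oplus> b = (j \<oplus> j') \<oplus> x \<otimes> (r \<oplus> r')"
      using x by (simp add: r_distr J.Icarr a_ac)
    then show ?thesis using * by blast
  qed
  show "s \<otimes> a \<in> ?K" if s: "s \<in> carrier R" and a: "a \<in> ?K" for s a
  proof -
    obtain j r where *: "a = j \<oplus> x \<otimes> r" "j \<in> J" "r \<in> carrier R" using a by auto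
    then have "s \<otimes> a = s \<otimes> j \<oplus> x \<otimes> (s \<otimes> r)"
      using x s by (simp add: r_distr J.Icarr m_lcomm)
    then show ?thesis using * s J.I_l_closed by blast
  qed
qed

lemma (in cring) genideal_insert:
  assumes X: "X \<subseteq> carrier R" and x: "x \<in> carrier R"
  shows "Idl (insert x X) = {j \<oplus> x \<otimes> r | j r. j \<in> Idl X \<and> r \<in> carrier R}" (is "_ = ?K")
proof
  interpret J: ideal "Idl X" R by (rule genideal_ideal[OF X])
  interpret I: ideal "Idl (insert x X)" R by (rule genideal_ideal) (use X x in auto)
  have sub: "insert x X \<subseteq> Idl (insert x X)"
    by (rule genideal_self) (use X x in auto)
  have "j \<in> ?K" if "j \<in> Idl X" for j
    using that x by (intro CollectI exI[of _ j] exI[of _ \<zero>]) (auto simp: J.Icarr)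
  moreover have "x \<in> ?K"
    using x by (intro CollectI exI[of _ \<zero>] exI[of _ \<one>]) auto
  ultimately have "insert x X \<subseteq> ?K"
    using genideal_self[OF X] by blast
  then show "Idl (insert x X) \<subseteq> ?K"
    using add_principal_ideal[OF J.is_ideal x] by (intro genideal_minimal)
  have "Idl X \<subseteq> Idl (insert x X)"
    by (rule genideal_minimal) (use sub I.is_ideal in auto)
  then show "?K \<subseteq> Idl (insert x X)"
    using sub I.I_r_closed by auto
qed

lemma (in noetherian_ring) ideal_set_has_maximal:
  assumes "C \<noteq> {}" and "\<And>J. J \<in> C \<Longrightarrow> ideal J R"
  shows "\<exists>M\<in>C. \<forall>J\<in>C. M \<subseteq> J \<longrightarrow> J = M"
proof (rule subset_Zorn_nonempty[OF assms(1)])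
  fix D assume D: "D \<noteq> {}" "subset.chain C D"
  then have "subset.chain {J. ideal J R} D"
    using assms(2) by (auto simp: pred_on.chain_def)
  with D show "\<Union>D \<in> C"
    using ideal_chain_is_trivial[of D] by (auto simp: pred_on.chain_def)
qed

lemma prime_avoiding_multiplicative_set:
  fixes R (structure)
  assumes "cring R" "noetherian_ring R" and J: "ideal J R"
    and T: "T \<subseteq> carrier R" "\<one> \<in> T" "\<And>s t. s \<in> T \<Longrightarrow> t \<in> T \<Longrightarrow> s \<otimes> t \<in> T"
    and disj: "J \<inter> T = {}"
  obtains P where "primeideal P R" "J \<subseteq> P" "P \<inter> T = {}"
proof -
  interpret cring R by fact
  interpret noetherian_ring R by fact
  define C where "C = {K. ideal K R \<and> J \<subseteq> K \<and> K \<inter> T = {}}"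
  have "\<exists>M\<in>C. \<forall>K\<in>C. M \<subseteq> K \<longrightarrow> K = M"
    by (rule ideal_set_has_maximal) (use J disj in \<open>auto simp: C_def\<close>)
  then obtain M where "M \<in> C" and Mmax: "\<And>K. K \<in> C \<Longrightarrow> M \<subseteq> K \<Longrightarrow> K = M"
    by blast
  then have M: "ideal M R" "J \<subseteq> M" "M \<inter> T = {}" by (simp_all add: C_def)
  interpret M: ideal M R by fact
  have meets: "\<exists>m\<in>M. \<exists>r\<in>carrier R. m \<oplus> a \<otimes> r \<in> T" if a: "a \<in> carrier R" "a \<notin> M" for a
  proof (rule ccontr)
    assume neg: "\<not> ?thesis"
    let ?K = "{j \<oplus> a \<otimes> r | j r. j \<in> M \<and> r \<in> carrier R}"
    have sub: "M \<subseteq> ?K"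
    proof
      fix j assume "j \<in> M"
      then show "j \<in> ?K"
        using a by (intro CollectI exI[of _ j] exI[of _ \<zero>]) (auto simp: M.Icarr)
    qed
    have "ideal ?K R" by (rule add_principal_ideal[OF M.is_ideal a(1)])
    then have "?K = M"
      using M(2) sub neg by (intro Mmax) (auto simp: C_def)
    moreover have "a \<in> ?K"
      using a by (intro CollectI exI[of _ \<zero>] exI[of _ \<one>]) auto
    ultimately show False using a by simp
  qed
  have "primeideal M R"
  proof (rule primeidealI)
    show "carrier R \<noteq> M" using T M(3) by auto
    fix a b assume ab: "a \<in> carrier R" "b \<in> carrier R" "a \<otimes> b \<in> M"
    show "a \<in> M \<or> b \<in> M"
    proof (rule ccontr)
      assume "\<not> ?thesis"
      then obtain m r m' r' where m: "m \<in> M" "m' \<in> M" "r \<in> carrier R" "r' \<in> carrier R"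
        and t: "m \<oplus> a \<otimes> r \<in> T" "m' \<oplus> b \<otimes> r' \<in> T"
        using meets[of a] meets[of b] ab by blast
      have "(m \<oplus> a \<otimes> r) \<otimes> (m' \<oplus> b \<otimes> r')
          = (m' \<oplus> b \<otimes> r') \<otimes> m \<oplus> ((a \<otimes> r) \<otimes> m' \<oplus> (r \<otimes> r') \<otimes> (a \<otimes> b))"
        using m ab by (simp add: M.Icarr l_distr r_distr m_ac a_ac)
      also have "\<dots> \<in> M" using m ab by (simp add: M.Icarr M.I_l_closed)
      finally show False using T(3)[OF t] M(3) by auto
    qed
  qed (use M is_cring in auto)
  then show thesis using M(2,3) that by auto
qed

lemma prime_below_nonzerodivisor:
  fixes R (structure)
  assumes "cring R" "noetherian_ring R" and J: "ideal J R" and P: "primeideal P R" "J \<subseteq> P"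
    and x: "x \<in> P" "\<And>r. r \<in> carrier R \<Longrightarrow> x \<otimes> r \<in> J \<Longrightarrow> r \<in> J"
  obtains P' where "primeideal P' R" "J \<subseteq> P'" "P' \<subset> P"
proof -
  interpret cring R by fact
  interpret P: primeideal P R by fact
  have xc: "x \<in> carrier R" using x by (simp add: P.Icarr)
  let ?T = "{s \<otimes> x [^] k | s (k::nat). s \<in> carrier R \<and> s \<notin> P}"
  have one: "\<one> \<notin> P" using P.I_notcarr P.one_imp_carrier by blast
  have "r \<in> J" if "r \<in> carrier R" "r \<otimes> x [^] k \<in> J" for r and k :: nat
    using that
  proof (induction k)
    case (Suc k)
    then show ?case
      using x(2)[of "r \<otimes> x [^] k"] xc by (simp add: m_ac)
  qed simp
  then have T1: "J \<inter> ?T = {}" using P(2) by auto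
  have T2: "s \<otimes> t \<in> ?T" if "s \<in> ?T" "t \<in> ?T" for s t
  proof -
    obtain a b and k l :: nat where *: "s = a \<otimes> x [^] k" "t = b \<otimes> x [^] l" "a \<in> carrier R" "b \<in> carrier R"
      "a \<notin> P" "b \<notin> P" using \<open>s \<in> ?T\<close> \<open>t \<in> ?T\<close> by blast
    then have "s \<otimes> t = (a \<otimes> b) \<otimes> x [^] (k + l)"
      using xc by (simp add: m_ac flip: nat_pow_mult)
    moreover have "a \<otimes> b \<notin> P" using * P.I_prime by blast
    ultimately show ?thesis using *(3,4)
      by (intro CollectI exI[of _ "a \<otimes> b"] exI[of _ "k + l"]) simp
  qed
  have T3: "\<one> \<in> ?T"
    using one by (intro CollectI exI[of _ \<one>] exI[of _ "0::nat"]) auto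
  have T4: "?T \<subseteq> carrier R" using xc by auto
  obtain P' where P': "primeideal P' R" "J \<subseteq> P'" "P' \<inter> ?T = {}"
    by (rule prime_avoiding_multiplicative_set[OF assms(1,2) J T4 T3 T2 T1])
  interpret P': primeideal P' R by fact
  have "s \<in> P" if "s \<in> P'" for s
  proof (rule ccontr)
    assume "s \<notin> P"
    then have "s \<in> ?T"
      using that by (intro CollectI exI[of _ s] exI[of _ "0::nat"]) (auto simp: P'.Icarr)
    then show False using P' that by auto
  qed
  moreover have "x \<notin> P'"
  proof
    assume "x \<in> P'"
    moreover have "x \<in> ?T"
      using one xc by (intro CollectI exI[of _ \<one>] exI[of _ "1::nat"]) auto
    ultimately show False using P' by auto
  qed
  ultimately show thesis using that[of P'] P' x by blast
qed

lemma regular_sequence_prime_chain: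
  fixes R (structure)
  assumes "cring R" "noetherian_ring R" "primeideal P R" "regular_sequence R xs" "set xs \<subseteq> P"
  shows "j \<le> length xs \<Longrightarrow>
    \<exists>C. prime_chain R j C \<and> C j = P \<and> Idl (set (take (length xs - j) xs)) \<subseteq> C 0"
proof (induction j)
  case 0
  interpret cring R by fact
  interpret P: primeideal P R by fact
  have "Idl (set xs) \<subseteq> P" using assms(5) P.is_ideal by (rule genideal_minimal[rotated])
  then show ?case
    using assms(3) by (intro exI[of _ "\<lambda>_. P"]) (simp add: prime_chain_def)
next
  case (Suc j)
  interpret cring R by fact
  define i where "i = length xs - Suc j"
  have i: "i < length xs" "length xs - j = Suc i" using Suc.prems by (auto simp: i_def)
  obtain C where C: "prime_chain R j C" "C j = P" "Idl (set (take (Suc i) xs)) \<subseteq> C 0"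
    using Suc i by auto
  have car: "set xs \<subseteq> carrier R" using assms(4) by (simp add: regular_sequence_def)
  have car': "set (take l xs) \<subseteq> carrier R" for l using car set_take_subset[of l xs] by blast
  let ?J = "Idl (set (take i xs))"
  have "set (take (Suc i) xs) \<subseteq> C 0" using C(3) genideal_self[OF car'] by blast
  then have xi: "xs ! i \<in> C 0" "set (take i xs) \<subseteq> C 0"
    using i by (auto simp: take_Suc_conv_app_nth)
  have C0: "primeideal (C 0) R" using C(1) by (simp add: prime_chain_def)
  then interpret C0: primeideal "C 0" R .
  have "?J \<subseteq> C 0" using xi C0.is_ideal by (intro genideal_minimal)
  then obtain P' where P': "primeideal P' R" "?J \<subseteq> P'" "P' \<subset> C 0"
    using prime_below_nonzerodivisor[OF assms(1,2) genideal_ideal[OF car'] C0 _ xi(1)] assms(4) i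
    unfolding regular_sequence_def by metis
  let ?C = "\<lambda>l. if l = 0 then P' else C (l - 1)"
  have "prime_chain R (Suc j) ?C"
    unfolding prime_chain_def
  proof (intro conjI allI impI)
    show "primeideal (?C i) R" if "i \<le> Suc j" for i
      using that C(1) P' by (simp add: prime_chain_def)
    show "?C i \<subset> ?C (Suc i)" if "i < Suc j" for i
      using that C(1) P'(3) by (cases i) (simp_all add: prime_chain_def)
  qed
  then show ?case
    using P' C i_def by (intro exI[of _ ?C]) auto
qed

lemma depth_le_height:
  fixes R (structure)
  assumes "cring R" "noetherian_ring R" "primeideal P R"
  shows "depth R P \<le> height R P"
  unfolding depth_def
proof (rule Sup_least)
  fix e assume "e \<in> {enat (length xs) | xs. set xs \<subseteq> P \<and> regular_sequence R xs}"
  then obtain xs where xs: "e = enat (length xs)" "set xs \<subseteq> P" "regular_sequence R xs" by auto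
  then have "\<exists>C. prime_chain R (length xs) C \<and> C (length xs) = P"
    using regular_sequence_prime_chain[OF assms xs(3,2), of "length xs"] by auto
  then show "e \<le> height R P" unfolding height_def xs(1)
    by (intro Sup_upper) blast
qed

text \<open>
  Membership of \<open>0\<close> in \<open>boundary_set R [a\<^sub>1, \<dots>, a\<^sub>l]\<close> is the collapse relation of
  Coquand and Lombardi, which characterizes Krull dimension less than \<open>l\<close> without primes. A
  polynomial relation between the \<open>a\<^sub>i\<close> over a field produces such a collapse, by factoring out its
  lexicographically smallest monomial.
\<close>

primrec boundary_set :: "('a, 'm) ring_scheme \<Rightarrow> 'a list \<Rightarrow> 'a set" where
  "boundary_set R [] = {\<one>\<^bsub>R\<^esub>}"
| "boundary_set R (a # as) =
    {a [^]\<^bsub>R\<^esub> (e::nat) \<otimes>\<^bsub>R\<^esub> (g \<oplus>\<^bsub>R\<^esub> a \<otimes>\<^bsub>R\<^esub> h) | e g h. g \<in> boundary_set R as \<and> h \<in> carrier R}"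

lemma (in ring) boundary_set_closed:
  "set as \<subseteq> carrier R \<Longrightarrow> x \<in> boundary_set R as \<Longrightarrow> x \<in> carrier R"
  by (induction as arbitrary: x) auto

lemma boundary_set_hom:
  assumes "ring_hom_ring R S f" "set as \<subseteq> carrier R" "x \<in> boundary_set R as"
  shows "f x \<in> boundary_set S (map f as)"
  using assms(2,3)
proof (induction as arbitrary: x)
  case Nil
  interpret ring_hom_ring R S f by fact
  show ?case using Nil by simp
next
  case (Cons a as)
  interpret f: ring_hom_ring R S f by fact
  obtain g h and e :: nat where x: "x = a [^]\<^bsub>R\<^esub> e \<otimes>\<^bsub>R\<^esub> (g \<oplus>\<^bsub>R\<^esub> a \<otimes>\<^bsub>R\<^esub> h)"
    and g: "g \<in> boundary_set R as" and h: "h \<in> carrier R" using Cons.prems by auto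
  have gc: "g \<in> carrier R" by (rule f.R.boundary_set_closed[OF _ g]) (use Cons.prems(1) in simp)
  have "f x = f a [^]\<^bsub>S\<^esub> e \<otimes>\<^bsub>S\<^esub> (f g \<oplus>\<^bsub>S\<^esub> f a \<otimes>\<^bsub>S\<^esub> f h)"
    using gc h Cons.prems(1) by (simp add: x f.hom_nat_pow)
  moreover have "f g \<in> boundary_set S (map f as)" using Cons.IH[OF _ g] Cons.prems(1) by simp
  moreover have "f h \<in> carrier S" using h by simp
  ultimately show ?case by auto
qed

lemma boundary_set_prime_chain:
  fixes R (structure)
  assumes "set as \<subseteq> carrier R"
    and "\<And>i. i \<le> length as \<Longrightarrow> primeideal (P i) R"
    and "\<And>i. i < length as \<Longrightarrow> as ! i \<in> P (Suc i) - P i" "\<And>i. i < length as \<Longrightarrow> P i \<subseteq> P (Suc i)"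
    and "x \<in> boundary_set R as"
  shows "x \<notin> P 0"
  using assms
proof (induction as arbitrary: x P)
  case Nil
  interpret primeideal "P 0" R using Nil by auto
  show ?case using Nil I_notcarr one_imp_carrier by auto
next
  case (Cons a as)
  interpret P0: primeideal "P 0" R using Cons by auto
  interpret P1: primeideal "P 1" R using Cons by auto
  obtain g h and e :: nat where x: "x = a [^]\<^bsub>R\<^esub> e \<otimes>\<^bsub>R\<^esub> (g \<oplus>\<^bsub>R\<^esub> a \<otimes>\<^bsub>R\<^esub> h)"
    and g: "g \<in> boundary_set R as" and h: "h \<in> carrier R" using Cons.prems by auto
  have a: "a \<in> carrier R" and as: "set as \<subseteq> carrier R" using Cons.prems(1) by auto
  have gc: "g \<in> carrier R" using P0.boundary_set_closed[OF as g] .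
  have aP: "a \<in> P 1" "a \<notin> P 0" using Cons.prems(3)[of 0] by auto
  have "g \<notin> P 1"
    using Cons.IH[of "\<lambda>i. P (Suc i)" g] Cons.prems(2,4) Cons.prems(3)[of "Suc i" for i] as g
    by auto
  have apow: "a [^] k \<notin> P 0" for k :: nat
  proof (induction k)
    case 0
    then show ?case using P0.I_notcarr P0.one_imp_carrier by auto
  next
    case (Suc k)
    then show ?case using P0.I_prime[of "a [^] k" a] a aP by auto
  qed
  show ?case
  proof
    assume "x \<in> P 0"
    then have "g \<oplus> a \<otimes> h \<in> P 0"
      using P0.I_prime[of "a [^] e" "g \<oplus> a \<otimes> h"] apow a h gc x by auto
    then have *: "g \<oplus> a \<otimes> h \<in> P 1" using Cons.prems(4)[of 0] by auto
    have **: "a \<otimes> h \<in> P 1" by (rule P1.I_r_closed[OF aP(1) h])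
    have "g \<oplus> a \<otimes> h \<ominus> a \<otimes> h \<in> P 1"
      unfolding a_minus_def by (rule P1.a_closed[OF * P1.a_inv_closed[OF **]])
    moreover have "g \<oplus> a \<otimes> h \<ominus> a \<otimes> h = g"
      using gc a h by (simp add: a_minus_def P0.a_assoc P0.r_neg)
    ultimately show False using \<open>g \<notin> P 1\<close> by simp
  qed
qed

lemma prime_chain_length_bound:
  fixes R (structure)
  assumes "\<And>as. set as \<subseteq> carrier R \<Longrightarrow> length as = Suc r \<Longrightarrow> \<zero> \<in> boundary_set R as"
    and P: "prime_chain R l P"
  shows "l \<le> r"
proof (rule ccontr)
  assume "\<not> l \<le> r"
  then have r: "Suc r \<le> l" by simp
  have "\<exists>a. a \<in> P (Suc i) - P i" if "i < Suc r" for i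
  proof -
    have "P i \<subset> P (Suc i)" using P that r by (simp add: prime_chain_def)
    then show ?thesis by blast
  qed
  then obtain a where a: "\<And>i. i < Suc r \<Longrightarrow> a i \<in> P (Suc i) - P i" by metis
  have prime: "primeideal (P i) R" if "i \<le> Suc r" for i
    using P that r by (simp add: prime_chain_def)
  interpret P0: primeideal "P 0" R using prime by simp
  have "a i \<in> carrier R" if "i < Suc r" for i
  proof -
    interpret P: primeideal "P (Suc i)" R using prime that by simp
    show ?thesis using a[OF that] P.Icarr by blast
  qed
  then have car: "set (map a [0..<Suc r]) \<subseteq> carrier R" by (auto simp del: upt_Suc)
  have "\<zero> \<notin> P 0"
  proof (rule boundary_set_prime_chain[of "map a [0..<Suc r]" R P])
    show "\<zero> \<in> boundary_set R (map a [0..<Suc r])" by (rule assms(1)[OF car]) simp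
    show "map a [0..<Suc r] ! i \<in> P (Suc i) - P i" if "i < length (map a [0..<Suc r])" for i
      using a[of i] that by (simp del: upt_Suc)
    show "P i \<subseteq> P (Suc i)" if "i < length (map a [0..<Suc r])" for i
    proof -
      have "P i \<subset> P (Suc i)" using P r that by (simp add: prime_chain_def)
      then show ?thesis by blast
    qed
  qed (use prime car in auto)
  then show False by simp
qed

lemma height_le:
  fixes R (structure)
  assumes "\<And>as. set as \<subseteq> carrier R \<Longrightarrow> length as = Suc r \<Longrightarrow> \<zero> \<in> boundary_set R as"
  shows "height R P \<le> enat r"
  unfolding height_def
  by (rule Sup_least) (use prime_chain_length_bound[of R r, OF assms] in auto)

text \<open>
  Nakayama's lemma for \<open>N / J\<close> localized at \<open>M\<close>: if this module is nonzero, then so is its quotient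
  by \<open>z\<close>.
\<close>

lemma annihilator_mod_nonzerodivisor:
  fixes R (structure)
  assumes "cring R" "noetherian_ring R" "maximalideal M R" and J: "ideal J R" and N: "ideal N R" "J \<subseteq> N"
    and z: "z \<in> M" "\<And>r. r \<in> carrier R \<Longrightarrow> z \<otimes> r \<in> N \<Longrightarrow> r \<in> N"
    and y: "y \<in> N" "\<And>s. s \<in> carrier R \<Longrightarrow> s \<otimes> y \<in> J \<Longrightarrow> s \<in> M"
    and znzd: "\<And>r. r \<in> carrier R \<Longrightarrow> z \<otimes> r \<in> J \<Longrightarrow> r \<in> J"
  shows "\<exists>y'\<in>N. \<forall>s\<in>carrier R. \<forall>j\<in>J. \<forall>r\<in>carrier R. s \<otimes> y' = j \<oplus> z \<otimes> r \<longrightarrow> s \<in> M"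
proof -
  interpret cring R by fact
  interpret noetherian_ring R by fact
  interpret J: ideal J R by fact
  interpret N: ideal N R by fact
  have Mp: "primeideal M R" using maximalideal_prime assms(3) by blast
  then interpret M: primeideal M R .
  have zc: "z \<in> carrier R" using z M.Icarr by blast
  define L where "L y = {w \<in> carrier R. \<exists>s\<in>carrier R - M. \<exists>j\<in>J. \<exists>r\<in>carrier R. s \<otimes> w = j \<oplus> y \<otimes> r}" for y
  define A where "A = {y \<in> N. \<forall>s\<in>carrier R. s \<otimes> y \<in> J \<longrightarrow> s \<in> M}"
  have one: "\<one> \<notin> M" using M.I_notcarr M.one_imp_carrier by blast
  have L_ideal: "ideal (L y) R" if yc: "y \<in> carrier R" for y
  proof (rule cring_idealI)
    show "\<zero> \<in> L y"
      unfolding L_def using yc one by (auto intro!: bexI[of _ \<one>] bexI[of _ \<zero>])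
    fix a b assume "a \<in> L y" "b \<in> L y"
    then obtain s j r s' j' r' where *: "s \<in> carrier R" "s \<notin> M" "s' \<in> carrier R" "s' \<notin> M" "j \<in> J" "j' \<in> J"
      "r \<in> carrier R" "r' \<in> carrier R" and eq: "s \<otimes> a = j \<oplus> y \<otimes> r" "s' \<otimes> b = j' \<oplus> y \<otimes> r'"
      and ab: "a \<in> carrier R" "b \<in> carrier R"
      unfolding L_def by blast
    have "(s \<otimes> s') \<otimes> (a \<oplus> b) = s' \<otimes> (s \<otimes> a) \<oplus> s \<otimes> (s' \<otimes> b)"
      using * ab by (simp add: r_distr m_ac)
    also have "\<dots> = (s' \<otimes> j \<oplus> s \<otimes> j') \<oplus> y \<otimes> (s' \<otimes> r \<oplus> s \<otimes> r')"
      unfolding eq using * yc by (simp add: r_distr m_ac a_ac J.Icarr)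
    finally show "a \<oplus> b \<in> L y"
      unfolding L_def using * ab M.I_prime[of s s']
      by (intro CollectI conjI bexI[of _ "s \<otimes> s'"] bexI[of _ "s' \<otimes> j \<oplus> s \<otimes> j'"] bexI[of _ "s' \<otimes> r \<oplus> s \<otimes> r'"])
        (auto simp: J.I_l_closed)
  next
    fix t a assume t: "t \<in> carrier R" and "a \<in> L y"
    then obtain s j r where *: "s \<in> carrier R" "s \<notin> M" "j \<in> J" "r \<in> carrier R" "s \<otimes> a = j \<oplus> y \<otimes> r"
      "a \<in> carrier R" unfolding L_def by blast
    have "s \<otimes> (t \<otimes> a) = t \<otimes> (s \<otimes> a)" using *(1,6) t by (simp add: m_lcomm)
    also have "\<dots> = t \<otimes> j \<oplus> y \<otimes> (t \<otimes> r)" using * t yc by (simp add: r_distr m_ac J.Icarr)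
    finally show "t \<otimes> a \<in> L y" unfolding L_def using * t
      by (intro CollectI conjI bexI[of _ s] bexI[of _ "t \<otimes> j"] bexI[of _ "t \<otimes> r"]) (auto simp: J.I_l_closed)
  qed (auto simp: L_def)
  have "\<exists>K\<in>L ` A. \<forall>K'\<in>L ` A. K \<subseteq> K' \<longrightarrow> K' = K"
  proof (rule ideal_set_has_maximal)
    show "L ` A \<noteq> {}" using y by (auto simp: A_def)
    show "ideal K R" if "K \<in> L ` A" for K
      using that L_ideal N.Icarr by (auto simp: A_def)
  qed
  then obtain y0 where y0: "y0 \<in> A" and max: "\<And>y'. y' \<in> A \<Longrightarrow> L y0 \<subseteq> L y' \<Longrightarrow> L y' = L y0"
    by blast
  have y0c: "y0 \<in> carrier R" using y0 N.Icarr by (simp add: A_def)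
  have key: "s \<in> M" if s: "s \<in> carrier R" "j \<in> J" "r \<in> carrier R" and eq: "s \<otimes> y0 = j \<oplus> z \<otimes> r" for s j r
  proof (rule ccontr)
    assume sM: "s \<notin> M"
    have jc: "j \<in> carrier R" using s by (simp add: J.Icarr)
    have "z \<otimes> r = s \<otimes> y0 \<ominus> j" unfolding eq using jc zc s
      by (simp add: a_minus_def a_ac r_neg2 r_neg1)
    moreover have "s \<otimes> y0 \<in> N" using y0 s by (simp add: A_def N.I_l_closed)
    ultimately have "z \<otimes> r \<in> N" using s N(2) by (auto simp: a_minus_def)
    then have rN: "r \<in> N" using z(2) s by blast
    have rA: "r \<in> A"
      unfolding A_def
    proof (intro CollectI conjI ballI impI rN)
      fix t assume t: "t \<in> carrier R" "t \<otimes> r \<in> J"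
      have "(t \<otimes> s) \<otimes> y0 = t \<otimes> (j \<oplus> z \<otimes> r)" using t s y0c by (simp add: m_assoc eq)
      also have "\<dots> = t \<otimes> j \<oplus> z \<otimes> (t \<otimes> r)" using t s jc zc by (simp add: r_distr m_ac)
      also have "\<dots> \<in> J" using t s zc by (simp add: J.I_l_closed)
      finally have "t \<otimes> s \<in> M" using y0 t s by (auto simp: A_def)
      then show "t \<in> M" using M.I_prime[of t s] t s sM by blast
    qed
    have "L y0 \<subseteq> L r"
    proof
      fix w assume "w \<in> L y0"
      then obtain t i q where t: "t \<in> carrier R" "t \<notin> M" "i \<in> J" "q \<in> carrier R" "w \<in> carrier R"
        and eqt: "t \<otimes> w = i \<oplus> y0 \<otimes> q" unfolding L_def by blast
      have ic: "i \<in> carrier R" using t by (simp add: J.Icarr)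
      have "(s \<otimes> t) \<otimes> w = s \<otimes> (i \<oplus> y0 \<otimes> q)" using s t by (simp add: m_assoc eqt)
      also have "\<dots> = s \<otimes> i \<oplus> q \<otimes> (s \<otimes> y0)" using s t ic y0c by (simp add: r_distr m_ac)
      also have "\<dots> = (s \<otimes> i \<oplus> q \<otimes> j) \<oplus> r \<otimes> (z \<otimes> q)"
        unfolding eq using s t ic jc zc by (simp add: r_distr m_ac a_ac)
      finally show "w \<in> L r" unfolding L_def using s t zc sM M.I_prime[of s t]
        by (intro CollectI conjI bexI[of _ "s \<otimes> t"] bexI[of _ "s \<otimes> i \<oplus> q \<otimes> j"] bexI[of _ "z \<otimes> q"])
          (auto simp: J.I_l_closed)
    qed
    then have "L r = L y0" using max rA by blast
    moreover have "r \<in> L r" unfolding L_def using one s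
      by (intro CollectI conjI bexI[of _ \<one>] bexI[of _ \<zero>]) auto
    ultimately have "r \<in> L y0" by simp
    then obtain t i q where t: "t \<in> carrier R" "t \<notin> M" "i \<in> J" "q \<in> carrier R"
      and eqt: "t \<otimes> r = i \<oplus> y0 \<otimes> q" unfolding L_def by blast
    have ic: "i \<in> carrier R" using t by (simp add: J.Icarr)
    have "(s \<otimes> t) \<otimes> r = s \<otimes> (i \<oplus> y0 \<otimes> q)" using s t by (simp add: m_assoc eqt)
    also have "\<dots> = s \<otimes> i \<oplus> q \<otimes> (s \<otimes> y0)" using s t ic y0c by (simp add: r_distr m_ac)
    also have "\<dots> = (s \<otimes> i \<oplus> q \<otimes> j) \<oplus> (q \<otimes> z) \<otimes> r"
      unfolding eq using s t ic jc zc by (simp add: r_distr m_ac a_ac)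
    finally have e2: "(s \<otimes> t) \<otimes> r = (s \<otimes> i \<oplus> q \<otimes> j) \<oplus> (q \<otimes> z) \<otimes> r" .
    have "(s \<otimes> t \<ominus> q \<otimes> z) \<otimes> r = (s \<otimes> t) \<otimes> r \<ominus> (q \<otimes> z) \<otimes> r"
      using s t zc by (simp add: a_minus_def l_distr l_minus)
    also have "\<dots> = s \<otimes> i \<oplus> q \<otimes> j"
      unfolding e2 using s t zc ic jc by (simp add: a_minus_def a_assoc r_neg)
    also have "\<dots> \<in> J" using s t by (simp add: J.I_l_closed)
    finally have "s \<otimes> t \<ominus> q \<otimes> z \<in> M" using rA s t zc by (auto simp: A_def)
    moreover have "q \<otimes> z \<in> M" using t z by (simp add: M.I_l_closed)
    ultimately have "s \<otimes> t \<ominus> q \<otimes> z \<oplus> q \<otimes> z \<in> M" by simp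
    moreover have "s \<otimes> t \<ominus> q \<otimes> z \<oplus> q \<otimes> z = s \<otimes> t"
      using s t zc by (simp add: a_minus_def a_assoc l_neg)
    ultimately have "s \<otimes> t \<in> M" by simp
    then show False using M.I_prime[of s t] s t sM by blast
  qed
  have "y0 \<in> N" using y0 by (simp add: A_def)
  then show ?thesis using key by blast
qed

lemma regular_sequence_boundary_set:
  fixes R (structure)
  assumes "cring R" "noetherian_ring R" "maximalideal M R"
    and "set ys \<subseteq> carrier R" "set zs \<subseteq> M"
    and "\<And>i r. i < length zs \<Longrightarrow> r \<in> carrier R \<Longrightarrow>
      zs ! i \<otimes> r \<in> Idl (set (take i zs) \<union> set ys) \<Longrightarrow> r \<in> Idl (set (take i zs) \<union> set ys)"
    and "y \<in> carrier R" "\<And>s. s \<in> carrier R \<Longrightarrow> s \<otimes> y \<in> Idl (set ys) \<Longrightarrow> s \<in> M"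
    and "e \<in> boundary_set R zs" "e \<otimes> y \<in> Idl (set ys)"
  shows False
  using assms(4-)
proof (induction zs arbitrary: ys y e)
  case Nil
  interpret cring R by fact
  interpret M: maximalideal M R by fact
  have "\<one> \<in> M" using Nil.prems(5)[of \<one>] Nil.prems(4,6,7) by simp
  then show ?case using M.I_notcarr M.one_imp_carrier by auto
next
  case (Cons z zs)
  interpret cring R by fact
  interpret M: maximalideal M R by fact
  interpret J: ideal "Idl (set ys)" R by (rule genideal_ideal[OF Cons.prems(1)])
  have zc: "z \<in> carrier R" and zM: "z \<in> M" using Cons.prems(2) by (auto simp: M.Icarr)
  have zsc: "set zs \<subseteq> carrier R" using Cons.prems(2) by (auto simp: M.Icarr)
  have znzd: "r \<in> Idl (set ys)" if "r \<in> carrier R" "z \<otimes> r \<in> Idl (set ys)" for r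
    using Cons.prems(3)[of 0 r] that by simp
  obtain g h and k :: nat where e: "e = z [^] k \<otimes> (g \<oplus> z \<otimes> h)"
    and g: "g \<in> boundary_set R zs" and h: "h \<in> carrier R" using Cons.prems by auto
  have gc: "g \<in> carrier R" by (rule boundary_set_closed[OF zsc g])
  define w where "w = g \<oplus> z \<otimes> h"
  have wc: "w \<in> carrier R" using gc h zc by (simp add: w_def)
  have pow: "r \<in> Idl (set ys)" if "r \<in> carrier R" "z [^] k \<otimes> r \<in> Idl (set ys)" for r and k :: nat
    using that
  proof (induction k arbitrary: r)
    case (Suc k)
    have "z [^] k \<otimes> (z \<otimes> r) \<in> Idl (set ys)" using Suc.prems zc by (simp add: m_assoc)
    then have "z \<otimes> r \<in> Idl (set ys)" by (rule Suc.IH[rotated]) (use zc Suc.prems in simp)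
    then show ?case by (rule znzd[OF Suc.prems(1)])
  qed simp
  define N where "N = {y \<in> carrier R. w \<otimes> y \<in> Idl (set ys)}"
  have N: "ideal N R" unfolding N_def by (rule J.helper_max_prime) (use is_cring wc in auto)
  have yN: "y \<in> N"
    using Cons.prems(7) pow[of "w \<otimes> y" k] zc wc Cons.prems(4) by (simp add: N_def e m_assoc flip: w_def)
  have JN: "Idl (set ys) \<subseteq> N" unfolding N_def using wc by (auto simp: J.Icarr J.I_l_closed)
  have zN: "r \<in> N" if "r \<in> carrier R" "z \<otimes> r \<in> N" for r
    using that zc wc znzd[of "w \<otimes> r"] by (simp add: N_def m_lcomm)
  have "\<exists>y'\<in>N. \<forall>s\<in>carrier R. \<forall>j\<in>Idl (set ys). \<forall>r\<in>carrier R. s \<otimes> y' = j \<oplus> z \<otimes> r \<longrightarrow> s \<in> M"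
    by (rule annihilator_mod_nonzerodivisor[OF assms(1-3) J.is_ideal N JN zM zN yN Cons.prems(5) znzd])
  then obtain y' where y': "y' \<in> N"
    "\<forall>s\<in>carrier R. \<forall>j\<in>Idl (set ys). \<forall>r\<in>carrier R. s \<otimes> y' = j \<oplus> z \<otimes> r \<longrightarrow> s \<in> M"
    by blast
  have y'c: "y' \<in> carrier R" using y' by (simp add: N_def)
  have ins: "Idl (set (z # ys)) = {j \<oplus> z \<otimes> r | j r. j \<in> Idl (set ys) \<and> r \<in> carrier R}"
    using genideal_insert[OF Cons.prems(1) zc] by simp
  show False
  proof (rule Cons.IH[of "z # ys" y' g])
    show "set (z # ys) \<subseteq> carrier R" using zc Cons.prems(1) by simp
    show "set zs \<subseteq> M" using Cons.prems(2) by simp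
    show "r \<in> Idl (set (take i zs) \<union> set (z # ys))"
      if "i < length zs" "r \<in> carrier R" "zs ! i \<otimes> r \<in> Idl (set (take i zs) \<union> set (z # ys))" for i r
      using Cons.prems(3)[of "Suc i" r] that by simp
    show "s \<in> M" if "s \<in> carrier R" "s \<otimes> y' \<in> Idl (set (z # ys))" for s
      using that y'(2) unfolding ins by blast
    have "w \<otimes> y' \<in> Idl (set ys)" using y' by (simp add: N_def)
    moreover have "g \<otimes> y' = w \<otimes> y' \<oplus> z \<otimes> (\<ominus> (h \<otimes> y'))"
      using gc zc h y'c by (simp add: w_def l_distr r_minus m_assoc a_assoc r_neg)
    ultimately show "g \<otimes> y' \<in> Idl (set (z # ys))"
      unfolding ins using h y'c by blast
  qed (use y'c g in auto)
qed

lemma depth_le: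
  fixes R (structure)
  assumes "cring R" "noetherian_ring R" "maximalideal M R"
    and y: "y \<in> carrier R" "\<And>s. s \<in> carrier R \<Longrightarrow> s \<otimes> y = \<zero> \<Longrightarrow> s \<in> M"
    and dep: "\<And>zs. set zs \<subseteq> M \<Longrightarrow> length zs = Suc r \<Longrightarrow> \<exists>e\<in>boundary_set R zs. e \<otimes> y = \<zero>"
  shows "depth R M \<le> enat r"
  unfolding depth_def
proof (rule Sup_least)
  fix l assume "l \<in> {enat (length xs) | xs. set xs \<subseteq> M \<and> regular_sequence R xs}"
  then obtain xs where xs: "l = enat (length xs)" "set xs \<subseteq> M" "regular_sequence R xs" by auto
  interpret cring R by fact
  have Idl_empty: "Idl {} = {\<zero>}"
    using genideal_minimal[OF zeroideal, of "{}"] genideal_ideal[of "{}"]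
    by (auto simp: additive_subgroup.zero_closed ideal.axioms(1))
  show "l \<le> enat r"
  proof (rule ccontr)
    assume "\<not> l \<le> enat r"
    then have len: "Suc r \<le> length xs" using xs(1) by simp
    let ?zs = "take (Suc r) xs"
    have "set ?zs \<subseteq> M" using xs(2) set_take_subset[of "Suc r" xs] by blast
    then obtain e where e: "e \<in> boundary_set R ?zs" "e \<otimes> y = \<zero>"
      using dep[of ?zs] len by auto
    show False
    proof (rule regular_sequence_boundary_set[OF assms(1-3), of "[]" ?zs y e])
      show "b \<in> Idl (set (take i ?zs) \<union> set [])" if "i < length ?zs" "b \<in> carrier R"
        "?zs ! i \<otimes> b \<in> Idl (set (take i ?zs) \<union> set [])" for i b
      proof -
        have "i < Suc r" using that(1) len by simp
        then have i: "i < length xs" "?zs ! i = xs ! i" "take i ?zs = take i xs" using len by (auto simp: min_def)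
        show ?thesis using xs(3) that(2,3) i unfolding regular_sequence_def by simp
      qed
    qed (use e y xs \<open>set ?zs \<subseteq> M\<close> Idl_empty in auto)
  qed
qed

section \<open>Quotient rings\<close>

context ring
begin

lemma Quot_mem_image_iff:
  assumes "ideal I R" "ideal K R" "I \<subseteq> K" "a \<in> carrier R"
  shows "I +> a \<in> (+>) I ` K \<longleftrightarrow> a \<in> K"
proof -
  have "(+>) I ` K \<subseteq> carrier (R Quot I)"
    using assms(2) ideal.Icarr by (fastforce simp: FactRing_simps)
  then have "a \<in> \<Union> ((+>) I ` K) \<longleftrightarrow> I +> a \<in> (+>) I ` K"
    by (rule canonical_proj_vimage_mem_iff[OF assms(1) _ assms(4)])
  moreover have "K = \<Union> ((+>) I ` K)" using ideal_incl_iff[OF assms(1,2)] assms(3) by simp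
  ultimately show ?thesis by metis
qed

lemma Quot_carrier: "carrier (R Quot I) = (+>) I ` carrier R"
  by (auto simp: FactRing_simps)

lemma Quot_list_lift:
  assumes "set as \<subseteq> (+>) I ` X"
  obtains as' where "as = map ((+>) I) as'" "set as' \<subseteq> X"
proof -
  have "\<forall>z\<in>set as. \<exists>z'. z' \<in> X \<and> z = I +> z'" using assms by blast
  then obtain g where "\<forall>z\<in>set as. g z \<in> X \<and> z = I +> g z" by metis
  then show thesis by (intro that[of "map g as"]) (auto simp: map_idI)
qed

lemma Quot_zero: "\<zero>\<^bsub>R Quot I\<^esub> = I"
  by (simp add: FactRing_def)

lemma Quot_eq_zero_iff:
  assumes "ideal I R" "a \<in> carrier R"
  shows "I +> a = \<zero>\<^bsub>R Quot I\<^esub> \<longleftrightarrow> a \<in> I"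
  using assms by (simp add: Quot_zero ideal.rcos_const_imp_mem a_rcos_zero) (metis a_rcos_zero ideal.rcos_const_imp_mem)

lemma Quot_vimage:
  assumes I: "ideal I R" and J: "ideal J (R Quot I)"
  shows "ideal {a \<in> carrier R. I +> a \<in> J} R" "I \<subseteq> {a \<in> carrier R. I +> a \<in> J}"
    "(+>) I ` {a \<in> carrier R. I +> a \<in> J} = J"
proof -
  interpret h: ring_hom_ring R "R Quot I" "(+>) I" by (rule ideal.rcos_ring_hom_ring[OF I])
  interpret J: ideal J "R Quot I" by fact
  interpret I: ideal I R by fact
  show "ideal {a \<in> carrier R. I +> a \<in> J} R" by (rule h.ideal_vimage[OF J])
  show "I \<subseteq> {a \<in> carrier R. I +> a \<in> J}"
  proof
    fix a assume a: "a \<in> I"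
    then have "I +> a = \<zero>\<^bsub>R Quot I\<^esub>" using Quot_eq_zero_iff[OF I] I.Icarr by simp
    moreover have "\<zero>\<^bsub>R Quot I\<^esub> \<in> J" by simp
    ultimately show "a \<in> {a \<in> carrier R. I +> a \<in> J}" using a I.Icarr by simp
  qed
  show "(+>) I ` {a \<in> carrier R. I +> a \<in> J} = J"
    using J.Icarr by (auto simp: Quot_carrier)
qed

lemma Quot_genideal:
  assumes I: "ideal I R" and X: "X \<subseteq> carrier R"
  shows "Idl\<^bsub>R Quot I\<^esub> ((+>) I ` X) = (+>) I ` (Idl (I \<union> X))"
proof
  interpret I: ideal I R by fact
  interpret Q: ring "R Quot I" by (rule ideal.quotient_is_ring[OF I])
  have car: "I \<union> X \<subseteq> carrier R" using X I.Icarr by auto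
  have sub: "I \<union> X \<subseteq> Idl (I \<union> X)" by (rule genideal_self[OF car])
  have im: "ideal ((+>) I ` (Idl (I \<union> X))) (R Quot I)"
    by (rule ring_ideal_imp_quot_ideal[OF I genideal_ideal[OF car]])
  show "Idl\<^bsub>R Quot I\<^esub> ((+>) I ` X) \<subseteq> (+>) I ` (Idl (I \<union> X))"
    by (rule Q.genideal_minimal[OF im]) (use sub in auto)
  have Xc: "(+>) I ` X \<subseteq> carrier (R Quot I)" using X by (auto simp: Quot_carrier)
  let ?K = "{a \<in> carrier R. I +> a \<in> Idl\<^bsub>R Quot I\<^esub> ((+>) I ` X)}"
  note K = Quot_vimage[OF I Q.genideal_ideal[OF Xc]]
  have "X \<subseteq> ?K" using Q.genideal_self[OF Xc] X by auto
  then have "Idl (I \<union> X) \<subseteq> ?K" using K(2) by (intro genideal_minimal[OF K(1)]) simp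
  then show "(+>) I ` (Idl (I \<union> X)) \<subseteq> Idl\<^bsub>R Quot I\<^esub> ((+>) I ` X)" using K(3) by blast
qed

lemma Quot_mem_genideal_iff:
  assumes I: "ideal I R" and X: "X \<subseteq> carrier R" and a: "a \<in> carrier R"
  shows "I +> a \<in> Idl\<^bsub>R Quot I\<^esub> ((+>) I ` X) \<longleftrightarrow> a \<in> Idl (I \<union> X)"
proof -
  have car: "I \<union> X \<subseteq> carrier R" using X ideal.Icarr[OF I] by auto
  show ?thesis unfolding Quot_genideal[OF I X]
    using genideal_self[OF car] by (intro Quot_mem_image_iff[OF I genideal_ideal[OF car] _ a]) simp
qed

end

lemma (in noetherian_ring) Quot_noetherian:
  assumes I: "ideal I R"
  shows "noetherian_ring (R Quot I)"
proof -
  interpret Q: ring "R Quot I" by (rule ideal.quotient_is_ring[OF I])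
  show ?thesis
  proof (rule Q.noetherian_ringI)
    fix J assume "ideal J (R Quot I)"
    note K = Quot_vimage[OF I this]
    obtain A where A: "A \<subseteq> carrier R" "finite A" "{a \<in> carrier R. I +> a \<in> J} = Idl A"
      using finetely_gen[OF K(1)] by auto
    have car: "I \<union> A \<subseteq> carrier R" using A(1) ideal.Icarr[OF I] by auto
    have "Idl (I \<union> A) \<subseteq> Idl A"
      using K(1,2) genideal_self[OF A(1)] unfolding A(3) by (intro genideal_minimal) auto
    moreover have "Idl A \<subseteq> Idl (I \<union> A)" using car by (intro subset_Idl_subset) auto
    ultimately have "Idl\<^bsub>R Quot I\<^esub> ((+>) I ` A) = J"
      using Quot_genideal[OF I A(1)] K(3) A(3) by auto
    then show "\<exists>A\<subseteq>carrier (R Quot I). finite A \<and> J = Idl\<^bsub>R Quot I\<^esub> A"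
      using A by (intro exI[of _ "(+>) I ` A"]) (auto simp: Quot_carrier)
  qed
qed

context cring
begin

lemma Quot_primeideal:
  assumes I: "ideal I R" and P: "primeideal P R" "I \<subseteq> P"
  shows "primeideal ((+>) I ` P) (R Quot I)"
proof (rule primeidealI)
  interpret P: primeideal P R by fact
  interpret h: ring_hom_ring R "R Quot I" "(+>) I" by (rule ideal.rcos_ring_hom_ring[OF I])
  show "ideal ((+>) I ` P) (R Quot I)" by (rule ring_ideal_imp_quot_ideal[OF I P.is_ideal])
  show "cring (R Quot I)" by (rule ideal.quotient_is_cring[OF I is_cring])
  have one: "\<one> \<notin> P" using P.I_notcarr P.one_imp_carrier by blast
  then have "I +> \<one> \<notin> (+>) I ` P" using Quot_mem_image_iff[OF I P.is_ideal P(2) one_closed] by blast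
  then show "carrier (R Quot I) \<noteq> (+>) I ` P" unfolding Quot_carrier using one_closed by blast
  fix a b assume "a \<in> carrier (R Quot I)" "b \<in> carrier (R Quot I)" and ab: "a \<otimes>\<^bsub>R Quot I\<^esub> b \<in> (+>) I ` P"
  then obtain a' b' where *: "a = I +> a'" "b = I +> b'" "a' \<in> carrier R" "b' \<in> carrier R"
    by (auto simp: Quot_carrier)
  then have "I +> (a' \<otimes> b') \<in> (+>) I ` P" using ab by simp
  then have "a' \<otimes> b' \<in> P" using Quot_mem_image_iff[OF I P.is_ideal P(2) m_closed[OF *(3,4)]] by blast
  then have "a' \<in> P \<or> b' \<in> P" using P.I_prime *(3,4) by simp
  then show "a \<in> (+>) I ` P \<or> b \<in> (+>) I ` P" unfolding *(1,2) by auto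
qed

lemma Quot_maximalideal:
  assumes I: "ideal I R" and P: "maximalideal P R" "I \<subseteq> P"
  shows "maximalideal ((+>) I ` P) (R Quot I)"
proof (rule maximalidealI)
  interpret P: maximalideal P R by fact
  show "ideal ((+>) I ` P) (R Quot I)" by (rule ring_ideal_imp_quot_ideal[OF I P.is_ideal])
  have one: "\<one> \<notin> P" using P.I_notcarr P.one_imp_carrier by blast
  then have "I +> \<one> \<notin> (+>) I ` P" using Quot_mem_image_iff[OF I P.is_ideal P(2) one_closed] by blast
  then show "carrier (R Quot I) \<noteq> (+>) I ` P" unfolding Quot_carrier using one_closed by blast
  fix J assume J: "ideal J (R Quot I)" "(+>) I ` P \<subseteq> J"
  note K = Quot_vimage[OF I J(1)]
  have "P \<subseteq> {a \<in> carrier R. I +> a \<in> J}" using J(2) P.Icarr by auto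
  then have "{a \<in> carrier R. I +> a \<in> J} = P \<or> {a \<in> carrier R. I +> a \<in> J} = carrier R"
    using P.I_maximal[OF K(1)] by auto
  then show "J = (+>) I ` P \<or> J = carrier (R Quot I)"
  proof
    assume e: "{a \<in> carrier R. I +> a \<in> J} = P"
    show ?thesis using K(3) unfolding e by simp
  next
    assume e: "{a \<in> carrier R. I +> a \<in> J} = carrier R"
    show ?thesis using K(3) unfolding e by (simp add: Quot_carrier)
  qed
qed

lemma Quot_maximalideal_vimage:
  assumes I: "ideal I R" and P: "maximalideal P (R Quot I)"
  shows "maximalideal {a \<in> carrier R. I +> a \<in> P} R"
proof (rule maximalidealI)
  interpret P: maximalideal P "R Quot I" by fact
  note K = Quot_vimage[OF I P.is_ideal]
  show "ideal {a \<in> carrier R. I +> a \<in> P} R" by (rule K)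
  show "carrier R \<noteq> {a \<in> carrier R. I +> a \<in> P}"
  proof
    assume e: "carrier R = {a \<in> carrier R. I +> a \<in> P}"
    show False using K(3) P.I_notcarr unfolding e[symmetric] by (simp add: Quot_carrier)
  qed
  fix J assume J: "ideal J R" "{a \<in> carrier R. I +> a \<in> P} \<subseteq> J" "J \<subseteq> carrier R"
  have IJ: "I \<subseteq> J" using J K(2) by auto
  have "P \<subseteq> (+>) I ` J" using K(3) J(2) by blast
  then have "(+>) I ` J = P \<or> (+>) I ` J = carrier (R Quot I)"
    using J(3) by (intro P.I_maximal ring_ideal_imp_quot_ideal[OF I J(1)]) (auto simp: Quot_carrier)
  moreover have "J = {a \<in> carrier R. I +> a \<in> (+>) I ` J}"
    using Quot_mem_image_iff[OF I J(1) IJ] J(3) by auto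
  ultimately show "J = {a \<in> carrier R. I +> a \<in> P} \<or> J = carrier R"
    by (auto simp: Quot_carrier)
qed

lemma Quot_regular_sequence:
  assumes I: "ideal I R" and zs: "set zs \<subseteq> carrier R"
    and nzd: "\<And>i r. i < length zs \<Longrightarrow> r \<in> carrier R \<Longrightarrow>
      zs ! i \<otimes> r \<in> Idl (I \<union> set (take i zs)) \<Longrightarrow> r \<in> Idl (I \<union> set (take i zs))"
    and proper: "Idl (I \<union> set zs) \<noteq> carrier R"
  shows "regular_sequence (R Quot I) (map ((+>) I) zs)"
  unfolding regular_sequence_def
proof (intro conjI allI impI ballI)
  interpret h: ring_hom_ring R "R Quot I" "(+>) I" by (rule ideal.rcos_ring_hom_ring[OF I])
  show "set (map ((+>) I) zs) \<subseteq> carrier (R Quot I)" using zs by (auto simp: Quot_carrier)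
  have car: "set (take i zs) \<subseteq> carrier R" for i using zs set_take_subset[of i zs] by blast
  fix i r assume i: "i < length (map ((+>) I) zs)" and r: "r \<in> carrier (R Quot I)"
    and mem: "map ((+>) I) zs ! i \<otimes>\<^bsub>R Quot I\<^esub> r \<in> Idl\<^bsub>R Quot I\<^esub> (set (take i (map ((+>) I) zs)))"
  obtain r' where r': "r = I +> r'" "r' \<in> carrier R" using r by (auto simp: Quot_carrier)
  have zi: "zs ! i \<in> carrier R" using i zs by auto
  have "I +> (zs ! i \<otimes> r') \<in> Idl\<^bsub>R Quot I\<^esub> ((+>) I ` set (take i zs))"
    using mem i r' zi by (simp add: take_map)
  then have "zs ! i \<otimes> r' \<in> Idl (I \<union> set (take i zs))"
    using Quot_mem_genideal_iff[OF I car m_closed[OF zi r'(2)]] by blast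
  then have "r' \<in> Idl (I \<union> set (take i zs))" using nzd i r' by simp
  then show "r \<in> Idl\<^bsub>R Quot I\<^esub> (set (take i (map ((+>) I) zs)))"
    using Quot_mem_genideal_iff[OF I car] r' by (simp add: take_map)
next
  show "Idl\<^bsub>R Quot I\<^esub> (set (map ((+>) I) zs)) \<noteq> carrier (R Quot I)"
  proof
    assume "Idl\<^bsub>R Quot I\<^esub> (set (map ((+>) I) zs)) = carrier (R Quot I)"
    then have "I +> \<one> \<in> Idl\<^bsub>R Quot I\<^esub> ((+>) I ` set zs)" by (simp add: Quot_carrier)
    then have "\<one> \<in> Idl (I \<union> set zs)" using Quot_mem_genideal_iff[OF I zs] by simp
    moreover have "I \<union> set zs \<subseteq> carrier R" using zs ideal.Icarr[OF I] by auto
    ultimately show False using proper ideal.one_imp_carrier[OF genideal_ideal] by blast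
  qed
qed

lemma Quot_height_ge:
  assumes I: "ideal I R" and C: "prime_chain R l C" "\<And>i. i \<le> l \<Longrightarrow> I \<subseteq> C i"
  shows "enat l \<le> height (R Quot I) ((+>) I ` C l)"
  unfolding height_def
proof (rule Sup_upper)
  have prime: "primeideal (C i) R" if "i \<le> l" for i using that C(1) by (simp add: prime_chain_def)
  have id: "ideal (C i) R" if "i \<le> l" for i using prime[OF that] by (simp add: primeideal_def)
  have "prime_chain (R Quot I) l (\<lambda>i. (+>) I ` C i)"
    unfolding prime_chain_def
  proof (intro conjI allI impI)
    show "primeideal ((+>) I ` C i) (R Quot I)" if "i \<le> l" for i
      using Quot_primeideal[OF I prime C(2)] that by simp
    show "(+>) I ` C i \<subset> (+>) I ` C (Suc i)" if "i < l" for i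
    proof -
      have "C i \<subset> C (Suc i)" using C(1) that by (simp add: prime_chain_def)
      then obtain a where a: "a \<in> C (Suc i)" "a \<notin> C i" by blast
      have "a \<in> carrier R" using a id[of "Suc i"] that ideal.Icarr by fastforce
      then have "I +> a \<notin> (+>) I ` C i"
        using Quot_mem_image_iff[OF I id C(2), of i a] a that by simp
      then show ?thesis using a \<open>C i \<subset> C (Suc i)\<close> by blast
    qed
  qed
  then show "enat l \<in> {enat m | m. \<exists>P. prime_chain (R Quot I) m P \<and> P m = (+>) I ` C l}"
    by (intro CollectI exI[of _ l] conjI exI[of _ "\<lambda>i. (+>) I ` C i"]) auto
qed

end

section \<open>Polynomials and monomial ideals\<close>

abbreviation lookup :: "('a \<Rightarrow>\<^sub>0 'b::zero) \<Rightarrow> 'a \<Rightarrow> 'b" where "lookup \<equiv> Poly_Mapping.lookup"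
abbreviation keys :: "('a \<Rightarrow>\<^sub>0 'b::zero) \<Rightarrow> 'a set" where "keys \<equiv> Poly_Mapping.keys"
abbreviation single :: "'a \<Rightarrow> 'b \<Rightarrow> ('a \<Rightarrow>\<^sub>0 'b::zero)" where "single \<equiv> Poly_Mapping.single"

lemma poly_mapping_sum_single: "p = (\<Sum>w\<in>keys p. single w (lookup p w))"
  by (rule poly_mapping_eqI) (auto simp: lookup_sum lookup_single when_def sum.If_cases in_keys_iff)

lemma times_sum_single:
  fixes p q :: "('a::comm_monoid_add) \<Rightarrow>\<^sub>0 ('b::comm_semiring_1)"
  shows "p * q = (\<Sum>a\<in>keys p. \<Sum>b\<in>keys q. single (a + b) (lookup p a * lookup q b))"
  by (subst (1) poly_mapping_sum_single[of p], subst (1) poly_mapping_sum_single[of q])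
    (simp add: sum_product mult_single)

lemma lookup_times_unique:
  fixes p q :: "('a::comm_monoid_add) \<Rightarrow>\<^sub>0 ('b::comm_semiring_1)"
  assumes "\<And>a' b'. a' \<in> keys p \<Longrightarrow> b' \<in> keys q \<Longrightarrow> a' + b' = a + b \<Longrightarrow> a' = a \<and> b' = b"
  shows "lookup (p * q) (a + b) = lookup p a * lookup q b"
proof -
  have "lookup (p * q) (a + b)
      = (\<Sum>a'\<in>keys p. \<Sum>b'\<in>keys q. if a' + b' = a + b then lookup p a' * lookup q b' else 0)"
    by (simp add: times_sum_single[of p q] lookup_sum lookup_single when_def)
  also have "\<dots> = (\<Sum>a'\<in>keys p. \<Sum>b'\<in>keys q. if a' = a then (if b' = b then lookup p a * lookup q b else 0) else 0)"
    using assms by (intro sum.cong refl) auto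
  also have "\<dots> = (\<Sum>a'\<in>keys p. if a' = a then (\<Sum>b'\<in>keys q. if b' = b then lookup p a * lookup q b else 0) else 0)"
    by (intro sum.cong refl) auto
  also have "\<dots> = lookup p a * lookup q b"
    by (auto simp: sum.delta in_keys_iff)
  finally show ?thesis .
qed

lemma lookup_single_times:
  fixes p :: "('a::cancel_comm_monoid_add) \<Rightarrow>\<^sub>0 ('b::comm_semiring_1)"
  shows "lookup (single h c * p) (h + w) = c * lookup p w"
  by (subst lookup_times_unique) (auto split: if_splits)

lemma keys_single_times:
  fixes p :: "('a::cancel_comm_monoid_add) \<Rightarrow>\<^sub>0 ('b::comm_semiring_1)"
  shows "keys (single h c * p) \<subseteq> (+) h ` keys p"
  using keys_mult[of "single h c" p] by (auto split: if_splits)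

lemma zero_notin_keys_var_times:
  fixes p :: "monomial \<Rightarrow>\<^sub>0 'b::comm_semiring_1"
  shows "0 \<notin> keys (single (single i 1) c * p)"
proof
  assume "0 \<in> keys (single (single i 1) c * p)"
  then have "0 \<in> (+) (single i 1) ` keys p" using keys_single_times by (rule subsetD[rotated])
  then obtain w :: monomial where "0 = single i 1 + w" by blast
  then have "lookup 0 i = lookup (single i 1 + w) i" by simp
  then show False by (simp add: lookup_add)
qed

lemma monomial_diff_add:
  fixes a b :: monomial
  assumes "\<And>i. lookup a i \<le> lookup b i"
  shows "b = a + (b - a)"
  by (rule poly_mapping_eqI) (simp add: lookup_add lookup_minus assms)

lemma monomial_keys_add: "keys (a + b) = keys a \<union> keys (b :: monomial)"
  by (auto simp: in_keys_iff lookup_add)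

lemma monomial_nonneg: "0 \<le> (h :: monomial)"
  by (metis less_monomial_iff lookup_zero not_less not_less0)

definition polys :: "nat set \<Rightarrow> 'k::field mpoly set" where
  "polys X = {p. \<forall>w\<in>keys p. keys w \<subseteq> X}"

lemma polys_0 [simp]: "0 \<in> polys X" and polys_1 [simp]: "1 \<in> polys X"
  by (auto simp: polys_def)

lemma polys_uminus: "p \<in> polys X \<Longrightarrow> - p \<in> polys X"
  by (simp add: polys_def)

lemma polys_add: "p \<in> polys X \<Longrightarrow> q \<in> polys X \<Longrightarrow> p + q \<in> polys X"
  using Poly_Mapping.keys_add[of p q] by (auto simp: polys_def dest!: subsetD)

lemma polys_diff: "p \<in> polys X \<Longrightarrow> q \<in> polys X \<Longrightarrow> p - q \<in> polys X"
  using polys_add[of p X "- q"] polys_uminus[of q X] by simp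

lemma polys_mult: "p \<in> polys X \<Longrightarrow> q \<in> polys X \<Longrightarrow> p * q \<in> polys X"
  using keys_mult[of p q] by (fastforce simp: polys_def monomial_keys_add)

lemma polys_power: "p \<in> polys X \<Longrightarrow> p ^ n \<in> polys X"
  by (induction n) (auto intro: polys_mult)

lemma polys_sum: "(\<And>a. a \<in> A \<Longrightarrow> f a \<in> polys X) \<Longrightarrow> sum f A \<in> polys X"
  by (induction A rule: infinite_finite_induct) (auto intro: polys_add)

lemma polys_prod: "(\<And>a. a \<in> A \<Longrightarrow> f a \<in> polys X) \<Longrightarrow> prod f A \<in> polys X"
  by (induction A rule: infinite_finite_induct) (auto intro: polys_mult)

lemma polys_single: "keys w \<subseteq> X \<Longrightarrow> single w c \<in> polys X"
  by (auto simp: polys_def)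

lemma polys_mono: "X \<subseteq> Y \<Longrightarrow> polys X \<subseteq> polys Y"
  by (auto simp: polys_def)

lemma carrier_poly_ring [simp]: "carrier (poly_ring n) = polys {1..n}"
  and mult_poly_ring [simp]: "mult (poly_ring n) = (*)"
  and one_poly_ring [simp]: "one (poly_ring n) = 1"
  and zero_poly_ring [simp]: "zero (poly_ring n) = 0"
  and add_poly_ring [simp]: "add (poly_ring n) = (+)"
  by (simp_all add: poly_ring_def polys_def)

lemma ring_poly_ring: "ring (poly_ring n)"
  by (rule cring.axioms(1)[OF cring_poly_ring])

lemma pow_poly_ring [simp]: "p [^]\<^bsub>poly_ring n\<^esub> (k::nat) = p ^ k"
proof -
  interpret cring "poly_ring n" by (rule cring_poly_ring)
  show ?thesis by (induction k) (simp_all add: mult.commute)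
qed

lemma poly_ideal_iff:
  "ideal J (poly_ring n) \<longleftrightarrow> J \<subseteq> polys {1..n} \<and> 0 \<in> J \<and> (\<forall>a\<in>J. \<forall>b\<in>J. a + b \<in> J) \<and>
    (\<forall>r\<in>polys {1..n}. \<forall>a\<in>J. r * a \<in> J)" (is "?L = ?R")
proof
  assume ?L
  then interpret J: ideal J "poly_ring n" .
  show ?R
    using J.Icarr J.I_l_closed additive_subgroup.zero_closed[OF J.additive_subgroup_axioms]
      additive_subgroup.a_closed[OF J.additive_subgroup_axioms] by auto
next
  assume ?R
  then show ?L by (intro cring.cring_idealI[OF cring_poly_ring]) auto
qed

lemma poly_idealD:
  assumes "ideal J (poly_ring n)"
  shows "J \<subseteq> polys {1..n}" "0 \<in> J" "a \<in> J \<Longrightarrow> b \<in> J \<Longrightarrow> a + b \<in> J"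
    "r \<in> polys {1..n} \<Longrightarrow> a \<in> J \<Longrightarrow> r * a \<in> J" "r \<in> polys {1..n} \<Longrightarrow> a \<in> J \<Longrightarrow> a * r \<in> J"
    "a \<in> J \<Longrightarrow> - a \<in> J" "a \<in> J \<Longrightarrow> b \<in> J \<Longrightarrow> a - b \<in> J"
proof -
  note J = assms[unfolded poly_ideal_iff]
  show "J \<subseteq> polys {1..n}" "0 \<in> J" "a \<in> J \<Longrightarrow> b \<in> J \<Longrightarrow> a + b \<in> J"
    and mult: "\<And>r a. r \<in> polys {1..n} \<Longrightarrow> a \<in> J \<Longrightarrow> r * a \<in> J"
    using J by auto
  show "r \<in> polys {1..n} \<Longrightarrow> a \<in> J \<Longrightarrow> a * r \<in> J" using mult[of r a] by (simp add: mult.commute)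
  have uminus: "- a \<in> J" if "a \<in> J" for a
    using mult[of "- 1" a] that by (simp add: polys_uminus)
  then show "a \<in> J \<Longrightarrow> - a \<in> J" .
  show "a - b \<in> J" if "a \<in> J" "b \<in> J"
    using J uminus[OF that(2)] that(1) by (metis diff_conv_add_uminus)
qed

lemma poly_ideal_sum:
  assumes "ideal J (poly_ring n)" "\<And>a. a \<in> A \<Longrightarrow> f a \<in> J"
  shows "sum f A \<in> J"
  using assms(2)
  by (induction A rule: infinite_finite_induct)
    (auto intro: poly_idealD(2,3)[OF assms(1)])

definition upset :: "monomial set \<Rightarrow> bool" where
  "upset U \<longleftrightarrow> (\<forall>w\<in>U. \<forall>h. w + h \<in> U)"

definition monomial_ideal :: "nat \<Rightarrow> monomial set \<Rightarrow> 'k::field mpoly set" where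
  "monomial_ideal n U = {p \<in> polys {1..n}. keys p \<subseteq> U}"

lemma upsetD: "upset U \<Longrightarrow> w \<in> U \<Longrightarrow> w + h \<in> U" and upsetD2: "upset U \<Longrightarrow> w \<in> U \<Longrightarrow> h + w \<in> U"
  by (auto simp: upset_def add.commute)

lemma monomial_ideal_ideal:
  assumes "upset U"
  shows "ideal (monomial_ideal n U :: 'k::field mpoly set) (poly_ring n)"
  unfolding poly_ideal_iff
proof (intro conjI ballI)
  fix a b :: "'k mpoly" assume "a \<in> monomial_ideal n U" "b \<in> monomial_ideal n U"
  then show "a + b \<in> monomial_ideal n U"
    using Poly_Mapping.keys_add[of a b] by (auto simp: monomial_ideal_def polys_add)
next
  fix r a :: "'k mpoly" assume "r \<in> polys {1..n}" "a \<in> monomial_ideal n U"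
  then show "r * a \<in> monomial_ideal n U"
    using keys_mult[of r a] upsetD2[OF assms] by (fastforce simp: monomial_ideal_def polys_mult)
qed (auto simp: monomial_ideal_def)

definition multiples :: "monomial set \<Rightarrow> monomial set" where
  "multiples G = {g + h | g h. g \<in> G}"

lemma multiplesE: "w \<in> multiples G \<Longrightarrow> (\<And>g h. w = g + h \<Longrightarrow> g \<in> G \<Longrightarrow> thesis) \<Longrightarrow> thesis"
  by (auto simp: multiples_def)

lemma mem_multiples: "g \<in> G \<Longrightarrow> g \<in> multiples G"
  unfolding multiples_def by (intro CollectI exI[of _ g] exI[of _ 0]) simp

lemma upset_multiples: "upset (multiples G)"
  by (auto simp: upset_def multiples_def add.assoc) blast

lemma genideal_monomials:
  assumes "G \<subseteq> {w. keys w \<subseteq> {1..n}}"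
  shows "genideal (poly_ring n) ((\<lambda>w. single w (1::'k::field)) ` G) = monomial_ideal n (multiples G)"
proof
  interpret ring "poly_ring n :: 'k mpoly ring" by (rule ring_poly_ring)
  let ?X = "(\<lambda>w. single w (1::'k)) ` G"
  have X: "?X \<subseteq> carrier (poly_ring n)" using assms by (auto intro: polys_single)
  have "?X \<subseteq> monomial_ideal n (multiples G)"
    using X mem_multiples by (auto simp: monomial_ideal_def)
  then show "Idl\<^bsub>poly_ring n\<^esub> ?X \<subseteq> monomial_ideal n (multiples G)"
    by (rule genideal_minimal[OF monomial_ideal_ideal[OF upset_multiples]])
  note J = genideal_ideal[OF X]
  show "monomial_ideal n (multiples G) \<subseteq> Idl\<^bsub>poly_ring n\<^esub> ?X"
  proof
    fix p :: "'k mpoly" assume p: "p \<in> monomial_ideal n (multiples G)"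
    have "single w (lookup p w) \<in> Idl\<^bsub>poly_ring n\<^esub> ?X" if w: "w \<in> keys p" for w
    proof -
      obtain g h where g: "w = g + h" "g \<in> G" using p w by (auto simp: monomial_ideal_def multiples_def)
      have "keys w \<subseteq> {1..n}" using p w by (auto simp: monomial_ideal_def polys_def)
      then have "single h (lookup p w) \<in> polys {1..n}" unfolding g(1) monomial_keys_add
        by (intro polys_single) auto
      moreover have "single g 1 \<in> Idl\<^bsub>poly_ring n\<^esub> ?X" using genideal_self[OF X] g by auto
      ultimately have "single h (lookup p w) * single g 1 \<in> Idl\<^bsub>poly_ring n\<^esub> ?X"
        by (rule poly_idealD(4)[OF J])
      then show ?thesis by (simp add: mult_single g(1) add.commute)
    qed
    then have "(\<Sum>w\<in>keys p. single w (lookup p w)) \<in> Idl\<^bsub>poly_ring n\<^esub> ?X"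
      by (rule poly_ideal_sum[OF J])
    then show "p \<in> Idl\<^bsub>poly_ring n\<^esub> ?X" using poly_mapping_sum_single[of p] by simp
  qed
qed

lemma lexsegment_ideal_eq:
  "lexsegment_ideal n d u v = monomial_ideal n (multiples (lexsegment n d u v))"
  unfolding lexsegment_ideal_def
  by (rule genideal_monomials) (auto simp: lexsegment_def monomials_def)

section \<open>Dickson's lemma and Hilbert's basis theorem\<close>

lemma nat_seq_mono_subseq:
  fixes g :: "nat \<Rightarrow> nat"
  shows "\<exists>\<psi> :: nat \<Rightarrow> nat. strict_mono \<psi> \<and> mono (\<lambda>m. g (\<psi> m))"
proof -
  obtain r where r: "strict_mono r" "monoseq (\<lambda>n. g (r n))"
    using seq_monosub[of g] by auto
  show ?thesis
  proof (cases "mono (\<lambda>n. g (r n))")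
    case False
    then have dec: "g (r n) \<le> g (r m)" if "m \<le> n" for m n
      using r(2) that by (auto simp: monoseq_def mono_def)
    obtain N where N: "\<And>n. g (r N) \<le> g (r n)"
      using ex_has_least_nat[of "\<lambda>_. True" 0 "\<lambda>n. g (r n)"] by auto
    have "g (r (n + N)) = g (r N)" for n using N[of "n + N"] dec[of N "n + N"] by simp
    then have "mono (\<lambda>n. g (r (n + N)))" by (simp add: mono_def)
    moreover have "strict_mono (\<lambda>n. r (n + N))" using r(1) by (simp add: strict_mono_def)
    ultimately show ?thesis by blast
  qed (use r in blast)
qed

lemma dickson_seq:
  fixes f :: "nat \<Rightarrow> monomial"
  assumes "finite X"
  shows "\<exists>\<phi> :: nat \<Rightarrow> nat. strict_mono \<phi> \<and> (\<forall>i\<in>X. mono (\<lambda>m. lookup (f (\<phi> m)) i))"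
  using assms
proof induction
  case empty
  then show ?case by (auto intro: exI[of _ id] simp: strict_mono_def)
next
  case (insert i X)
  then obtain \<phi> :: "nat \<Rightarrow> nat" where \<phi>: "strict_mono \<phi>" "\<forall>i\<in>X. mono (\<lambda>m. lookup (f (\<phi> m)) i)" by blast
  obtain \<psi> :: "nat \<Rightarrow> nat" where \<psi>: "strict_mono \<psi>" "mono (\<lambda>m. lookup (f (\<phi> (\<psi> m))) i)"
    using nat_seq_mono_subseq[of "\<lambda>m. lookup (f (\<phi> m)) i"] by blast
  have "strict_mono (\<lambda>m. \<phi> (\<psi> m))" using \<phi>(1) \<psi>(1) by (simp add: strict_mono_def)
  moreover have "mono (\<lambda>m. lookup (f (\<phi> (\<psi> m))) j)" if "j \<in> X" for j
    using \<phi>(2) that strict_mono_mono[OF \<psi>(1)] unfolding mono_def by blast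
  ultimately show ?case using \<psi>(2) by (intro exI[of _ "\<lambda>m. \<phi> (\<psi> m)"]) auto
qed

lemma dickson:
  fixes M :: "monomial set"
  assumes "finite X" and M: "M \<subseteq> {w. keys w \<subseteq> X}"
  obtains D where "D \<subseteq> M" "finite D" "M \<subseteq> multiples D"
proof
  define D where "D = {d \<in> M. \<forall>w\<in>M. \<forall>h. d = w + h \<longrightarrow> w = d}"
  show "D \<subseteq> M" by (auto simp: D_def)
  show "finite D"
  proof (rule ccontr)
    assume "infinite D"
    then obtain f :: "nat \<Rightarrow> monomial" where f: "inj f" "range f \<subseteq> D"
      using infinite_countable_subset by blast
    obtain \<phi> :: "nat \<Rightarrow> nat" where \<phi>: "strict_mono \<phi>" "\<forall>i\<in>X. mono (\<lambda>m. lookup (f (\<phi> m)) i)"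
      using dickson_seq[OF assms(1)] by blast
    have fM: "f k \<in> M" for k using f by (auto simp: D_def)
    have "lookup (f (\<phi> 0)) i \<le> lookup (f (\<phi> 1)) i" for i
    proof (cases "i \<in> X")
      case False
      then have "i \<notin> keys (f (\<phi> 0))" using fM M by blast
      then show ?thesis by (simp add: in_keys_iff)
    qed (use \<phi>(2) in \<open>auto simp: mono_def\<close>)
    then have "f (\<phi> 1) = f (\<phi> 0) + (f (\<phi> 1) - f (\<phi> 0))" by (rule monomial_diff_add)
    moreover have "f (\<phi> 1) \<in> D" using f by auto
    ultimately have "f (\<phi> 0) = f (\<phi> 1)" using fM[of "\<phi> 0"] unfolding D_def by blast
    then have "\<phi> 0 = \<phi> 1" using f(1) by (simp add: inj_def)
    then show False using \<phi>(1) by (simp add: strict_mono_eq)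
  qed
  show "M \<subseteq> multiples D"
  proof
    fix w assume w: "w \<in> M"
    let ?s = "\<lambda>w. \<Sum>i\<in>X. lookup w i"
    obtain w' where w': "w' \<in> M \<and> (\<exists>h. w = w' + h)" and
      least: "\<And>z. z \<in> M \<and> (\<exists>h. w = z + h) \<Longrightarrow> ?s w' \<le> ?s z"
      using ex_has_least_nat[of "\<lambda>z. z \<in> M \<and> (\<exists>h. w = z + h)" w ?s] w by (metis add.right_neutral)
    have "z = w'" if z: "z \<in> M" "w' = z + h" for z h
    proof -
      have "\<exists>k. w = z + k" using w' z by (auto simp: add.assoc)
      then have "?s w' \<le> ?s z" using least z by blast
      then have "?s h = 0" using z(2) by (simp add: lookup_add sum.distrib)
      then have "\<forall>i\<in>X. lookup h i = 0" using assms(1) by simp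
      moreover have "keys h \<subseteq> X" using w' z M monomial_keys_add[of z h] by auto
      ultimately have "lookup h i = 0" for i by (cases "i \<in> X") (auto simp: in_keys_iff)
      then have "h = 0" by (simp add: poly_mapping_eqI)
      then show ?thesis using z by simp
    qed
    then have "w' \<in> D" using w' by (auto simp: D_def)
    then show "w \<in> multiples D" using w' by (auto simp: multiples_def)
  qed
qed

lemma monomial_set_has_least:
  fixes M :: "monomial set"
  assumes "finite X" and M: "M \<subseteq> {w. keys w \<subseteq> X}" "M \<noteq> {}"
  shows "\<exists>m\<in>M. \<forall>w\<in>M. m \<le> w"
proof -
  obtain D where D: "D \<subseteq> M" "finite D" "M \<subseteq> multiples D"
    by (rule dickson[OF assms(1,2)])
  have "D \<noteq> {}" using D(3) M(2) by (auto simp: multiples_def)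
  then have "Min D \<in> M" using D(1) Min_in[OF D(2)] by blast
  moreover have "Min D \<le> w" if "w \<in> M" for w
  proof -
    have "w \<in> multiples D" using D(3) that by blast
    then obtain d h where d: "w = d + h" "d \<in> D" by (rule multiplesE)
    have "Min D \<le> d" using d D by simp
    also have "d \<le> d + h" using monomial_nonneg[of h] by (simp add: add_increasing2)
    finally show ?thesis using d by simp
  qed
  ultimately show ?thesis by blast
qed

theorem noetherian_poly_ring: "noetherian_ring (poly_ring n :: 'k::field mpoly ring)"
proof (rule ring.noetherian_ringI[OF ring_poly_ring])
  fix J :: "'k mpoly set" assume J: "ideal J (poly_ring n)"
  interpret ring "poly_ring n :: 'k mpoly ring" by (rule ring_poly_ring)
  note JD = poly_idealD[OF J]
  let ?lm = "\<lambda>p :: 'k mpoly. Max (keys p)"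
  have lm_key: "?lm p \<in> keys p" if "p \<noteq> 0" for p :: "'k mpoly" using that by (intro Max_in) auto
  have lm_in: "?lm p \<in> {w. keys w \<subseteq> {1..n}}" if "p \<in> J" "p \<noteq> 0" for p
    using lm_key[OF that(2)] JD(1) that(1) by (auto simp: polys_def)
  have "?lm ` (J - {0}) \<subseteq> {w. keys w \<subseteq> {1..n}}" using lm_in by blast
  then obtain D where D: "D \<subseteq> ?lm ` (J - {0})" "finite D" "?lm ` (J - {0}) \<subseteq> multiples D"
    by (rule dickson[OF finite_atLeastAtMost])
  have "\<forall>d\<in>D. \<exists>q. q \<in> J \<and> q \<noteq> 0 \<and> ?lm q = d" using D(1) by blast
  then obtain g where g: "\<And>d. d \<in> D \<Longrightarrow> g d \<in> J \<and> g d \<noteq> 0 \<and> ?lm (g d) = d" by metis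
  have A: "g ` D \<subseteq> carrier (poly_ring n)" using g JD(1) by auto
  note K = genideal_ideal[OF A]
  have "J \<subseteq> Idl\<^bsub>poly_ring n\<^esub> (g ` D)"
  proof (rule ccontr)
    assume "\<not> ?thesis"
    then have ne: "?lm ` (J - Idl\<^bsub>poly_ring n\<^esub> (g ` D)) \<noteq> {}" by auto
    have "?lm ` (J - Idl\<^bsub>poly_ring n\<^esub> (g ` D)) \<subseteq> {w. keys w \<subseteq> {1..n}}"
      using lm_in poly_idealD(2)[OF K] by blast
    from monomial_set_has_least[OF finite_atLeastAtMost this ne]
    obtain m where m: "m \<in> ?lm ` (J - Idl\<^bsub>poly_ring n\<^esub> (g ` D))"
      and least: "\<And>w. w \<in> ?lm ` (J - Idl\<^bsub>poly_ring n\<^esub> (g ` D)) \<Longrightarrow> m \<le> w"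
      by blast
    obtain p where p: "p \<in> J" "p \<notin> Idl\<^bsub>poly_ring n\<^esub> (g ` D)" "m = ?lm p" using m by auto
    have p0: "p \<noteq> 0" using p poly_idealD(2)[OF K] by auto
    obtain d h where d: "m = h + d" "d \<in> D"
    proof -
      have "m \<in> multiples D" using D(3) p(1,3) p0 by blast
      then show thesis using that by (metis multiplesE add.commute)
    qed
    define c where "c = lookup p m / lookup (g d) d"
    define t where "t = single h c * g d"
    have gd: "lookup (g d) d \<noteq> 0" using lm_key[of "g d"] g[OF d(2)] by (auto simp: in_keys_iff)
    have hc: "single h c \<in> polys {1..n}"
      using lm_in[OF p(1) p0] d(1) p(3) by (intro polys_single) (auto simp: monomial_keys_add)
    have tJ: "t \<in> J" unfolding t_def using JD(4)[OF hc] g[OF d(2)] by blast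
    have "g d \<in> Idl\<^bsub>poly_ring n\<^esub> (g ` D)" using genideal_self[OF A] d by auto
    then have tK: "t \<in> Idl\<^bsub>poly_ring n\<^esub> (g ` D)" unfolding t_def by (rule poly_idealD(4)[OF K hc])
    have ptK: "p - t \<notin> Idl\<^bsub>poly_ring n\<^esub> (g ` D)"
      using poly_idealD(3)[OF K _ tK, of "p - t"] p by auto
    have pt0: "p - t \<noteq> 0" using ptK poly_idealD(2)[OF K] by auto
    have "lookup t m = lookup p m" using gd by (simp add: t_def d(1) lookup_single_times c_def)
    then have "m \<notin> keys (p - t)" by (simp add: in_keys_iff lookup_minus)
    moreover have "w \<le> m" if "w \<in> keys (p - t)" for w
    proof -
      have "w \<in> keys p \<or> w \<in> keys t" using that keys_diff[of p t] by auto
      then show ?thesis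
      proof
        assume "w \<in> keys t"
        then obtain b where b: "w = h + b" "b \<in> keys (g d)"
          using keys_single_times[of h c "g d"] by (auto simp: t_def)
        then have "b \<le> d" using g[OF d(2)] Max_ge[of "keys (g d)" b] by simp
        then show ?thesis using b d by (simp add: add_left_mono)
      qed (use p(3) in simp)
    qed
    ultimately have "?lm (p - t) < m" using lm_key[OF pt0] by (metis le_neq_trans)
    moreover have "m \<le> ?lm (p - t)" using least ptK JD(7)[OF p(1) tJ] by blast
    ultimately show False by simp
  qed
  moreover have "Idl\<^bsub>poly_ring n\<^esub> (g ` D) \<subseteq> J" using g by (intro genideal_minimal[OF J]) auto
  ultimately show "\<exists>A\<subseteq>carrier (poly_ring n). finite A \<and> J = Idl\<^bsub>poly_ring n\<^esub> A"
    using A D(2) by (intro exI[of _ "g ` D"]) auto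
qed

section \<open>Algebraic dependence by counting\<close>

lemma linear_dependence:
  fixes v :: "'x \<Rightarrow> 'b \<Rightarrow> 'k::field"
  assumes "finite B" "finite X" "card B < card X"
  shows "\<exists>c. (\<exists>x\<in>X. c x \<noteq> 0) \<and> (\<forall>b\<in>B. (\<Sum>x\<in>X. c x * v x b) = 0)"
  using assms
proof (induction B arbitrary: X v)
  case empty
  then show ?case by (intro exI[of _ "\<lambda>_. 1"]) (auto simp: card_gt_0_iff)
next
  case (insert b B)
  show ?case
  proof (cases "\<forall>x\<in>X. v x b = 0")
    case True
    then show ?thesis using insert.IH[of X v] insert.prems insert.hyps by auto
  next
    case False
    then obtain y where y: "y \<in> X" "v y b \<noteq> 0" by blast
    let ?X = "X - {y}"
    define v' where "v' x b' = v x b' - v x b / v y b * v y b'" for x b'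
    have "card B < card ?X" using insert y by simp
    then obtain c where c: "\<exists>x\<in>?X. c x \<noteq> 0" "\<forall>b\<in>B. (\<Sum>x\<in>?X. c x * v' x b) = 0"
      using insert.IH[of ?X v'] insert.prems by auto
    define c' where "c' = c(y := - (\<Sum>x\<in>?X. c x * (v x b / v y b)))"
    have sum: "(\<Sum>x\<in>X. c' x * v x b') = (\<Sum>x\<in>?X. c x * v' x b')" for b'
    proof -
      have "(\<Sum>x\<in>X. c' x * v x b') = c' y * v y b' + (\<Sum>x\<in>?X. c' x * v x b')"
        using y insert.prems by (simp add: sum.remove)
      also have "(\<Sum>x\<in>?X. c' x * v x b') = (\<Sum>x\<in>?X. c x * v x b')"
        by (intro sum.cong) (auto simp: c'_def)
      also have "c' y * v y b' = - (\<Sum>x\<in>?X. c x * (v x b / v y b) * v y b')"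
        by (simp add: c'_def sum_distrib_right)
      finally show ?thesis by (simp add: v'_def algebra_simps sum_subtractf)
    qed
    have "v' x b = 0" for x using y by (simp add: v'_def)
    then have "\<forall>b'\<in>insert b B. (\<Sum>x\<in>X. c' x * v x b') = 0" using c(2) sum by auto
    moreover have "\<exists>x\<in>X. c' x \<noteq> 0" using c(1) by (auto simp: c'_def)
    ultimately show ?thesis by blast
  qed
qed

definition mpow :: "'a::comm_monoid_mult list \<Rightarrow> nat list \<Rightarrow> 'a" where
  "mpow as m = prod_list (map2 (^) as m)"

lemma mpow_Nil [simp]: "mpow [] m = 1" and mpow_Cons [simp]: "mpow (a # as) (k # m) = a ^ k * mpow as m"
  by (simp_all add: mpow_def)

lemma polys_mpow: "set as \<subseteq> polys X \<Longrightarrow> mpow as m \<in> polys X"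
proof (induction as arbitrary: m)
  case (Cons a as)
  then show ?case by (cases m) (auto simp: mpow_def intro: polys_mult polys_power)
qed simp

lemma boundary_set_of_relation:
  fixes c :: "nat list \<Rightarrow> 'k::field"
  assumes "set as \<subseteq> polys {1..n}" "finite X" "X \<noteq> {}" "X \<subseteq> {m. length m = length as}" "\<And>m. m \<in> X \<Longrightarrow> c m \<noteq> 0"
  shows "\<exists>e\<in>boundary_set (poly_ring n) as. \<exists>\<gamma>. \<gamma> \<noteq> 0 \<and>
    (\<Sum>m\<in>X. single 0 (c m) * mpow as m) = single 0 \<gamma> * e"
  using assms
proof (induction as arbitrary: X c)
  case Nil
  then have "X = {[]}" by auto
  then show ?case using Nil by auto
next
  case (Cons a as)
  have ne: "m \<noteq> []" if "m \<in> X" for m using Cons.prems(4) that by auto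
  define k where "k = Min (hd ` X)"
  define X0 where "X0 = {m \<in> X. hd m = k}"
  have k: "k \<in> hd ` X" "\<And>m. m \<in> X \<Longrightarrow> k \<le> hd m"
    unfolding k_def using Cons.prems(2,3) by auto
  have X0: "finite X0" "X0 \<noteq> {}" "X0 \<subseteq> X" using k Cons.prems by (auto simp: X0_def)
  have inj: "inj_on tl X0" using ne by (auto simp: X0_def inj_on_def) (metis list.expand)
  define c' where "c' m = c (k # m)" for m
  have c': "c' (tl m) = c m" if "m \<in> X0" for m
    using that ne unfolding c'_def X0_def by (metis (mono_tags, lifting) list.collapse mem_Collect_eq)
  obtain g \<gamma> where g: "g \<in> boundary_set (poly_ring n) as" "\<gamma> \<noteq> 0"
    "(\<Sum>m\<in>tl ` X0. single 0 (c' m) * mpow as m) = single 0 \<gamma> * g"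
  proof -
    have "tl ` X0 \<subseteq> {m. length m = length as}" using X0(3) Cons.prems(4) by auto
    moreover have "c' m \<noteq> 0" if "m \<in> tl ` X0" for m
      using that c' X0(3) Cons.prems(5) by auto
    ultimately have "\<exists>e\<in>boundary_set (poly_ring n) as. \<exists>\<gamma>. \<gamma> \<noteq> 0 \<and>
        (\<Sum>m\<in>tl ` X0. single 0 (c' m) * mpow as m) = single 0 \<gamma> * e"
      using Cons.prems(1) X0(1,2) by (intro Cons.IH) auto
    then show thesis using that by blast
  qed
  have mpow: "mpow (a # as) m = a ^ hd m * mpow as (tl m)" if "m \<in> X" for m
    using ne[OF that] by (cases m) auto
  define H where "H = (\<Sum>m\<in>X - X0. single 0 (c m) * (a ^ (hd m - Suc k) * mpow as (tl m)))"
  have "(\<Sum>m\<in>X0. single 0 (c m) * mpow (a # as) m) = (\<Sum>m\<in>X0. a ^ k * (single 0 (c' (tl m)) * mpow as (tl m)))"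
    using c' mpow X0(3) by (intro sum.cong refl) (auto simp: X0_def mult_ac)
  also have "\<dots> = a ^ k * (single 0 \<gamma> * g)"
    unfolding g(3)[symmetric] by (simp add: sum.reindex[OF inj] sum_distrib_left)
  finally have s0: "(\<Sum>m\<in>X0. single 0 (c m) * mpow (a # as) m) = a ^ k * (single 0 \<gamma> * g)" .
  have "(\<Sum>m\<in>X - X0. single 0 (c m) * mpow (a # as) m)
      = (\<Sum>m\<in>X - X0. a ^ k * (a * (single 0 (c m) * (a ^ (hd m - Suc k) * mpow as (tl m)))))"
  proof (intro sum.cong refl)
    fix m assume m: "m \<in> X - X0"
    then have "k < hd m" using k(2)[of m] by (auto simp: X0_def)
    then have "a ^ hd m = a ^ k * (a * a ^ (hd m - Suc k))"
      by (metis Suc_diff_Suc add_diff_inverse_nat not_less_iff_gr_or_eq power_Suc power_add)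
    then show "single 0 (c m) * mpow (a # as) m = a ^ k * (a * (single 0 (c m) * (a ^ (hd m - Suc k) * mpow as (tl m))))"
      using m by (simp add: mpow mult_ac)
  qed
  also have "\<dots> = a ^ k * (a * H)" by (simp add: H_def sum_distrib_left)
  finally have s1: "(\<Sum>m\<in>X - X0. single 0 (c m) * mpow (a # as) m) = a ^ k * (a * H)" .
  have "(\<Sum>m\<in>X. single 0 (c m) * mpow (a # as) m) = a ^ k * (a * H) + a ^ k * (single 0 \<gamma> * g)"
    using sum.subset_diff[OF X0(3) Cons.prems(2), of "\<lambda>m. single 0 (c m) * mpow (a # as) m"] s0 s1 by simp
  also have "\<dots> = single 0 \<gamma> * (a ^ k * (g + a * (single 0 (inverse \<gamma>) * H)))"
  proof -
    have inv: "single 0 \<gamma> * single 0 (inverse \<gamma>) = (1 :: 'k mpoly)"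
      using g(2) by (simp add: mult_single)
    have "u * (a ^ k * (g + a * (w * H))) = a ^ k * (a * ((u * w) * H)) + a ^ k * (u * g)" for u w
      by (simp add: algebra_simps)
    from this[of "single 0 \<gamma>" "single 0 (inverse \<gamma>)"] show ?thesis by (simp only: inv mult_1)
  qed
  finally have eq: "(\<Sum>m\<in>X. single 0 (c m) * mpow (a # as) m)
      = single 0 \<gamma> * (a ^ k * (g + a * (single 0 (inverse \<gamma>) * H)))" .
  have "H \<in> polys {1..n}" unfolding H_def using Cons.prems(1)
    by (intro polys_sum polys_mult polys_single polys_power polys_mpow) auto
  then have "single 0 (inverse \<gamma>) * H \<in> polys {1..n}" by (intro polys_mult polys_single) auto
  then have mem: "a ^ k * (g + a * (single 0 (inverse \<gamma>) * H)) \<in> boundary_set (poly_ring n) (a # as)"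
    using g(1) by auto
  show ?case by (rule bexI[OF _ mem], rule exI[of _ \<gamma>]) (use eq g(2) in simp)
qed

definition exponents_le :: "'k::field mpoly \<Rightarrow> nat \<Rightarrow> bool" where
  "exponents_le p M \<longleftrightarrow> (\<forall>w\<in>keys p. \<forall>i. lookup w i \<le> M)"

lemma exponents_le_mult: "exponents_le p M \<Longrightarrow> exponents_le q N \<Longrightarrow> exponents_le (p * q) (M + N)"
  using keys_mult[of p q] unfolding exponents_le_def by (fastforce simp: lookup_add add_mono)

lemma exponents_le_one: "exponents_le 1 M"
  by (auto simp: exponents_le_def)

lemma exponents_le_power: "exponents_le p M \<Longrightarrow> exponents_le (p ^ k) (k * M)"
  by (induction k) (auto intro: exponents_le_mult exponents_le_one)

lemma exponents_le_mono: "exponents_le p M \<Longrightarrow> M \<le> N \<Longrightarrow> exponents_le p N"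
  by (auto simp: exponents_le_def intro: order_trans)

lemma exponents_le_mpow:
  assumes "\<forall>a\<in>set as. exponents_le a D" "set m \<subseteq> {..N}"
  shows "exponents_le (mpow as m) (length as * (N * D))"
  using assms
proof (induction as arbitrary: m)
  case (Cons a as)
  show ?case
  proof (cases m)
    case (Cons k m')
    then have "exponents_le (a ^ k) (N * D)"
      using exponents_le_power[of a D k] Cons.prems by (auto intro: exponents_le_mono)
    then show ?thesis using exponents_le_mult Cons.IH[of m'] Cons.prems Cons by auto
  qed (simp add: mpow_def exponents_le_one)
qed (simp add: exponents_le_one)

lemma ex_exponents_le: "\<exists>D. exponents_le p D"
proof -
  have "lookup w i \<le> (\<Sum>w\<in>keys p. \<Sum>i\<in>keys w. lookup w i)" if "w \<in> keys p" for w i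
  proof -
    have "lookup w i \<le> (\<Sum>i\<in>keys w. lookup w i)"
      by (cases "i \<in> keys w") (auto simp: in_keys_iff intro: member_le_sum)
    also have "\<dots> \<le> (\<Sum>w\<in>keys p. \<Sum>i\<in>keys w. lookup w i)"
      by (rule member_le_sum) (use that in auto)
    finally show ?thesis .
  qed
  then show ?thesis unfolding exponents_le_def by blast
qed

lemma ex_common_exponents_le: "\<exists>D. \<forall>a\<in>set as. exponents_le a D"
proof (induction as)
  case (Cons a as)
  then obtain D where "\<forall>a\<in>set as. exponents_le a D" by blast
  moreover obtain E where "exponents_le a E" using ex_exponents_le by blast
  ultimately show ?case by (intro exI[of _ "max D E"]) (auto intro: exponents_le_mono)
qed simp

lemma monomial_box:
  fixes c :: "nat \<Rightarrow> nat"
  shows "finite {w::monomial. keys w \<subseteq> {1..n} \<and> (\<forall>i\<in>{1..n}. lookup w i \<le> c i)}" (is "finite ?B")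
    and "card {w::monomial. keys w \<subseteq> {1..n} \<and> (\<forall>i\<in>{1..n}. lookup w i \<le> c i)} \<le> (\<Prod>i\<in>{1..n}. Suc (c i))"
proof -
  let ?f = "\<lambda>w::monomial. restrict (lookup w) {1..n}"
  let ?P = "PiE {1..n} (\<lambda>i. {..c i})"
  have inj: "inj_on ?f ?B"
  proof (rule inj_onI, rule poly_mapping_eqI)
    fix w w' i assume w: "w \<in> ?B" "w' \<in> ?B" and eq: "?f w = ?f w'"
    show "lookup w i = lookup w' i"
    proof (cases "i \<in> {1..n}")
      case True
      then show ?thesis using fun_cong[OF eq, of i] by simp
    next
      case False
      then have "i \<notin> keys w" "i \<notin> keys w'" using w by auto
      then show ?thesis by (simp add: in_keys_iff)
    qed
  qed
  have sub: "?f ` ?B \<subseteq> ?P" by auto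
  have fin: "finite ?P" by (intro finite_PiE) auto
  show "finite ?B" using inj sub fin by (rule inj_on_finite)
  have "card ?B \<le> card ?P" using inj sub fin by (rule card_inj_on_le)
  then show "card ?B \<le> (\<Prod>i\<in>{1..n}. Suc (c i))" by (simp add: card_PiE)
qed

lemma boundary_set_meets_monomial_ideal:
  fixes as :: "'k::field mpoly list"
  assumes U: "upset U" and as: "set as \<subseteq> polys {1..n}" "length as = Suc r"
    and count: "\<And>M. card {w. keys w \<subseteq> {1..n} \<and> (\<forall>i\<in>{1..n}. lookup w i \<le> M) \<and> w \<notin> U} \<le> C * Suc M ^ r"
  shows "\<exists>e\<in>boundary_set (poly_ring n) as. e \<in> monomial_ideal n U"
proof -
  obtain D where D: "\<forall>a\<in>set as. exponents_le a D" using ex_common_exponents_le by blast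
  define K where "K = Suc (Suc r * D)"
  define N where "N = C * K ^ r"
  define M where "M = Suc r * (N * D)"
  define B where "B = {w. keys w \<subseteq> {1..n} \<and> (\<forall>i\<in>{1..n}. lookup w i \<le> M) \<and> w \<notin> U}"
  define X where "X = {m. set m \<subseteq> {..N} \<and> length m = Suc r}"
  have "finite B" by (rule finite_subset[OF _ monomial_box(1)[of n "\<lambda>_. M"]]) (auto simp: B_def)
  have "finite X" unfolding X_def by (intro finite_lists_length_eq) simp
  have "Suc M \<le> K * Suc N" by (simp add: M_def K_def algebra_simps)
  then have "card B \<le> C * (K * Suc N) ^ r"
    unfolding B_def by (intro order_trans[OF count] mult_left_mono power_mono) auto
  also have "\<dots> = (C * K ^ r) * Suc N ^ r" by (simp only: power_mult_distrib mult.assoc)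
  also have "\<dots> = N * Suc N ^ r" by (simp only: N_def)
  also have "\<dots> < Suc N * Suc N ^ r" by (intro mult_strict_right_mono) simp_all
  also have "\<dots> = card X" unfolding X_def by (subst card_lists_length_eq) simp_all
  finally obtain c where c: "\<exists>m\<in>X. c m \<noteq> 0" "\<forall>w\<in>B. (\<Sum>m\<in>X. c m * lookup (mpow as m) w) = 0"
    using linear_dependence[OF \<open>finite B\<close> \<open>finite X\<close>, of "\<lambda>m. lookup (mpow as m)"] by blast
  define X' where "X' = {m \<in> X. c m \<noteq> 0}"
  have "\<exists>e\<in>boundary_set (poly_ring n) as. \<exists>\<gamma>. \<gamma> \<noteq> 0 \<and>
    (\<Sum>m\<in>X'. single 0 (c m) * mpow as m) = single 0 \<gamma> * e"
  proof (rule boundary_set_of_relation[OF as(1)])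
    show "finite X'" using \<open>finite X\<close> by (simp add: X'_def)
  qed (use c(1) as in \<open>auto simp: X'_def X_def\<close>)
  then obtain e \<gamma> where e: "e \<in> boundary_set (poly_ring n) as" "\<gamma> \<noteq> 0"
    and eq: "(\<Sum>m\<in>X'. single 0 (c m) * mpow as m) = single 0 \<gamma> * e" by blast
  define p where "p = (\<Sum>m\<in>X'. single 0 (c m) * mpow as m)"
  have lookup_const: "lookup (single 0 a * q) w = a * lookup q w" for a and q :: "'k mpoly" and w
    using lookup_single_times[of 0 a q w] by simp
  have pp: "p \<in> polys {1..n}" unfolding p_def
    by (intro polys_sum polys_mult polys_single polys_mpow as(1)) simp
  have "exponents_le p M"
    unfolding exponents_le_def
  proof (intro ballI allI)
    fix w i assume "w \<in> keys p"
    then obtain m where m: "m \<in> X'" "w \<in> keys (single 0 (c m) * mpow as m)"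
      using Poly_Mapping.keys_sum[of "\<lambda>m. single 0 (c m) * mpow as m" X'] unfolding p_def by blast
    then have "w \<in> keys (mpow as m)" using keys_single_times[of 0 "c m" "mpow as m"] by auto
    moreover have "exponents_le (mpow as m) M"
      unfolding M_def as(2)[symmetric] using m by (intro exponents_le_mpow[OF D]) (auto simp: X'_def X_def)
    ultimately show "lookup w i \<le> M" by (auto simp: exponents_le_def)
  qed
  have "w \<in> U" if w: "w \<in> keys p" for w
  proof (rule ccontr)
    assume "w \<notin> U"
    then have "w \<in> B" using w pp \<open>exponents_le p M\<close> by (auto simp: B_def polys_def exponents_le_def)
    then have "(\<Sum>m\<in>X. c m * lookup (mpow as m) w) = 0" using c(2) by blast
    moreover have "lookup p w = (\<Sum>m\<in>X'. c m * lookup (mpow as m) w)"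
      by (simp add: p_def lookup_sum lookup_const)
    moreover have "(\<Sum>m\<in>X'. c m * lookup (mpow as m) w) = (\<Sum>m\<in>X. c m * lookup (mpow as m) w)"
      using \<open>finite X\<close> by (intro sum.mono_neutral_left) (auto simp: X'_def)
    ultimately show False using w by (simp add: in_keys_iff)
  qed
  then have "p \<in> monomial_ideal n U" using pp by (auto simp: monomial_ideal_def)
  then have "single 0 (inverse \<gamma>) * p \<in> monomial_ideal n U"
    by (intro poly_idealD(4)[OF monomial_ideal_ideal[OF U]] polys_single) auto
  moreover have "single 0 (inverse \<gamma>) * p = e"
    using e(2) by (simp add: p_def eq mult_single flip: mult.assoc)
  ultimately show ?thesis using e(1) by auto
qed

section \<open>Primes generated by variables\<close>

definition var_prime :: "nat \<Rightarrow> nat set \<Rightarrow> 'k::field mpoly set" where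
  "var_prime n X = monomial_ideal n {w. keys w \<inter> X \<noteq> {}}"

lemma upset_var: "upset {w. keys w \<inter> X \<noteq> {}}"
  by (auto simp: upset_def monomial_keys_add)

lemma var_prime_ideal: "ideal (var_prime n X :: 'k::field mpoly set) (poly_ring n)"
  unfolding var_prime_def by (rule monomial_ideal_ideal[OF upset_var])

lemma var_prime_mono: "X \<subseteq> Y \<Longrightarrow> var_prime n X \<subseteq> var_prime n Y"
  by (auto simp: var_prime_def monomial_ideal_def)

lemma one_notin_var_prime: "1 \<notin> (var_prime n X :: 'k::field mpoly set)"
  by (auto simp: var_prime_def monomial_ideal_def)

lemma var_prime_primeideal: "primeideal (var_prime n X :: 'k::field mpoly set) (poly_ring n)"
proof (rule primeidealI)
  let ?P = "var_prime n X :: 'k mpoly set"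
  show "ideal ?P (poly_ring n)" by (rule var_prime_ideal)
  show "cring (poly_ring n :: 'k mpoly ring)" by (rule cring_poly_ring)
  show "carrier (poly_ring n) \<noteq> ?P" using one_notin_var_prime polys_1 by (metis carrier_poly_ring)
  fix a b :: "'k mpoly"
  assume ab: "a \<in> carrier (poly_ring n)" "b \<in> carrier (poly_ring n)" "a \<otimes>\<^bsub>poly_ring n\<^esub> b \<in> ?P"
  show "a \<in> ?P \<or> b \<in> ?P"
  proof (rule ccontr)
    let ?A = "\<lambda>p :: 'k mpoly. {w \<in> keys p. keys w \<inter> X = {}}"
    assume "\<not> (a \<in> ?P \<or> b \<in> ?P)"
    then have ne: "?A a \<noteq> {}" "?A b \<noteq> {}" using ab by (auto simp: var_prime_def monomial_ideal_def)
    define \<alpha> where "\<alpha> = Min (?A a)"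
    define \<beta> where "\<beta> = Min (?A b)"
    have \<alpha>: "\<alpha> \<in> ?A a" "\<And>w. w \<in> ?A a \<Longrightarrow> \<alpha> \<le> w" unfolding \<alpha>_def using ne Min_in[of "?A a"] by auto
    have \<beta>: "\<beta> \<in> ?A b" "\<And>w. w \<in> ?A b \<Longrightarrow> \<beta> \<le> w" unfolding \<beta>_def using ne Min_in[of "?A b"] by auto
    have "lookup (a * b) (\<alpha> + \<beta>) = lookup a \<alpha> * lookup b \<beta>"
    proof (rule lookup_times_unique)
      fix w w' assume w: "w \<in> keys a" "w' \<in> keys b" and eq: "w + w' = \<alpha> + \<beta>"
      have "(keys w \<union> keys w') \<inter> X = {}"
        using \<alpha>(1) \<beta>(1) by (auto simp: eq simp flip: monomial_keys_add) (auto simp: monomial_keys_add)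
      then have "\<alpha> \<le> w" "\<beta> \<le> w'" using \<alpha>(2) \<beta>(2) w by auto
      then show "w = \<alpha> \<and> w' = \<beta>" using eq
        by (metis add_le_cancel_left add_le_cancel_right add_right_cancel add_left_cancel add_mono antisym)
    qed
    then have "\<alpha> + \<beta> \<in> keys (a * b)" using \<alpha>(1) \<beta>(1) by (simp add: in_keys_iff)
    then have "keys (\<alpha> + \<beta>) \<inter> X \<noteq> {}" using ab by (auto simp: var_prime_def monomial_ideal_def)
    then show False using \<alpha>(1) \<beta>(1) by (auto simp: monomial_keys_add)
  qed
qed

lemma mem_var_prime_all: "p \<in> var_prime n {1..n} \<longleftrightarrow> p \<in> polys {1..n} \<and> 0 \<notin> keys p"
proof -
  have "w = 0 \<longleftrightarrow> keys w \<inter> {1..n} = {}" if "p \<in> polys {1..n}" "w \<in> keys p" for w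
    using that by (auto simp: polys_def Int_absorb2)
  then show ?thesis unfolding var_prime_def monomial_ideal_def by blast
qed

lemma var_prime_maximalideal: "maximalideal (var_prime n {1..n} :: 'k::field mpoly set) (poly_ring n)"
proof (rule maximalidealI)
  let ?P = "var_prime n {1..n} :: 'k mpoly set"
  show "ideal ?P (poly_ring n)" by (rule var_prime_ideal)
  show "carrier (poly_ring n) \<noteq> ?P" using one_notin_var_prime polys_1 by (metis carrier_poly_ring)
  fix J :: "'k mpoly set" assume J: "ideal J (poly_ring n)" "?P \<subseteq> J"
  note JD = poly_idealD[OF J(1)]
  show "J = ?P \<or> J = carrier (poly_ring n)"
  proof (rule disjCI)
    assume "J \<noteq> carrier (poly_ring n)"
    then have one: "1 \<notin> J" using ideal.one_imp_carrier[OF J(1)] by auto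
    have "p \<in> ?P" if p: "p \<in> J" for p
    proof (rule ccontr)
      assume "p \<notin> ?P"
      then have "0 \<in> keys p" using p JD(1) mem_var_prime_all by blast
      define c where "c = lookup p 0"
      have c: "c \<noteq> 0" using \<open>0 \<in> keys p\<close> by (simp add: c_def in_keys_iff)
      define q where "q = p - single 0 c"
      have "q \<in> polys {1..n}" using p JD(1) unfolding q_def by (intro polys_diff polys_single) auto
      moreover have "0 \<notin> keys q" by (simp add: q_def c_def in_keys_iff lookup_minus)
      ultimately have "q \<in> ?P" using mem_var_prime_all by blast
      then have "p - q \<in> J" using J(2) p JD(7) by blast
      then have "single 0 c \<in> J" by (simp add: q_def)
      then have "single 0 (inverse c) * single 0 c \<in> J" by (intro JD(4) polys_single) auto
      then show False using one c by (simp add: mult_single)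
    qed
    then show "J = ?P" using J(2) by blast
  qed
qed

section \<open>Depth and height at the origin of a monomial quotient\<close>

lemma zero_notin_upset: "upset U \<Longrightarrow> f \<notin> U \<Longrightarrow> 0 \<notin> U"
  using upsetD[of U 0 f] by auto

lemma monomial_ideal_subset_origin:
  assumes "0 \<notin> U"
  shows "monomial_ideal n U \<subseteq> var_prime n {1..n}"
  using assms unfolding subset_iff mem_var_prime_all by (auto simp: monomial_ideal_def)

lemma monomial_quot_depth_le:
  fixes n :: nat and U :: "monomial set"
  defines "I \<equiv> monomial_ideal n U :: 'k::field mpoly set"
  assumes U: "upset U" and X: "X \<subseteq> {1..n}" and f: "keys f \<subseteq> {1..n}" "f \<notin> U"
    and kill: "\<And>i. i \<in> X \<Longrightarrow> f + single i 1 \<in> U"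
  shows "depth (poly_ring n Quot I) ((+>\<^bsub>poly_ring n\<^esub>) I ` var_prime n {1..n}) \<le> enat (n - card X)"
proof -
  let ?S = "poly_ring n :: 'k mpoly ring"
  let ?m = "var_prime n {1..n} :: 'k mpoly set"
  let ?\<pi> = "(+>\<^bsub>?S\<^esub>) I"
  interpret S: cring ?S by (rule cring_poly_ring)
  have I: "ideal I ?S" unfolding I_def by (rule monomial_ideal_ideal[OF U])
  have Im: "I \<subseteq> ?m" unfolding I_def
    by (rule monomial_ideal_subset_origin[OF zero_notin_upset[OF U f(2)]])
  interpret h: ring_hom_ring ?S "?S Quot I" ?\<pi> by (rule ideal.rcos_ring_hom_ring[OF I])
  let ?y = "single f (1::'k)"
  have y: "?y \<in> polys {1..n}" by (rule polys_single[OF f(1)])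
  show ?thesis
  proof (rule depth_le)
    show "cring (?S Quot I)" by (rule ideal.quotient_is_cring[OF I cring_poly_ring])
    show "noetherian_ring (?S Quot I)" by (rule noetherian_ring.Quot_noetherian[OF noetherian_poly_ring I])
    show "maximalideal (?\<pi> ` ?m) (?S Quot I)"
      by (rule S.Quot_maximalideal[OF I var_prime_maximalideal Im])
    show "?\<pi> ?y \<in> carrier (?S Quot I)" using y by (simp add: S.Quot_carrier)
    fix s assume s: "s \<in> carrier (?S Quot I)" "s \<otimes>\<^bsub>?S Quot I\<^esub> ?\<pi> ?y = \<zero>\<^bsub>?S Quot I\<^esub>"
    then obtain s' where s': "s = ?\<pi> s'" "s' \<in> polys {1..n}" by (auto simp: S.Quot_carrier)
    have "?\<pi> (s' * ?y) = \<zero>\<^bsub>?S Quot I\<^esub>" using s(2) s' y h.hom_mult[of s' ?y] by simp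
    then have "s' * ?y \<in> I" using S.Quot_eq_zero_iff[OF I] s' y by (simp add: polys_mult)
    then have k: "keys (s' * ?y) \<subseteq> U" by (simp add: I_def monomial_ideal_def)
    have "0 \<notin> keys s'"
    proof
      assume "0 \<in> keys s'"
      moreover have "lookup (?y * s') (f + 0) = lookup s' 0" by (subst lookup_single_times) simp
      ultimately have "f \<in> keys (s' * ?y)" by (simp add: in_keys_iff mult.commute)
      then show False using k f(2) by auto
    qed
    then show "s \<in> ?\<pi> ` ?m" using s' mem_var_prime_all by blast
  next
    fix zs assume zs: "set zs \<subseteq> ?\<pi> ` ?m" "length zs = Suc (n - card X)"
    from zs(1) obtain zs' where zs': "zs = map ?\<pi> zs'" "set zs' \<subseteq> ?m" by (rule S.Quot_list_lift)
    have zsc: "set zs' \<subseteq> polys {1..n}" using zs' mem_var_prime_all by blast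
    have "\<exists>e\<in>boundary_set ?S zs'. e \<in> monomial_ideal n {w. keys w \<inter> X \<noteq> {}}"
    proof (rule boundary_set_meets_monomial_ideal[OF upset_var zsc, of "n - card X" X 1])
      show "length zs' = Suc (n - card X)" using zs(2) zs'(1) by simp
      fix M :: nat
      let ?c = "\<lambda>i. if i \<in> X then 0 else M"
      have "card {w :: monomial. keys w \<subseteq> {1..n} \<and> (\<forall>i\<in>{1..n}. lookup w i \<le> M) \<and> w \<notin> {w. keys w \<inter> X \<noteq> {}}}
          \<le> card {w :: monomial. keys w \<subseteq> {1..n} \<and> (\<forall>i\<in>{1..n}. lookup w i \<le> ?c i)}"
        by (intro card_mono monomial_box(1)) (auto simp: in_keys_iff disjoint_iff)
      also have "\<dots> \<le> (\<Prod>i\<in>{1..n}. Suc (?c i))" by (rule monomial_box(2))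
      also have "\<dots> = (\<Prod>i\<in>{1..n} - X. Suc M)"
        by (rule prod.mono_neutral_cong_right) auto
      also have "\<dots> = 1 * Suc M ^ (n - card X)" using X by (simp add: card_Diff_subset finite_subset[OF X])
      finally show "card {w :: monomial. keys w \<subseteq> {1..n} \<and> (\<forall>i\<in>{1..n}. lookup w i \<le> M) \<and>
        w \<notin> {w. keys w \<inter> X \<noteq> {}}} \<le> 1 * Suc M ^ (n - card X)" .
    qed
    then obtain e where e: "e \<in> boundary_set ?S zs'" "e \<in> monomial_ideal n {w. keys w \<inter> X \<noteq> {}}" by blast
    have ec: "e \<in> polys {1..n}" using e(2) by (simp add: monomial_ideal_def)
    have "keys (e * ?y) \<subseteq> U"
    proof
      fix w assume "w \<in> keys (e * ?y)"
      then obtain w' where w': "w = f + w'" "w' \<in> keys e"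
        using keys_single_times[of f 1 e] by (auto simp: mult.commute)
      then obtain i where i: "i \<in> X" "i \<in> keys w'" using e(2) by (auto simp: monomial_ideal_def)
      have "w' = single i 1 + (w' - single i 1)"
        by (rule monomial_diff_add) (use i in \<open>auto simp: lookup_single when_def in_keys_iff\<close>)
      then have "w = (f + single i 1) + (w' - single i 1)" unfolding w'(1) by (metis add.assoc)
      then show "w \<in> U" using upsetD[OF U kill[OF i(1)]] by metis
    qed
    then have "e * ?y \<in> I" using ec y by (simp add: I_def monomial_ideal_def polys_mult)
    then have "?\<pi> (e \<otimes>\<^bsub>?S\<^esub> ?y) = \<zero>\<^bsub>?S Quot I\<^esub>"
      using S.Quot_eq_zero_iff[OF I] ec y by (simp add: polys_mult)
    then have "?\<pi> e \<otimes>\<^bsub>?S Quot I\<^esub> ?\<pi> ?y = \<zero>\<^bsub>?S Quot I\<^esub>" using ec y h.hom_mult[of e ?y] by simp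
    moreover have "?\<pi> e \<in> boundary_set (?S Quot I) zs"
      unfolding zs'(1) by (rule boundary_set_hom[OF h.ring_hom_ring_axioms _ e(1)]) (use zsc in simp)
    ultimately show "\<exists>e\<in>boundary_set (?S Quot I) zs. e \<otimes>\<^bsub>?S Quot I\<^esub> ?\<pi> ?y = \<zero>\<^bsub>?S Quot I\<^esub>" by blast
  qed
qed

lemma monomial_quot_height_ge:
  fixes n :: nat and U :: "monomial set"
  defines "I \<equiv> monomial_ideal n U :: 'k::field mpoly set"
  assumes U: "upset U" and Y: "Y \<subseteq> {1..n}" "U \<subseteq> {w. keys w \<inter> Y \<noteq> {}}"
  shows "enat (n - card Y) \<le> height (poly_ring n Quot I) ((+>\<^bsub>poly_ring n\<^esub>) I ` var_prime n {1..n})"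
proof -
  let ?S = "poly_ring n :: 'k mpoly ring"
  interpret S: cring ?S by (rule cring_poly_ring)
  have I: "ideal I ?S" unfolding I_def by (rule monomial_ideal_ideal[OF U])
  obtain ys where ys: "set ys = {1..n} - Y" "distinct ys" using finite_distinct_list[of "{1..n} - Y"] by auto
  have len: "length ys = n - card Y"
    using distinct_card[OF ys(2)] ys(1) Y(1) by (simp add: card_Diff_subset finite_subset[OF Y(1)])
  define C where "C i = (var_prime n (Y \<union> set (take i ys)) :: 'k mpoly set)" for i
  have "prime_chain ?S (n - card Y) C"
    unfolding prime_chain_def
  proof (intro conjI allI impI)
    show "primeideal (C i) ?S" for i unfolding C_def by (rule var_prime_primeideal)
    fix i assume "i < n - card Y"
    then have i: "i < length ys" using len by simp
    have sub: "C i \<subseteq> C (Suc i)" unfolding C_def using i by (intro var_prime_mono) (auto simp: take_Suc_conv_app_nth)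
    have "ys ! i \<in> {1..n} - Y" unfolding ys(1)[symmetric] by (rule nth_mem[OF i])
    moreover have "ys ! i \<notin> set (take i ys)"
      using i ys(2) by (auto simp: in_set_conv_nth nth_eq_iff_index_eq)
    ultimately have "single (single (ys ! i) 1) (1::'k) \<in> C (Suc i) - C i"
      using i by (auto simp: C_def var_prime_def monomial_ideal_def take_Suc_conv_app_nth intro!: polys_single)
    then show "C i \<subset> C (Suc i)" using sub by blast
  qed
  moreover have "I \<subseteq> C i" for i
    using Y(2) by (auto simp: C_def I_def var_prime_def monomial_ideal_def)
  ultimately have "enat (n - card Y) \<le> height (?S Quot I) ((+>\<^bsub>?S\<^esub>) I ` C (n - card Y))"
    by (rule S.Quot_height_ge[OF I])
  moreover have "Y \<union> set (take (n - card Y) ys) = {1..n}" using ys Y(1) len by auto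
  ultimately show ?thesis by (simp only: C_def)
qed

lemma not_cohen_macaulayI:
  fixes n :: nat and U :: "monomial set"
  assumes U: "upset U" and Y: "Y \<subseteq> {1..n}" "U \<subseteq> {w. keys w \<inter> Y \<noteq> {}}"
    and X: "X \<subseteq> {1..n}" "card Y < card X"
    and f: "keys f \<subseteq> {1..n}" "f \<notin> U" "\<And>i. i \<in> X \<Longrightarrow> f + single i 1 \<in> U"
  shows "\<not> cohen_macaulay_ring (poly_ring n Quot (monomial_ideal n U :: 'k::field mpoly set))"
proof
  let ?S = "poly_ring n :: 'k mpoly ring"
  let ?I = "monomial_ideal n U :: 'k mpoly set"
  let ?P = "(+>\<^bsub>?S\<^esub>) ?I ` var_prime n {1..n}"
  assume CM: "cohen_macaulay_ring (?S Quot ?I)"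
  interpret S: cring ?S by (rule cring_poly_ring)
  have "maximalideal ?P (?S Quot ?I)"
    by (rule S.Quot_maximalideal[OF monomial_ideal_ideal[OF U] var_prime_maximalideal
      monomial_ideal_subset_origin[OF zero_notin_upset[OF U f(2)]]])
  then have eq: "depth (?S Quot ?I) ?P = height (?S Quot ?I) ?P"
    using CM unfolding cohen_macaulay_ring_def by blast
  have "enat (n - card Y) \<le> height (?S Quot ?I) ?P" by (rule monomial_quot_height_ge[OF U Y])
  also have "height (?S Quot ?I) ?P \<le> enat (n - card X)" unfolding eq[symmetric] by (rule monomial_quot_depth_le[OF U X(1) f])
  finally have "n - card Y \<le> n - card X" by simp
  moreover have "card X \<le> n" using card_mono[OF _ X(1)] by simp
  ultimately show False using X(2) by simp
qed

section \<open>Coefficients with respect to one variable\<close>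

lift_definition var_coeff :: "nat \<Rightarrow> nat \<Rightarrow> 'k::field mpoly \<Rightarrow> 'k mpoly" is
  "\<lambda>j e p w. if lookup w j = 0 then p (w + single j e) else 0"
proof -
  fix j e and p :: "monomial \<Rightarrow> 'k" assume fin: "finite {w. p w \<noteq> 0}"
  have sub: "w \<in> (\<lambda>w. w - single j e) ` {w. p w \<noteq> 0}"
    if "p (w + single j e) \<noteq> 0" for w
    using that by (intro image_eqI[of _ _ "w + single j e"]) simp_all
  have "{w. (if lookup w j = 0 then p (w + single j e) else 0) \<noteq> 0}
      \<subseteq> (\<lambda>w. w - single j e) ` {w. p w \<noteq> 0}"
  proof (rule subsetI)
    fix w assume "w \<in> {w. (if lookup w j = 0 then p (w + single j e) else 0) \<noteq> 0}"
    then have "p (w + single j e) \<noteq> 0" by (simp split: if_splits)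
    then show "w \<in> (\<lambda>w. w - single j e) ` {w. p w \<noteq> 0}" by (rule sub)
  qed
  then show "finite {w. (if lookup w j = 0 then p (w + single j e) else 0) \<noteq> 0}"
    by (rule finite_subset[OF _ finite_imageI[OF fin]])
qed

lemma lookup_var_coeff: "lookup (var_coeff j e p) w = (if lookup w j = 0 then lookup p (w + single j e) else 0)"
  by (simp add: var_coeff.rep_eq)

lemma var_coeff_0 [simp]: "var_coeff j e 0 = 0"
  by (rule poly_mapping_eqI) (simp add: lookup_var_coeff)

lemma var_coeff_add: "var_coeff j e (p + q) = var_coeff j e p + var_coeff j e q"
  by (rule poly_mapping_eqI) (simp add: lookup_var_coeff lookup_add)

lemma var_coeff_sum: "var_coeff j e (sum f A) = (\<Sum>a\<in>A. var_coeff j e (f a))"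
  by (induction A rule: infinite_finite_induct) (simp_all add: var_coeff_add)

lemma var_coeff_single:
  "var_coeff j e (single \<mu> c) = (if lookup \<mu> j = e then single (\<mu> - single j e) c else 0)"
proof (rule poly_mapping_eqI)
  fix w
  have "\<mu> = w + single j e \<longleftrightarrow> \<mu> - single j e = w \<and> lookup \<mu> j = e" if "lookup w j = 0"
  proof
    assume "\<mu> - single j e = w \<and> lookup \<mu> j = e"
    moreover have "\<mu> = single j e + (\<mu> - single j e)" if "lookup \<mu> j = e"
      by (rule monomial_diff_add) (use that in \<open>auto simp: lookup_single when_def\<close>)
    ultimately show "\<mu> = w + single j e" by (metis add.commute)
  qed (use that in \<open>auto simp: lookup_add\<close>)
  moreover have "lookup (\<mu> - single j e) j = 0" if "lookup \<mu> j = e"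
    using that by (simp add: lookup_minus)
  ultimately show "lookup (var_coeff j e (single \<mu> c)) w
      = lookup (if lookup \<mu> j = e then single (\<mu> - single j e) c else 0) w"
    by (auto simp: lookup_var_coeff lookup_single when_def)
qed

lemma monomial_diff_diff_add:
  fixes \<mu> w :: monomial
  assumes "lookup \<mu> j + lookup w j = e"
  shows "\<mu> + w - single j e = (\<mu> - single j (lookup \<mu> j)) + (w - single j (lookup w j))"
  using assms by (intro poly_mapping_eqI) (auto simp: lookup_add lookup_minus lookup_single when_def)

lemma var_coeff_single_times:
  fixes p :: "'k::field mpoly"
  shows "var_coeff j e (single \<mu> c * p) =
    (if lookup \<mu> j \<le> e then single (\<mu> - single j (lookup \<mu> j)) c * var_coeff j (e - lookup \<mu> j) p else 0)"
proof -
  have "single \<mu> c * p = (\<Sum>w\<in>keys p. single (\<mu> + w) (c * lookup p w))"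
    by (subst poly_mapping_sum_single[of p]) (simp add: sum_distrib_left mult_single)
  then have "var_coeff j e (single \<mu> c * p) = (\<Sum>w\<in>keys p. var_coeff j e (single (\<mu> + w) (c * lookup p w)))"
    by (simp add: var_coeff_sum)
  also have "\<dots> = (\<Sum>w\<in>keys p. if lookup \<mu> j \<le> e then single (\<mu> - single j (lookup \<mu> j)) c *
      var_coeff j (e - lookup \<mu> j) (single w (lookup p w)) else 0)"
    by (intro sum.cong refl)
      (auto simp: var_coeff_single mult_single lookup_add monomial_diff_diff_add)
  also have "\<dots> = (if lookup \<mu> j \<le> e then single (\<mu> - single j (lookup \<mu> j)) c *
      var_coeff j (e - lookup \<mu> j) (\<Sum>w\<in>keys p. single w (lookup p w)) else 0)"
    by (simp add: var_coeff_sum sum_distrib_left)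
  finally show ?thesis by (simp flip: poly_mapping_sum_single)
qed

lemma polys_var_coeff:
  assumes "p \<in> polys X"
  shows "var_coeff j e p \<in> polys (X - {j})"
  unfolding polys_def
proof (intro CollectI ballI)
  fix w assume "w \<in> keys (var_coeff j e p)"
  then have "lookup w j = 0" "w + single j e \<in> keys p"
    by (auto simp: in_keys_iff lookup_var_coeff split: if_splits)
  then have "keys (w + single j e) \<subseteq> X" "j \<notin> keys w"
    using assms by (auto simp: polys_def in_keys_iff)
  then show "keys w \<subseteq> X - {j}" by (auto simp: monomial_keys_add)
qed

lemma monomial_keys_diff: "keys (a - b) \<subseteq> keys (a :: monomial)"
  by (auto simp: in_keys_iff lookup_minus)

lemma var_coeff_polys:
  assumes "p \<in> polys X" "j \<notin> X"
  shows "var_coeff j e p = (if e = 0 then p else 0)"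
proof (rule poly_mapping_eqI)
  fix w
  have zero: "lookup p w = 0" if "lookup w j \<noteq> 0" for w
  proof -
    have "j \<in> keys w" using that by (simp add: in_keys_iff)
    then have "w \<notin> keys p" using assms unfolding polys_def by blast
    then show ?thesis by (simp add: in_keys_iff)
  qed
  then show "lookup (var_coeff j e p) w = lookup (if e = 0 then p else 0) w"
    using zero[of w] zero[of "w + single j e"] by (auto simp: lookup_var_coeff lookup_add)
qed

lemma var_coeff_eq_0:
  assumes "exponents_le p N" "N < e"
  shows "var_coeff j e p = 0"
proof (rule poly_mapping_eqI)
  fix w
  have "w + single j e \<notin> keys p"
    using assms by (auto simp: exponents_le_def lookup_add dest!: bspec spec[of _ j])
  then show "lookup (var_coeff j e p) w = lookup 0 w" by (simp add: lookup_var_coeff in_keys_iff)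
qed

lemma var_coeff_expand:
  fixes p :: "'k::field mpoly"
  assumes "exponents_le p N"
  shows "p = (\<Sum>e\<le>N. single (single j e) 1 * var_coeff j e p)"
proof -
  have *: "single w c = (\<Sum>e\<le>N. single (single j e) 1 * var_coeff j e (single w c))"
    if "lookup w j \<le> N" for w and c :: 'k
  proof -
    have "w = single j (lookup w j) + (w - single j (lookup w j))"
      by (rule monomial_diff_add) (auto simp: lookup_single when_def)
    then show ?thesis using that
      by (simp add: var_coeff_single if_distrib mult_single cong: if_cong)
  qed
  have "p = (\<Sum>w\<in>keys p. single w (lookup p w))" by (rule poly_mapping_sum_single)
  also have "\<dots> = (\<Sum>w\<in>keys p. \<Sum>e\<le>N. single (single j e) 1 * var_coeff j e (single w (lookup p w)))"
    using assms by (intro sum.cong refl *) (simp add: exponents_le_def)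
  also have "\<dots> = (\<Sum>e\<le>N. single (single j e) 1 * var_coeff j e (\<Sum>w\<in>keys p. single w (lookup p w)))"
    by (subst sum.swap) (simp add: var_coeff_sum sum_distrib_left)
  finally show ?thesis by (simp flip: poly_mapping_sum_single)
qed

lemma var_coeff_genideal:
  fixes A :: "'k::field mpoly set"
  assumes j: "j \<in> {1..n}" and A: "A \<subseteq> polys ({1..n} - {j})" and p: "p \<in> genideal (poly_ring n) A"
  shows "var_coeff j e p \<in> genideal (poly_ring n) A"
proof -
  interpret ring "poly_ring n :: 'k mpoly ring" by (rule ring_poly_ring)
  have Ac: "A \<subseteq> carrier (poly_ring n)" using A polys_mono[of "{1..n} - {j}" "{1..n}"] by auto
  let ?J = "genideal (poly_ring n) A"
  have J: "ideal ?J (poly_ring n)" by (rule genideal_ideal[OF Ac])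
  note JD = poly_idealD[OF J]
  let ?K = "{p \<in> polys {1..n}. \<forall>e. var_coeff j e p \<in> ?J}"
  have "ideal ?K (poly_ring n)"
    unfolding poly_ideal_iff
  proof (intro conjI ballI)
    fix r a :: "'k mpoly" assume r: "r \<in> polys {1..n}" and a: "a \<in> ?K"
    have "var_coeff j e (r * a) \<in> ?J" for e
    proof -
      have "var_coeff j e (r * a) = (\<Sum>w\<in>keys r. var_coeff j e (single w (lookup r w) * a))"
        by (subst poly_mapping_sum_single[of r]) (simp add: sum_distrib_right var_coeff_sum)
      also have "\<dots> \<in> ?J"
      proof (rule poly_ideal_sum[OF J])
        fix w assume "w \<in> keys r"
        then have "keys (w - single j (lookup w j)) \<subseteq> {1..n}"
          using r monomial_keys_diff[of w "single j (lookup w j)"] unfolding polys_def by blast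
        then show "var_coeff j e (single w (lookup r w) * a) \<in> ?J"
          using a by (auto simp: var_coeff_single_times intro!: JD(4) JD(2) polys_single)
      qed
      finally show ?thesis .
    qed
    then show "r * a \<in> ?K" using r a by (simp add: polys_mult)
  qed (use JD in \<open>auto simp: var_coeff_add intro: polys_add\<close>)
  moreover have "A \<subseteq> ?K"
  proof
    fix t assume t: "t \<in> A"
    then have "var_coeff j e t = (if e = 0 then t else 0)" for e
      using A by (intro var_coeff_polys[of _ "{1..n} - {j}"]) auto
    then show "t \<in> ?K" using t Ac genideal_self[OF Ac] JD(2) by auto
  qed
  ultimately have "?J \<subseteq> ?K" by (rule genideal_minimal)
  then show ?thesis using p by blast
qed

lemma univariate_key:
  assumes "F \<in> polys {j}" "w \<in> keys F"
  shows "w = single j (lookup w j)"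
proof (rule poly_mapping_eqI)
  fix k
  have "keys w \<subseteq> {j}" using assms by (auto simp: polys_def)
  then have "k \<notin> keys w" if "k \<noteq> j" using that by blast
  then show "lookup w k = lookup (single j (lookup w j)) k"
    by (auto simp: lookup_single when_def in_keys_iff)
qed

lemma univariate_nonzerodivisor:
  fixes A :: "'k::field mpoly set"
  assumes j: "j \<in> {1..n}" and A: "A \<subseteq> polys ({1..n} - {j})"
    and g: "g \<in> polys {j}" "g \<noteq> 0" and h: "h \<in> polys {1..n}"
    and gh: "g * h \<in> genideal (poly_ring n) A"
  shows "h \<in> genideal (poly_ring n) A"
proof (rule ccontr)
  interpret ring "poly_ring n :: 'k mpoly ring" by (rule ring_poly_ring)
  have Ac: "A \<subseteq> carrier (poly_ring n)" using A polys_mono[of "{1..n} - {j}" "{1..n}"] by auto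
  let ?J = "genideal (poly_ring n) A"
  have J: "ideal ?J (poly_ring n)" by (rule genideal_ideal[OF Ac])
  note JD = poly_idealD[OF J]
  assume "h \<notin> ?J"
  obtain N where N: "exponents_le h N" using ex_exponents_le by blast
  have "\<exists>e. var_coeff j e h \<notin> ?J"
  proof (rule ccontr)
    assume "\<not> ?thesis"
    then have "(\<Sum>e\<le>N. single (single j e) 1 * var_coeff j e h) \<in> ?J"
      using j by (intro poly_ideal_sum[OF J] JD(4) polys_single) auto
    then show False using var_coeff_expand[OF N, of j] \<open>h \<notin> ?J\<close> by simp
  qed
  moreover have "e \<le> N" if "var_coeff j e h \<notin> ?J" for e
    using that var_coeff_eq_0[OF N] JD(2) by (metis not_le)
  ultimately obtain e where e: "var_coeff j e h \<notin> ?J" and max: "\<And>e'. var_coeff j e' h \<notin> ?J \<Longrightarrow> e' \<le> e"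
    using Nat.ex_has_greatest_nat[of "\<lambda>e. var_coeff j e h \<notin> ?J" _ N] by metis
  note gkey = univariate_key[OF g(1)]
  define d where "d = Max (keys g)"
  have d: "d \<in> keys g" using g(2) by (simp add: d_def)
  let ?D = "lookup d j"
  have less: "lookup w j < ?D" if w: "w \<in> keys g" "w \<noteq> d" for w
  proof (rule ccontr)
    assume "\<not> ?thesis"
    then have "w = d + single j (lookup w j - ?D)"
      using gkey[OF w(1)] gkey[OF d] by (metis le_add_diff_inverse not_less single_add)
    then have "d \<le> w" using monomial_nonneg add_increasing2 order_refl by metis
    moreover have "w \<le> d" using w(1) by (simp add: d_def)
    ultimately show False using w(2) by simp
  qed
  let ?t = "\<lambda>w. var_coeff j (?D + e) (single w (lookup g w) * h)"
  have "(\<Sum>w\<in>keys g. ?t w) \<in> ?J"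
  proof -
    have "var_coeff j (?D + e) (g * h) = (\<Sum>w\<in>keys g. ?t w)"
      by (subst poly_mapping_sum_single[of g]) (simp add: sum_distrib_right var_coeff_sum)
    then show ?thesis using var_coeff_genideal[OF j A gh, of "?D + e"] by simp
  qed
  moreover have "(\<Sum>w\<in>keys g - {d}. ?t w) \<in> ?J"
  proof (rule poly_ideal_sum[OF J])
    fix w assume w: "w \<in> keys g - {d}"
    then have lt: "lookup w j < ?D" using less by blast
    then have "var_coeff j (?D + e - lookup w j) h \<in> ?J" using max[of "?D + e - lookup w j"] by force
    moreover have "w - single j (lookup w j) = 0" using gkey w by (metis DiffD1 cancel_comm_monoid_add_class.diff_cancel)
    ultimately show "?t w \<in> ?J" using lt by (auto simp: var_coeff_single_times intro!: JD(4) JD(2) polys_single)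
  qed
  ultimately have "?t d \<in> ?J"
    using JD(7) d by (metis (no_types, lifting) add_diff_cancel_right' finite_keys sum.remove)
  moreover have "d - single j ?D = 0" using gkey[OF d] by (metis cancel_comm_monoid_add_class.diff_cancel)
  ultimately have "single 0 (lookup g d) * var_coeff j e h \<in> ?J" by (simp add: var_coeff_single_times)
  then have "single 0 (inverse (lookup g d)) * (single 0 (lookup g d) * var_coeff j e h) \<in> ?J"
    by (rule JD(4)[rotated]) (simp add: polys_single)
  moreover have "single 0 (inverse (lookup g d)) * (single 0 (lookup g d) * var_coeff j e h) = var_coeff j e h"
    using d by (simp add: mult_single in_keys_iff flip: mult.assoc)
  ultimately show False using e by simp
qed

section \<open>Zariski's lemma\<close>

definition span_mod :: "nat \<Rightarrow> 'k::field mpoly set \<Rightarrow> nat set \<Rightarrow> monomial set \<Rightarrow> 'k mpoly set" where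
  "span_mod n Q T E = {s \<in> polys {1..n}. \<exists>a. (\<forall>w. a w \<in> polys T) \<and> s - (\<Sum>w\<in>E. a w * single w 1) \<in> Q}"

lemma span_mod_add:
  assumes Q: "ideal Q (poly_ring n)" and s: "s \<in> span_mod n Q T E" "t \<in> span_mod n Q T E"
  shows "s + t \<in> span_mod n Q T E"
proof -
  obtain a b where ab: "\<forall>w. a w \<in> polys T" "s - (\<Sum>w\<in>E. a w * single w 1) \<in> Q"
    "\<forall>w. b w \<in> polys T" "t - (\<Sum>w\<in>E. b w * single w 1) \<in> Q"
    using s by (auto simp: span_mod_def)
  have eq: "s + t - (\<Sum>w\<in>E. (a w + b w) * single w 1)
      = (s - (\<Sum>w\<in>E. a w * single w 1)) + (t - (\<Sum>w\<in>E. b w * single w 1))"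
    by (simp add: distrib_right sum.distrib)
  have "s + t - (\<Sum>w\<in>E. (a w + b w) * single w 1) \<in> Q"
    unfolding eq by (rule poly_idealD(3)[OF Q ab(2,4)])
  then show ?thesis using s ab
    unfolding span_mod_def by (intro CollectI conjI exI[of _ "\<lambda>w. a w + b w"]) (auto simp: span_mod_def intro: polys_add)
qed

lemma span_mod_mult:
  assumes Q: "ideal Q (poly_ring n)" and T: "T \<subseteq> {1..n}" and r: "r \<in> polys T" and s: "s \<in> span_mod n Q T E"
  shows "r * s \<in> span_mod n Q T E"
proof -
  have r': "r \<in> polys {1..n}" using r polys_mono[OF T] by blast
  obtain a where a: "\<forall>w. a w \<in> polys T" "s - (\<Sum>w\<in>E. a w * single w 1) \<in> Q" "s \<in> polys {1..n}"
    using s by (auto simp: span_mod_def)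
  have "r * s - (\<Sum>w\<in>E. (r * a w) * single w 1) = r * (s - (\<Sum>w\<in>E. a w * single w 1))"
    by (simp add: right_diff_distrib sum_distrib_left mult.assoc)
  then have "r * s - (\<Sum>w\<in>E. (r * a w) * single w 1) \<in> Q"
    using poly_idealD(4)[OF Q r' a(2)] by simp
  then show ?thesis using r r' a
    unfolding span_mod_def by (intro CollectI conjI exI[of _ "\<lambda>w. r * a w"]) (auto intro: polys_mult)
qed

lemma span_mod_ideal:
  assumes Q: "ideal Q (poly_ring n)" and "q \<in> Q"
  shows "q \<in> span_mod n Q T E"
  using assms(2) poly_idealD(1)[OF Q] by (auto simp: span_mod_def intro!: exI[of _ "\<lambda>_. 0"])

lemma span_mod_base:
  assumes Q: "ideal Q (poly_ring n)" and "finite E" "w \<in> E" "keys w \<subseteq> {1..n}"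
  shows "single w 1 \<in> span_mod n Q T E"
proof -
  have "(\<Sum>v\<in>E. (if v = w then 1 else 0) * single v 1) = (single w 1 :: 'a mpoly)"
    using assms by (subst sum.remove[of E w]) (auto intro!: sum.neutral)
  then show ?thesis
    using assms poly_idealD(2)[OF Q]
    by (auto simp: span_mod_def intro!: exI[of _ "\<lambda>v. if v = w then 1 else 0"] polys_single)
qed

lemma span_mod_sum:
  assumes Q: "ideal Q (poly_ring n)" and "\<And>x. x \<in> A \<Longrightarrow> f x \<in> span_mod n Q T E"
  shows "sum f A \<in> span_mod n Q T E"
  using assms(2)
  by (induction A rule: infinite_finite_induct)
    (auto intro: span_mod_add[OF Q] span_mod_ideal[OF Q] poly_idealD(2)[OF Q])

lemma span_mod_trans:
  assumes Q: "ideal Q (poly_ring n)" and T: "T \<subseteq> {1..n}" and k: "k \<in> polys {1..n}"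
    and s: "s \<in> span_mod n Q T E" and E: "\<And>w. w \<in> E \<Longrightarrow> k * single w 1 \<in> span_mod n Q T E'"
  shows "k * s \<in> span_mod n Q T E'"
proof -
  obtain a where a: "\<forall>w. a w \<in> polys T" "s - (\<Sum>w\<in>E. a w * single w 1) \<in> Q"
    using s by (auto simp: span_mod_def)
  have "k * s = k * (s - (\<Sum>w\<in>E. a w * single w 1)) + (\<Sum>w\<in>E. a w * (k * single w 1))"
    by (simp add: right_diff_distrib sum_distrib_left mult.left_commute)
  also have "\<dots> \<in> span_mod n Q T E'"
  proof (rule span_mod_add[OF Q])
    show "k * (s - (\<Sum>w\<in>E. a w * single w 1)) \<in> span_mod n Q T E'"
      by (rule span_mod_ideal[OF Q poly_idealD(4)[OF Q k a(2)]])
    show "(\<Sum>w\<in>E. a w * (k * single w 1)) \<in> span_mod n Q T E'"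
    proof (rule span_mod_sum[OF Q])
      show "a w * (k * single w 1) \<in> span_mod n Q T E'" if "w \<in> E" for w
        using span_mod_mult[OF Q T _ E[OF that], of "a w"] a(1) by simp
    qed
  qed
  finally show ?thesis .
qed

lemma monomial_add_eq_leD:
  fixes a b x y :: monomial
  assumes "a \<le> x" "b \<le> y" "a + b = x + y"
  shows "a = x \<and> b = y"
  using assms add_less_le_mono[of a x b y] add_le_less_mono[of a x b y]
  by (metis order.not_eq_order_implies_strict order.strict_implies_not_eq)

lemma unit_is_constant:
  fixes g :: "'k::field mpoly"
  assumes "g * h = 1"
  shows "g = single 0 (lookup g 0)"
proof -
  have gh: "g \<noteq> 0" "h \<noteq> 0" using assms by auto
  have fin: "keys g \<noteq> {}" "keys h \<noteq> {}" using gh by auto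
  have "lookup (g * h) (Max (keys g) + Max (keys h)) = lookup g (Max (keys g)) * lookup h (Max (keys h))"
  proof (rule lookup_times_unique)
    fix a b assume ab: "a \<in> keys g" "b \<in> keys h" "a + b = Max (keys g) + Max (keys h)"
    then have "a \<le> Max (keys g)" "b \<le> Max (keys h)" by auto
    then show "a = Max (keys g) \<and> b = Max (keys h)"
      using ab(3) by (metis monomial_add_eq_leD)
  qed
  also have "\<dots> \<noteq> 0" using Max_in[OF _ fin(1)] Max_in[OF _ fin(2)] by (simp add: in_keys_iff)
  finally have "Max (keys g) + Max (keys h) = 0" unfolding assms by (simp add: lookup_one when_def split: if_splits)
  moreover have "0 \<le> Max (keys h)" by (rule monomial_nonneg)
  ultimately have "Max (keys g) \<le> 0" by (metis add_increasing2 order_refl)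
  have "w = 0" if "w \<in> keys g" for w
  proof -
    have "w \<le> 0" using that \<open>Max (keys g) \<le> 0\<close> by (meson Max_ge finite_keys order_trans)
    then show ?thesis using monomial_nonneg[of w] by (rule antisym)
  qed
  then show ?thesis
    by (intro poly_mapping_eqI) (metis in_keys_iff lookup_single_eq lookup_single_not_eq)
qed

text \<open>
  If \<open>Q\<close> met \<open>k[x\<^sub>i]\<close> only in \<open>0\<close>, then over a maximal polynomial subring \<open>A = k[T]\<close> with
  \<open>A \<inter> Q = 0\<close> the field \<open>S/Q\<close> would be generated by finitely many elements after inverting a single
  \<open>c \<in> A\<close>, and inverting \<open>1 + x\<^sub>i c\<close> would be impossible.
\<close>

theorem zariski:
  fixes Q :: "'k::field mpoly set"
  assumes Qmax: "maximalideal Q (poly_ring n)" and i: "i \<in> {1..n}"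
  shows "\<exists>g\<in>Q. g \<noteq> 0 \<and> g \<in> polys {i}"
proof (rule ccontr)
  assume neg: "\<not> ?thesis"
  interpret Q: maximalideal Q "poly_ring n" by fact
  have Q: "ideal Q (poly_ring n)" by (rule Q.is_ideal)
  note QD = poly_idealD[OF Q]
  have Qprime: "a \<in> Q \<or> b \<in> Q" if "a * b \<in> Q" "a \<in> polys {1..n}" "b \<in> polys {1..n}" for a b
    using primeideal.I_prime[OF cring.maximalideal_prime[OF cring_poly_ring Qmax], of a b] that by simp
  have Q1: "1 \<notin> Q" using Q.I_notcarr Q.one_imp_carrier by auto
  define \<T> where "\<T> = {T. i \<in> T \<and> T \<subseteq> {1..n} \<and> polys T \<inter> Q \<subseteq> {0}}"
  have "{i} \<in> \<T>" using i neg by (auto simp: \<T>_def)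
  moreover have "finite \<T>" by (rule finite_subset[of _ "Pow {1..n}"]) (auto simp: \<T>_def)
  ultimately obtain T where T: "T \<in> \<T>" and Tmax: "\<And>T'. T' \<in> \<T> \<Longrightarrow> T \<subseteq> T' \<Longrightarrow> T' = T"
    using finite_has_maximal2[of \<T> "{i}"] by metis
  have Tn: "T \<subseteq> {1..n}" and iT: "i \<in> T" and TQ: "\<And>p. p \<in> polys T \<Longrightarrow> p \<in> Q \<Longrightarrow> p = 0"
    using T by (auto simp: \<T>_def)
  have Tpolys: "polys T \<subseteq> polys {1..n}" by (rule polys_mono[OF Tn])
  define V where "V = {1..n} - T"
  have "\<exists>p. p \<in> Q \<and> p \<noteq> 0 \<and> p \<in> polys (insert j T)" if "j \<in> V" for j
  proof -
    have "insert j T \<notin> \<T>" using Tmax[of "insert j T"] that by (auto simp: V_def)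
    then show ?thesis using that iT Tn by (auto simp: \<T>_def V_def)
  qed
  then obtain P where P: "\<And>j. j \<in> V \<Longrightarrow> P j \<in> Q \<and> P j \<noteq> 0 \<and> P j \<in> polys (insert j T)" by metis
  have coeffT: "var_coeff j e (P j) \<in> polys T" if "j \<in> V" for j e
    using polys_var_coeff[of "P j" "insert j T" j e] P[OF that] that
    by (auto simp: V_def intro: subsetD[OF polys_mono])
  have ex_D: "\<exists>D. var_coeff j D (P j) \<noteq> 0 \<and> P j = (\<Sum>e\<le>D. single (single j e) 1 * var_coeff j e (P j))"
    if "j \<in> V" for j
  proof -
    obtain N where N: "exponents_le (P j) N" using ex_exponents_le by blast
    have "\<exists>e. var_coeff j e (P j) \<noteq> 0"
    proof (rule ccontr)
      assume "\<not> ?thesis"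
      then have "P j = 0" by (subst var_coeff_expand[OF N, of j]) simp
      then show False using P[OF that] by simp
    qed
    moreover have "e \<le> N" if "var_coeff j e (P j) \<noteq> 0" for e
      using that var_coeff_eq_0[OF N] by (metis not_le)
    ultimately obtain D where D: "var_coeff j D (P j) \<noteq> 0" "\<And>e. var_coeff j e (P j) \<noteq> 0 \<Longrightarrow> e \<le> D"
      using Nat.ex_has_greatest_nat[of "\<lambda>e. var_coeff j e (P j) \<noteq> 0" _ N] by metis
    have "D \<le> N" using D(1) var_coeff_eq_0[OF N] by (metis not_le)
    have "P j = (\<Sum>e\<le>N. single (single j e) 1 * var_coeff j e (P j))" by (rule var_coeff_expand[OF N])
    also have "\<dots> = (\<Sum>e\<le>D. single (single j e) 1 * var_coeff j e (P j))"
    proof (rule sum.mono_neutral_right)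
      show "\<forall>e\<in>{..N} - {..D}. single (single j e) 1 * var_coeff j e (P j) = 0"
        using D(2) by (auto simp: not_le[symmetric])
    qed (use \<open>D \<le> N\<close> in auto)
    finally show ?thesis using D(1) by blast
  qed
  have "\<exists>D. \<forall>j\<in>V. var_coeff j (D j) (P j) \<noteq> 0 \<and> P j = (\<Sum>e\<le>D j. single (single j e) 1 * var_coeff j e (P j))"
    by (rule bchoice) (rule ballI, rule ex_D)
  then obtain D where D: "\<And>j. j \<in> V \<Longrightarrow> var_coeff j (D j) (P j) \<noteq> 0"
    "\<And>j. j \<in> V \<Longrightarrow> P j = (\<Sum>e\<le>D j. single (single j e) 1 * var_coeff j e (P j))" by blast
  have Dpos: "0 < D j" if "j \<in> V" for j
  proof (rule ccontr)
    assume "\<not> 0 < D j"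
    then have "P j = var_coeff j 0 (P j)" using D(2)[OF that] by simp
    then have "P j \<in> polys T" using coeffT[OF that] by metis
    then show False using TQ P[OF that] by blast
  qed
  define c where "c = (\<Prod>j\<in>V. var_coeff j (D j) (P j))"
  have finV: "finite V" by (simp add: V_def)
  have cT: "c \<in> polys T" unfolding c_def using coeffT by (intro polys_prod)
  have c0: "c \<noteq> 0" unfolding c_def using D(1) finV by simp
  define E where "E = {w. keys w \<subseteq> V \<and> (\<forall>j\<in>V. lookup w j < D j)}"
  have En: "keys w \<subseteq> {1..n}" if "w \<in> E" for w using that by (auto simp: E_def V_def)
  have finE: "finite E"
  proof (rule finite_subset[OF _ monomial_box(1)[of n D]], intro subsetI CollectI conjI ballI)
    fix w l assume w: "w \<in> E"
    show "lookup w l \<le> D l"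
    proof (cases "l \<in> V")
      case False
      then have "l \<notin> keys w" using w by (auto simp: E_def)
      then show ?thesis by (simp add: in_keys_iff)
    qed (use w in \<open>auto simp: E_def less_imp_le\<close>)
  qed (use En in blast)
  have zE: "0 \<in> E" using Dpos by (simp add: E_def)
  have Sp1: "1 \<in> span_mod n Q T E" using span_mod_base[OF Q finE zE] by simp
  have step: "(c * single (single j 1) 1) * single w 1 \<in> span_mod n Q T E" if w: "w \<in> E" and j: "j \<in> V" for w j
  proof (cases "w + single j 1 \<in> E")
    case True
    then have "c * single (w + single j 1) 1 \<in> span_mod n Q T E"
      by (intro span_mod_mult[OF Q Tn cT] span_mod_base[OF Q finE] En)
    then show ?thesis by (simp add: mult.assoc mult_single add.commute)
  next
    case False
    define w0 where "w0 = w - single j (lookup w j)"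
    have w_eq: "w = single j (lookup w j) + w0"
      unfolding w0_def by (rule monomial_diff_add) (auto simp: lookup_single when_def)
    have "lookup w j < D j" using w j by (simp add: E_def)
    moreover have "\<not> Suc (lookup w j) < D j"
    proof
      assume "Suc (lookup w j) < D j"
      then have "w + single j 1 \<in> E" using w j
        by (auto simp: E_def monomial_keys_add lookup_add lookup_single when_def)
      then show False using False by simp
    qed
    ultimately have Dj: "Suc (lookup w j) = D j" by simp
    have w0E: "single j e + w0 \<in> E" if "e < D j" for e
      using w j that monomial_keys_diff[of w "single j (lookup w j)"] unfolding E_def w0_def
      by (auto simp: monomial_keys_add lookup_add lookup_minus lookup_single when_def split: if_splits)
    define c' where "c' = (\<Prod>l\<in>V - {j}. var_coeff l (D l) (P l))"
    have c': "c = var_coeff j (D j) (P j) * c'" unfolding c_def c'_def using finV j by (rule prod.remove)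
    have c'T: "c' \<in> polys T" unfolding c'_def using coeffT by (intro polys_prod) auto
    have "single j (D j) + w0 = single j 1 + w" using Dj
      by (subst w_eq) (simp flip: add.assoc single_add)
    then have "(c * single (single j 1) 1) * single w 1 = c' * (var_coeff j (D j) (P j) * single (single j (D j) + w0) 1)"
      by (simp add: c' mult_single mult_ac add.commute[of w])
    also have "\<dots> = c' * (P j * single w0 1) + (\<Sum>e<D j. (- c' * var_coeff j e (P j)) * single (single j e + w0) 1)"
    proof -
      have "P j * single w0 1 = (\<Sum>e\<le>D j. var_coeff j e (P j) * single (single j e + w0) 1)"
      proof -
        have "P j * single w0 1 = (\<Sum>e\<le>D j. single (single j e) 1 * var_coeff j e (P j)) * single w0 1"
          by (subst D(2)[OF j]) (rule refl)
        also have "\<dots> = (\<Sum>e\<le>D j. var_coeff j e (P j) * (single (single j e) 1 * single w0 1))"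
          unfolding sum_distrib_right by (intro sum.cong refl) (simp only: mult_ac)
        finally show ?thesis by (simp add: mult_single)
      qed
      also have "\<dots> = (\<Sum>e<D j. var_coeff j e (P j) * single (single j e + w0) 1)
          + var_coeff j (D j) (P j) * single (single j (D j) + w0) 1"
        by (simp flip: lessThan_Suc_atMost)
      finally show ?thesis by (simp add: distrib_left sum_distrib_left sum_negf mult.assoc)
    qed
    also have "\<dots> \<in> span_mod n Q T E"
    proof (intro span_mod_add[OF Q] span_mod_sum[OF Q])
      have "keys w0 \<subseteq> {1..n}" unfolding w0_def using monomial_keys_diff[of w "single j (lookup w j)"] En[OF w] by blast
      then have "P j * single w0 1 \<in> Q" using P[OF j] by (intro QD(5) polys_single) auto
      then have "c' * (P j * single w0 1) \<in> Q" by (rule QD(4)[rotated]) (use c'T Tpolys in auto)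
      then show "c' * (P j * single w0 1) \<in> span_mod n Q T E" by (rule span_mod_ideal[OF Q])
      fix e assume "e \<in> {..<D j}"
      then have "single j e + w0 \<in> E" using w0E by simp
      then have "single (single j e + w0) 1 \<in> span_mod n Q T E" by (intro span_mod_base[OF Q finE] En)
      moreover have "- c' * var_coeff j e (P j) \<in> polys T"
        using coeffT[OF j] c'T by (intro polys_mult polys_uminus)
      ultimately show "(- c' * var_coeff j e (P j)) * single (single j e + w0) 1 \<in> span_mod n Q T E"
        by (rule span_mod_mult[OF Q Tn, rotated])
    qed
    finally show ?thesis .
  qed
  have var: "(c * single (single j 1) 1) * s \<in> span_mod n Q T E" if s: "s \<in> span_mod n Q T E" and j: "j \<in> {1..n}" for s j
  proof (cases "j \<in> T")
    case True
    then show ?thesis using cT by (intro span_mod_mult[OF Q Tn _ s] polys_mult polys_single) auto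
  next
    case False
    then have "j \<in> V" using j by (simp add: V_def)
    then show ?thesis using cT Tpolys j
      by (intro span_mod_trans[OF Q Tn _ s step] polys_mult polys_single) auto
  qed
  have mono: "\<exists>N. c ^ N * single w 1 \<in> span_mod n Q T E" if "keys w \<subseteq> {1..n}" for w
    using that
  proof (induction "\<Sum>j\<in>{1..n}. lookup w j" arbitrary: w)
    case 0
    then have "lookup w j = 0" for j by (cases "j \<in> {1..n}") (auto simp: in_keys_iff)
    then have "w = 0" by (simp add: poly_mapping_eqI)
    then show ?case using Sp1 by (intro exI[of _ 0]) simp
  next
    case (Suc m)
    then obtain j where j: "j \<in> {1..n}" "0 < lookup w j" by (metis gr0I nat.distinct(1) sum.neutral)
    define v where "v = w - single j 1"
    have w: "w = single j 1 + v" unfolding v_def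
      by (rule monomial_diff_add) (use j in \<open>auto simp: lookup_single when_def\<close>)
    have "(\<Sum>l\<in>{1..n}. lookup w l) = (\<Sum>l\<in>{1..n}. lookup (single j 1) l) + (\<Sum>l\<in>{1..n}. lookup v l)"
      by (simp add: w lookup_add sum.distrib)
    moreover have "(\<Sum>l\<in>{1..n}. lookup (single j (1::nat)) l) = 1"
      using j(1) by (simp add: lookup_single when_def)
    ultimately have "m = (\<Sum>l\<in>{1..n}. lookup v l)" using Suc.hyps(2) by simp
    moreover have "keys v \<subseteq> {1..n}" using Suc.prems w by (auto simp: monomial_keys_add)
    ultimately obtain N where "c ^ N * single v 1 \<in> span_mod n Q T E" using Suc.hyps(1) by blast
    then have "(c * single (single j 1) 1) * (c ^ N * single v 1) \<in> span_mod n Q T E" by (rule var[OF _ j(1)])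
    moreover have "(c * single (single j 1) 1) * (c ^ N * single v 1) = c ^ Suc N * single w 1"
    proof -
      have "(c * single (single j 1) 1) * (c ^ N * single v 1) = c ^ Suc N * (single (single j 1) 1 * single v 1)"
        by (simp only: power_Suc mult_ac)
      then show ?thesis by (simp add: w mult_single)
    qed
    ultimately show ?case by metis
  qed
  have cpow: "c ^ k * s \<in> span_mod n Q T E" if "s \<in> span_mod n Q T E" for k s
    by (rule span_mod_mult[OF Q Tn polys_power[OF cT] that])
  have all: "\<exists>N. c ^ N * s \<in> span_mod n Q T E" if "s \<in> polys {1..n}" for s
  proof -
    have "\<forall>w\<in>keys s. \<exists>N. c ^ N * single w 1 \<in> span_mod n Q T E" using mono that by (auto simp: polys_def)
    then obtain N where N: "\<And>w. w \<in> keys s \<Longrightarrow> c ^ N w * single w 1 \<in> span_mod n Q T E" by metis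
    define M where "M = (\<Sum>w\<in>keys s. N w)"
    have "c ^ M * s = (\<Sum>w\<in>keys s. (single 0 (lookup s w) * c ^ (M - N w)) * (c ^ N w * single w 1))"
    proof -
      have "c ^ M * s = (\<Sum>w\<in>keys s. c ^ M * single w (lookup s w))"
        by (subst poly_mapping_sum_single[of s]) (simp add: sum_distrib_left)
      also have "\<dots> = (\<Sum>w\<in>keys s. (single 0 (lookup s w) * c ^ (M - N w)) * (c ^ N w * single w 1))"
      proof (intro sum.cong refl)
        fix w assume "w \<in> keys s"
        then have "N w \<le> M" unfolding M_def by (intro member_le_sum) auto
        then have "c ^ M = c ^ (M - N w) * c ^ N w" by (simp flip: power_add)
        moreover have "single w (lookup s w) = single 0 (lookup s w) * single w 1" by (simp add: mult_single)
        ultimately show "c ^ M * single w (lookup s w) = (single 0 (lookup s w) * c ^ (M - N w)) * (c ^ N w * single w 1)"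
          by (simp add: mult_ac)
      qed
      finally show ?thesis .
    qed
    also have "\<dots> \<in> span_mod n Q T E"
    proof (rule span_mod_sum[OF Q])
      fix w assume "w \<in> keys s"
      then show "(single 0 (lookup s w) * c ^ (M - N w)) * (c ^ N w * single w 1) \<in> span_mod n Q T E"
        by (intro span_mod_mult[OF Q Tn _ N]) (intro polys_mult polys_power polys_single cT, simp)
    qed
    finally show ?thesis by blast
  qed
  define indep where "indep F \<longleftrightarrow> (\<forall>a. (\<forall>w. a w \<in> polys T) \<longrightarrow> (\<Sum>w\<in>F. a w * single w 1) \<in> Q \<longrightarrow> (\<forall>w\<in>F. a w = 0))" for F
  define \<E> where "\<E> = {F. F \<subseteq> E \<and> 0 \<in> F \<and> indep F}"
  have "indep {0}" using TQ by (auto simp: indep_def)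
  then have "{0} \<in> \<E>" using zE by (auto simp: \<E>_def)
  moreover have "finite \<E>" by (rule finite_subset[of _ "Pow E"]) (auto simp: \<E>_def finE)
  ultimately obtain F where F: "F \<in> \<E>" and Fmax: "\<And>F'. F' \<in> \<E> \<Longrightarrow> F \<subseteq> F' \<Longrightarrow> F' = F"
    using finite_has_maximal2[of \<E> "{0}"] by metis
  have FE: "F \<subseteq> E" and zF: "0 \<in> F" and Find: "indep F" using F by (auto simp: \<E>_def)
  have finF: "finite F" using FE finE finite_subset by blast
  have "\<exists>k. k \<in> polys T \<and> k \<noteq> 0 \<and> k * single w 1 \<in> span_mod n Q T F" if w: "w \<in> E" for w
  proof (cases "w \<in> F")
    case True
    then show ?thesis using span_mod_base[OF Q finF True En[OF w]] by (intro exI[of _ 1]) simp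
  next
    case False
    then have "\<not> indep (insert w F)" using Fmax[of "insert w F"] w FE zF by (auto simp: \<E>_def)
    then obtain a where a: "\<forall>w. a w \<in> polys T" "(\<Sum>v\<in>insert w F. a v * single v 1) \<in> Q" "\<exists>v\<in>insert w F. a v \<noteq> 0"
      by (auto simp: indep_def)
    have sum: "(\<Sum>v\<in>insert w F. a v * single v 1) = a w * single w 1 + (\<Sum>v\<in>F. a v * single v 1)"
      using finF False by simp
    have "a w \<noteq> 0"
    proof
      assume "a w = 0"
      then have "(\<Sum>v\<in>F. a v * single v 1) \<in> Q" using a(2) sum by simp
      then have "\<forall>v\<in>F. a v = 0" using Find a(1) by (auto simp: indep_def)
      then show False using a(3) \<open>a w = 0\<close> by auto
    qed
    moreover have "a w * single w 1 \<in> span_mod n Q T F"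
      unfolding span_mod_def
    proof (intro CollectI conjI exI[of _ "\<lambda>v. - a v"] allI)
      show "a w * single w 1 \<in> polys {1..n}" using a(1) Tpolys En[OF w] by (intro polys_mult polys_single) auto
      show "- a v \<in> polys T" for v using a(1) by (simp add: polys_uminus)
      show "a w * single w 1 - (\<Sum>w\<in>F. - a w * single w 1) \<in> Q" using a(2) unfolding sum by (simp add: sum_negf)
    qed
    ultimately show ?thesis using a(1) by blast
  qed
  then obtain k where k: "\<And>w. w \<in> E \<Longrightarrow> k w \<in> polys T \<and> k w \<noteq> 0 \<and> k w * single w 1 \<in> span_mod n Q T F" by metis
  define \<kappa> where "\<kappa> = (\<Prod>w\<in>E. k w)"
  have \<kappa>T: "\<kappa> \<in> polys T" unfolding \<kappa>_def using k by (intro polys_prod) blast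
  have \<kappa>0: "\<kappa> \<noteq> 0" unfolding \<kappa>_def using k finE by simp
  have \<kappa>w: "\<kappa> * single w 1 \<in> span_mod n Q T F" if w: "w \<in> E" for w
  proof -
    have "\<kappa> * single w 1 = (\<Prod>v\<in>E - {w}. k v) * (k w * single w 1)"
      unfolding \<kappa>_def using finE w by (simp add: prod.remove mult_ac)
    also have "\<dots> \<in> span_mod n Q T F"
      using k w by (intro span_mod_mult[OF Q Tn polys_prod]) auto
    finally show ?thesis .
  qed
  define b where "b = c * \<kappa>"
  have bT: "b \<in> polys T" unfolding b_def by (intro polys_mult cT \<kappa>T)
  have b0: "b \<noteq> 0" using c0 \<kappa>0 by (simp add: b_def)
  have bspan: "\<exists>N. b ^ N * s \<in> span_mod n Q T F" if s: "s \<in> polys {1..n}" for s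
  proof -
    obtain N where N: "c ^ N * s \<in> span_mod n Q T E" using all[OF s] by blast
    have "\<kappa> * (c ^ N * s) \<in> span_mod n Q T F"
      using \<kappa>T Tpolys by (intro span_mod_trans[OF Q Tn _ N \<kappa>w]) auto
    then have "(c * \<kappa> ^ N) * (\<kappa> * (c ^ N * s)) \<in> span_mod n Q T F"
      by (rule span_mod_mult[OF Q Tn, rotated]) (intro polys_mult polys_power cT \<kappa>T)
    moreover have "(c * \<kappa> ^ N) * (\<kappa> * (c ^ N * s)) = b ^ Suc N * s"
      by (simp add: b_def power_mult_distrib mult_ac)
    ultimately show ?thesis by metis
  qed
  define x :: "'k mpoly" where "x = single (single i 1) 1"
  define g where "g = 1 + x * b"
  have xT: "x \<in> polys T" unfolding x_def using iT by (intro polys_single) auto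
  have gT: "g \<in> polys T" unfolding g_def by (intro polys_add polys_mult polys_1 xT bT)
  have x0: "x \<noteq> 0" by (metis x_def lookup_single_eq lookup_zero zero_neq_one)
  have key0: "lookup (x * b) 0 = 0"
  proof -
    have "0 \<notin> keys (x * b)" unfolding x_def by (rule zero_notin_keys_var_times)
    then show ?thesis by (simp add: in_keys_iff)
  qed
  then have "lookup g 0 = 1" by (simp add: g_def lookup_add)
  then have "g \<noteq> 0" by auto
  then have gQ: "g \<notin> Q" using TQ gT by blast
  have gn: "g \<in> polys {1..n}" using gT Tpolys by blast
  have "\<exists>s\<in>polys {1..n}. g * s - 1 \<in> Q"
  proof -
    interpret R: cring "poly_ring n :: 'k mpoly ring" by (rule cring_poly_ring)
    define K where "K = {j + g * r | j r. j \<in> Q \<and> r \<in> polys {1..n}}"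
    have K: "ideal K (poly_ring n)" using R.add_principal_ideal[OF Q, of g] gn by (simp add: K_def)
    have "Q \<subseteq> K"
    proof
      fix q assume "q \<in> Q"
      then show "q \<in> K" unfolding K_def by (intro CollectI exI[of _ q] exI[of _ 0]) simp
    qed
    then have "K = Q \<or> K = carrier (poly_ring n)"
      using poly_idealD(1)[OF K] by (intro Q.I_maximal[OF K]) simp_all
    moreover have "g \<in> K" unfolding K_def using QD(2) by (intro CollectI exI[of _ 0] exI[of _ 1]) simp
    ultimately have "1 \<in> K" using gQ by auto
    then obtain j r where "1 = j + g * r" "j \<in> Q" "r \<in> polys {1..n}" unfolding K_def by blast
    moreover from this have "g * r - 1 = - j" by (simp add: algebra_simps)
    ultimately show ?thesis using QD(6) by metis
  qed
  then obtain s where s: "s \<in> polys {1..n}" "g * s - 1 \<in> Q" by blast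
  obtain N where "b ^ N * s \<in> span_mod n Q T F" using bspan[OF s(1)] by blast
  then obtain a where a: "\<forall>w. a w \<in> polys T" "b ^ N * s - (\<Sum>w\<in>F. a w * single w 1) \<in> Q"
    by (auto simp: span_mod_def)
  define a' where "a' w = (if w = 0 then b ^ N else 0) - g * a w" for w
  have "(\<Sum>w\<in>F. a' w * single w 1) = b ^ N - g * (\<Sum>w\<in>F. a w * single w 1)"
  proof -
    have "(\<Sum>w\<in>F. (if w = 0 then b ^ N else 0) * single w 1) = (\<Sum>w\<in>F. if w = 0 then b ^ N else 0)"
      by (intro sum.cong) auto
    also have "\<dots> = b ^ N" using finF zF by simp
    finally show ?thesis by (simp add: a'_def left_diff_distrib sum_subtractf sum_distrib_left mult.assoc)
  qed
  also have "\<dots> = g * (b ^ N * s - (\<Sum>w\<in>F. a w * single w 1)) - b ^ N * (g * s - 1)"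
    by (simp add: algebra_simps)
  also have "\<dots> \<in> Q"
    using bT Tpolys by (intro QD(7) QD(4) gn a(2) s(2) polys_power) auto
  finally have "(\<Sum>w\<in>F. a' w * single w 1) \<in> Q" .
  moreover have "\<forall>w. a' w \<in> polys T" using a(1) bT gT
    by (auto simp: a'_def intro!: polys_diff polys_uminus polys_mult polys_power)
  ultimately have "a' 0 = 0" using Find zF unfolding indep_def by blast
  then have gdvd: "g dvd b ^ N" by (simp add: a'_def)
  have "g dvd x ^ N * b ^ N" using gdvd by simp
  also have "x ^ N * b ^ N = (g - 1) ^ N" by (simp add: g_def power_mult_distrib)
  finally have "g dvd (g - 1) ^ N" .
  moreover have "g dvd (g - 1) ^ N - (- 1) ^ N"
  proof -
    have "(g - 1) - (- 1) dvd (g - 1) ^ N - (- 1) ^ N" by (subst power_diff_sumr2) simp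
    then show ?thesis by simp
  qed
  ultimately have "g dvd (- 1) ^ N" using dvd_diff_right_iff by (metis dvd_diff diff_diff_eq2 add_diff_cancel_left')
  then have "g dvd 1" by (simp add: minus_one_power_iff split: if_splits)
  then obtain h where "g * h = 1" by (metis dvdE)
  then have "g = single 0 (lookup g 0)" by (rule unit_is_constant)
  then have "g = 1" using \<open>lookup g 0 = 1\<close> by simp
  then show False using x0 b0 by (simp add: g_def)
qed

section \<open>A family of Cohen--Macaulay monomial quotients\<close>

lemma univariate_top_key:
  assumes "F \<in> polys {j}" "F \<noteq> 0" "0 \<notin> keys F"
  obtains e where "0 < e" "single j e \<in> keys F" "\<And>w. w \<in> keys F \<Longrightarrow> 0 < lookup w j \<and> lookup w j \<le> e"
proof -
  have ne: "keys F \<noteq> {}" using assms(2) by simp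
  define e where "e = Max ((\<lambda>w. lookup w j) ` keys F)"
  have "e \<in> (\<lambda>w. lookup w j) ` keys F" unfolding e_def using ne by (intro Max_in) auto
  then have e: "single j e \<in> keys F" using univariate_key[OF assms(1)] by force
  have pos: "0 < lookup w j" if "w \<in> keys F" for w
  proof (rule ccontr)
    assume "\<not> 0 < lookup w j"
    then have "w = 0" using univariate_key[OF assms(1) that] by (metis gr0I single_zero)
    then show False using that assms(3) by simp
  qed
  have "0 < e" using pos[OF e] by simp
  then show thesis using e pos by (intro that[of e]) (auto simp: e_def)
qed

lemma binomial_nonzerodivisor:
  fixes F1 Fn h :: "'k::field mpoly"
  assumes U: "upset U" and pq: "p \<noteq> q"
    and red: "\<And>w. w + single p 1 + single p 1 \<in> U \<Longrightarrow> w + single p 1 \<in> U"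
    and sat: "\<And>w. keys w \<subseteq> {1..n} \<Longrightarrow> lookup w p = 0 \<Longrightarrow> w + single p 1 \<in> U \<Longrightarrow> w + single q 1 \<in> U \<Longrightarrow> w \<in> U"
    and F: "F1 \<in> polys {p}" "F1 \<noteq> 0" "0 \<notin> keys F1" "Fn \<in> polys {q}" "Fn \<noteq> 0" "0 \<notin> keys Fn" "{p, q} \<subseteq> {1..n}"
    and h: "h \<in> polys {1..n}" and fh: "(F1 + Fn) * h \<in> monomial_ideal n U"
  shows "h \<in> monomial_ideal n U"
proof -
  let ?I = "monomial_ideal n U :: 'k mpoly set"
  note I = monomial_ideal_ideal[OF U, of n, where 'k = 'k]
  define h' where "h' = (\<Sum>w\<in>keys h - U. single w (lookup h w))"
  have look: "lookup h' w = (if w \<in> U then 0 else lookup h w)" for w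
  proof -
    have "lookup h' w = (\<Sum>v\<in>keys h - U. if v = w then lookup h w else 0)"
      unfolding h'_def lookup_sum by (intro sum.cong) (auto simp: lookup_single when_def)
    then show ?thesis by (simp add: in_keys_iff)
  qed
  have keys': "keys h' = keys h - U" by (auto simp: in_keys_iff look split: if_splits)
  have h'p: "h' \<in> polys {1..n}" using h by (auto simp: polys_def keys')
  have diff: "h - h' \<in> ?I"
    using polys_diff[OF h h'p] by (auto simp: monomial_ideal_def in_keys_iff lookup_minus look split: if_splits)
  have Fp: "F1 \<in> polys {1..n}" "Fn \<in> polys {1..n}"
    using F polys_mono[of "{p}" "{1..n}"] polys_mono[of "{q}" "{1..n}"] by auto
  have "(F1 + Fn) * h' = (F1 + Fn) * h - (F1 + Fn) * (h - h')" by (simp add: algebra_simps)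
  also have "\<dots> \<in> ?I" by (rule poly_idealD(7)[OF I fh poly_idealD(4)[OF I polys_add[OF Fp] diff]])
  finally have fU: "keys ((F1 + Fn) * h') \<subseteq> U" by (simp add: monomial_ideal_def)
  obtain e1 where e1: "0 < e1" "single p e1 \<in> keys F1" "\<And>w. w \<in> keys F1 \<Longrightarrow> 0 < lookup w p \<and> lookup w p \<le> e1"
    by (rule univariate_top_key[OF F(1-3)]) blast
  obtain en where en: "0 < en" "single q en \<in> keys Fn" "\<And>w. w \<in> keys Fn \<Longrightarrow> 0 < lookup w q \<and> lookup w q \<le> en"
    by (rule univariate_top_key[OF F(4-6)]) blast
  note key1 = univariate_key[OF F(1)] and keyn = univariate_key[OF F(4)]
  have n1: "lookup w p = 0" if "w \<in> keys Fn" for w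
    using keyn[OF that] pq by (metis lookup_single_not_eq)
  have n2: "lookup w q = 0" if "w \<in> keys F1" for w
    using key1[OF that] pq by (metis lookup_single_not_eq)
  have kF: "keys (F1 + Fn) \<subseteq> keys F1 \<union> keys Fn" by (rule Poly_Mapping.keys_add)
  have disj: "w \<notin> keys Fn" if "w \<in> keys F1" for w using n1[of w] e1(3)[OF that] by auto
  have c1: "lookup (F1 + Fn) (single p e1) \<noteq> 0"
    using e1(2) disj[OF e1(2)] by (simp add: lookup_add in_keys_iff)
  have cn: "lookup (F1 + Fn) (single q en) \<noteq> 0"
  proof -
    have "single q en \<notin> keys F1" using en(2) disj by blast
    then show ?thesis using en(2) by (simp add: lookup_add in_keys_iff)
  qed
  have "h' = 0"
  proof (rule ccontr)
    assume "h' \<noteq> 0"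
    then have ne: "keys h' \<noteq> {}" by simp
    define a where "a = Max ((\<lambda>w. lookup w p) ` keys h')"
    have le_a: "lookup w p \<le> a" if "w \<in> keys h'" for w using that by (simp add: a_def)
    have shift: "w + single p 1 \<in> U" if "w + single p (Suc k) \<in> U" for w k
      using that
    proof (induction k arbitrary: w)
      case (Suc k)
      have "single p (Suc (Suc k)) = single p (Suc k) + single p (1::nat)" by (simp flip: single_add)
      then have "(w + single p k) + single p 1 + single p 1 \<in> U"
        using Suc.prems by (simp add: add.assoc flip: single_add)
      then have "(w + single p k) + single p 1 \<in> U" by (rule red)
      then show ?case using Suc.IH by (simp add: add.assoc flip: single_add)
    qed simp
    have top: "w + single p 1 \<in> U" if w: "w \<in> keys h'" "lookup w p = a" for w
    proof -
      have "lookup ((F1 + Fn) * h') (single p e1 + w) = lookup (F1 + Fn) (single p e1) * lookup h' w"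
      proof (rule lookup_times_unique)
        fix \<alpha> \<beta> assume *: "\<alpha> \<in> keys (F1 + Fn)" "\<beta> \<in> keys h'" "\<alpha> + \<beta> = single p e1 + w"
        have "lookup (\<alpha> + \<beta>) p = lookup (single p e1 + w) p" by (simp add: *(3))
        then have eq: "lookup \<alpha> p + lookup \<beta> p = e1 + a" using w by (simp add: lookup_add)
        then have "0 < lookup \<alpha> p" using le_a[OF *(2)] e1(1) by simp
        then have "\<alpha> \<in> keys F1" using *(1) kF n1[of \<alpha>] by auto
        then have "lookup \<alpha> p = e1" using eq le_a[OF *(2)] e1(3)[of \<alpha>] by simp
        then have "\<alpha> = single p e1" using key1[OF \<open>\<alpha> \<in> keys F1\<close>] by simp
        then show "\<alpha> = single p e1 \<and> \<beta> = w" using *(3) by simp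
      qed
      then have "single p e1 + w \<in> keys ((F1 + Fn) * h')" using c1 w(1) by (simp add: in_keys_iff)
      then have "w + single p (Suc (e1 - 1)) \<in> U" using fU e1(1) by (auto simp: add.commute)
      then show ?thesis by (rule shift)
    qed
    have "a \<in> (\<lambda>w. lookup w p) ` keys h'" unfolding a_def using ne by (intro Max_in) auto
    then obtain w0 where w0: "w0 \<in> keys h'" "lookup w0 p = a" by auto
    have "a = 0"
    proof (rule ccontr)
      assume "a \<noteq> 0"
      have "w0 = single p 1 + (w0 - single p 1)"
        by (rule monomial_diff_add) (use w0 \<open>a \<noteq> 0\<close> in \<open>auto simp: lookup_single when_def\<close>)
      then have w0_eq: "w0 = (w0 - single p 1) + single p 1" by (simp add: add.commute)
      then have "(w0 - single p 1) + single p 1 + single p 1 \<in> U" using top[OF w0] by simp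
      then have "w0 \<in> U" using red w0_eq by metis
      then show False using w0(1) keys' by auto
    qed
    then have deg0: "lookup w p = 0" if "w \<in> keys h'" for w using le_a[OF that] by simp
    then have x1: "w + single p 1 \<in> U" if "w \<in> keys h'" for w using top[OF that] that \<open>a = 0\<close> by simp
    define b where "b = Max ((\<lambda>w. lookup w q) ` keys h')"
    have le_b: "lookup w q \<le> b" if "w \<in> keys h'" for w using that by (simp add: b_def)
    have "b \<in> (\<lambda>w. lookup w q) ` keys h'" unfolding b_def using ne by (intro Max_in) auto
    then obtain w where w: "w \<in> keys h'" "lookup w q = b" by auto
    have "lookup ((F1 + Fn) * h') (single q en + w) = lookup (F1 + Fn) (single q en) * lookup h' w"
    proof (rule lookup_times_unique)
      fix \<alpha> \<beta> assume *: "\<alpha> \<in> keys (F1 + Fn)" "\<beta> \<in> keys h'" "\<alpha> + \<beta> = single q en + w"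
      have "lookup (\<alpha> + \<beta>) p = lookup (single q en + w) p" by (simp add: *(3))
      then have "lookup \<alpha> p = 0" using deg0[OF w(1)] deg0[OF *(2)] pq by (simp add: lookup_add lookup_single when_def)
      then have "\<alpha> \<in> keys Fn" using *(1) kF e1(3)[of \<alpha>] by auto
      have "lookup (\<alpha> + \<beta>) q = lookup (single q en + w) q" by (simp add: *(3))
      then have "lookup \<alpha> q + lookup \<beta> q = en + b" using w by (simp add: lookup_add)
      then have "lookup \<alpha> q = en" using le_b[OF *(2)] en(3)[OF \<open>\<alpha> \<in> keys Fn\<close>] by simp
      then have "\<alpha> = single q en" using keyn[OF \<open>\<alpha> \<in> keys Fn\<close>] by simp
      then show "\<alpha> = single q en \<and> \<beta> = w" using *(3) by simp
    qed
    then have "single q en + w \<in> keys ((F1 + Fn) * h')" using cn w(1) by (simp add: in_keys_iff)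
    then have "w + single q en \<in> U" using fU by (auto simp: add.commute)
    moreover have "v \<in> U" if "v + single q k \<in> U" "v + single p 1 \<in> U" "lookup v p = 0" "keys v \<subseteq> {1..n}" for v k
      using that
    proof (induction k)
      case (Suc k)
      have "(v + single q k) + single q 1 \<in> U" using Suc.prems(1) by (simp add: add.assoc flip: single_add)
      moreover have "(v + single q k) + single p 1 \<in> U"
        using upsetD[OF U Suc.prems(2), of "single q k"] by (simp add: add_ac)
      moreover have "lookup (v + single q k) p = 0" using Suc.prems(3) pq by (simp add: lookup_add lookup_single when_def)
      moreover have "keys (v + single q k) \<subseteq> {1..n}" using Suc.prems(4) F(7) by (auto simp: monomial_keys_add)
      ultimately have "v + single q k \<in> U" using sat by blast
      then show ?case using Suc by blast
    qed simp
    moreover have "keys w \<subseteq> {1..n}" using w(1) h'p by (auto simp: polys_def)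
    ultimately have "w \<in> U" using x1[OF w(1)] deg0[OF w(1)] by blast
    then show False using w(1) keys' by auto
  qed
  then show ?thesis using diff by simp
qed

lemma genideal_genideal_Un:
  assumes "ring R" "A \<subseteq> carrier R" "X \<subseteq> carrier R"
  shows "genideal R (genideal R A \<union> X) = genideal R (A \<union> X)"
proof
  interpret ring R by fact
  have AX: "A \<union> X \<subseteq> carrier R" using assms by auto
  have IA: "genideal R A \<subseteq> carrier R" by (rule genideal_minimal[OF oneideal assms(2)])
  have "genideal R A \<subseteq> genideal R (A \<union> X)" by (rule subset_Idl_subset[OF AX Un_upper1])
  then show "genideal R (genideal R A \<union> X) \<subseteq> genideal R (A \<union> X)"
    using genideal_self[OF AX] by (intro genideal_minimal[OF genideal_ideal[OF AX]] Un_least) simp_all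
  show "genideal R (A \<union> X) \<subseteq> genideal R (genideal R A \<union> X)"
  proof (rule genideal_minimal)
    have IX: "genideal R A \<union> X \<subseteq> carrier R" using IA assms(3) by auto
    show "ideal (genideal R (genideal R A \<union> X)) R" by (rule genideal_ideal[OF IX])
    show "A \<union> X \<subseteq> genideal R (genideal R A \<union> X)"
      by (rule subset_trans[OF Un_mono[OF genideal_self[OF assms(2)] subset_refl] genideal_self[OF IX]])
  qed
qed

theorem monomial_quot_cohen_macaulayI:
  fixes n d :: nat and G :: "monomial set"
  defines "U \<equiv> multiples G"
  assumes n: "2 \<le> n" and W: "W \<subseteq> {2..n - 1}" and G: "G \<subseteq> {w. keys w \<subseteq> {1..n} - W}"
    and nilp: "\<And>i. i \<in> {2..n - 1} - W \<Longrightarrow> single i d \<in> U"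
    and mixed: "single 1 1 + single n d \<in> U"
    and red: "\<And>w. w + single 1 1 + single 1 1 \<in> U \<Longrightarrow> w + single 1 1 \<in> U"
    and sat: "\<And>w. keys w \<subseteq> {1..n} \<Longrightarrow> lookup w 1 = 0 \<Longrightarrow> w + single 1 1 \<in> U \<Longrightarrow> w + single n 1 \<in> U \<Longrightarrow> w \<in> U"
  shows "cohen_macaulay_ring (poly_ring n Quot (monomial_ideal n U :: 'k::field mpoly set))"
  unfolding cohen_macaulay_ring_def
proof (intro conjI allI impI)
  let ?S = "poly_ring n :: 'k mpoly ring"
  define I where "I = (monomial_ideal n U :: 'k mpoly set)"
  define Gi where "Gi = (\<lambda>w. single w (1::'k)) ` G"
  let ?R = "?S Quot I"
  let ?\<pi> = "(+>\<^bsub>?S\<^esub>) I"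
  interpret S: cring ?S by (rule cring_poly_ring)
  have U: "upset U" unfolding U_def by (rule upset_multiples)
  have I: "ideal I ?S" unfolding I_def by (rule monomial_ideal_ideal[OF U])
  have Gn: "G \<subseteq> {w. keys w \<subseteq> {1..n}}" using G by auto
  have I_eq: "I = genideal ?S Gi" unfolding I_def U_def Gi_def by (rule genideal_monomials[OF Gn, symmetric])
  have Gic: "Gi \<subseteq> carrier ?S" using Gn by (auto simp: Gi_def intro!: polys_single)
  interpret h: ring_hom_ring ?S ?R ?\<pi> by (rule ideal.rcos_ring_hom_ring[OF I])
  have cr: "cring ?R" by (rule ideal.quotient_is_cring[OF I cring_poly_ring])
  have noeth: "noetherian_ring ?R" by (rule noetherian_ring.Quot_noetherian[OF noetherian_poly_ring I])
  show "cring (?S Quot monomial_ideal n U)" "noetherian_ring (?S Quot monomial_ideal n U)"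
    using cr noeth by (simp_all only: I_def)
  fix P assume "maximalideal P (?S Quot monomial_ideal n U)"
  then have P: "maximalideal P ?R" by (simp only: I_def)
  define Q where "Q = {a \<in> carrier ?S. ?\<pi> a \<in> P}"
  have Q: "maximalideal Q ?S" unfolding Q_def by (rule S.Quot_maximalideal_vimage[OF I P])
  interpret Q: maximalideal Q ?S by fact
  note QD = poly_idealD[OF Q.is_ideal]
  have IQ: "I \<subseteq> Q" unfolding Q_def by (rule S.Quot_vimage(2)[OF I maximalideal.axioms(1)[OF P]])
  have primeP: "primeideal P ?R" by (rule cring.maximalideal_prime[OF cr P])
  have Wn: "W \<subseteq> {1..n}" using W by (rule order_trans) auto
  have finW: "finite W" using W finite_subset by blast
  let ?r = "Suc (card W)"
  have hle: "height ?R P \<le> enat ?r"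
  proof (rule height_le)
    fix as assume as: "set as \<subseteq> carrier ?R" "length as = Suc ?r"
    have "set as \<subseteq> ?\<pi> ` polys {1..n}" using as(1) by (simp add: S.Quot_carrier)
    then obtain as' where as': "as = map ?\<pi> as'" "set as' \<subseteq> polys {1..n}" by (rule S.Quot_list_lift)
    have "\<exists>e\<in>boundary_set ?S as'. e \<in> monomial_ideal n U"
    proof (rule boundary_set_meets_monomial_ideal[OF U as'(2), of ?r "2 * Suc d ^ n"])
      show "length as' = Suc ?r" using as(2) as'(1) by simp
      fix M :: nat
      define c where "c j i = (if i \<in> insert j W then M else d)" for j i
      have box: "(\<Prod>i\<in>{1..n}. Suc (c j i)) \<le> Suc d ^ n * Suc M ^ ?r" if j: "j \<in> {1..n}" "j \<notin> W" for j
      proof -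
        have sub: "insert j W \<subseteq> {1..n}" using j Wn by auto
        have "(\<Prod>i\<in>{1..n}. Suc (c j i)) = (\<Prod>i\<in>{1..n} - insert j W. Suc (c j i)) * (\<Prod>i\<in>insert j W. Suc (c j i))"
          by (rule prod.subset_diff[OF sub]) simp
        also have "(\<Prod>i\<in>insert j W. Suc (c j i)) = (\<Prod>i\<in>insert j W. Suc M)" by (intro prod.cong) (auto simp: c_def)
        also have "\<dots> = Suc M ^ ?r" using finW j(2) by simp
        also have "(\<Prod>i\<in>{1..n} - insert j W. Suc (c j i)) = (\<Prod>i\<in>{1..n} - insert j W. Suc d)" by (intro prod.cong) (auto simp: c_def)
        also have "\<dots> \<le> Suc d ^ n"
          using card_mono[of "{1..n}" "{1..n} - insert j W"] by (simp add: power_increasing del: power_Suc)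
        finally show ?thesis by (simp add: mult_right_mono)
      qed
      let ?B = "{w :: monomial. keys w \<subseteq> {1..n} \<and> (\<forall>i\<in>{1..n}. lookup w i \<le> M) \<and> w \<notin> U}"
      let ?box = "\<lambda>j. {w :: monomial. keys w \<subseteq> {1..n} \<and> (\<forall>i\<in>{1..n}. lookup w i \<le> c j i)}"
      have "?B \<subseteq> ?box 1 \<union> ?box n"
      proof
        fix w assume w: "w \<in> ?B"
        have mid: "lookup w i \<le> d" if i: "i \<in> {2..n - 1} - W" for i
        proof (rule ccontr)
          assume "\<not> lookup w i \<le> d"
          then have "w = single i d + (w - single i d)"
            by (intro monomial_diff_add) (auto simp: lookup_single when_def)
          then show False using w upsetD[OF U nilp[OF i]] by (metis (mono_tags, lifting) mem_Collect_eq)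
        qed
        have "lookup w 1 = 0 \<or> lookup w n \<le> d"
        proof (rule ccontr)
          assume "\<not> ?thesis"
          then have "w = (single 1 1 + single n d) + (w - (single 1 1 + single n d))"
            using n by (intro monomial_diff_add) (auto simp: lookup_add lookup_single when_def)
          then show False using w upsetD[OF U mixed] by (metis (mono_tags, lifting) mem_Collect_eq)
        qed
        moreover have mid': "lookup w i \<le> d" if "i \<in> {1..n}" "i \<noteq> 1" "i \<noteq> n" "i \<notin> W" for i
          using that by (intro mid) auto
        moreover have "lookup w i \<le> c n i" if "lookup w 1 = 0" "i \<in> {1..n}" for i
          using that w mid'[of i] by (cases "i = 1") (auto simp: c_def)
        moreover have "lookup w i \<le> c 1 i" if "lookup w n \<le> d" "i \<in> {1..n}" for i
          using that w mid'[of i] by (cases "i = n") (auto simp: c_def)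
        ultimately show "w \<in> ?box 1 \<union> ?box n" using w by blast
      qed
      then have "card ?B \<le> card (?box 1 \<union> ?box n)" by (intro card_mono finite_UnI monomial_box(1))
      also have "\<dots> \<le> card (?box 1) + card (?box n)" by (rule card_Un_le)
      also have "\<dots> \<le> Suc d ^ n * Suc M ^ ?r + Suc d ^ n * Suc M ^ ?r"
        using W n by (intro add_mono order_trans[OF monomial_box(2) box]) auto
      finally show "card ?B \<le> 2 * Suc d ^ n * Suc M ^ ?r" by simp
    qed
    then obtain e where e: "e \<in> boundary_set ?S as'" "e \<in> I" by (auto simp: I_def)
    have "?\<pi> e = \<zero>\<^bsub>?R\<^esub>" using S.Quot_eq_zero_iff[OF I] e(2) poly_idealD(1)[OF I] by auto
    moreover have "?\<pi> e \<in> boundary_set ?R as"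
      unfolding as'(1) by (rule boundary_set_hom[OF h.ring_hom_ring_axioms _ e(1)]) (use as' in simp)
    ultimately show "\<zero>\<^bsub>?R\<^esub> \<in> boundary_set ?R as" by simp
  qed
  have dge: "enat ?r \<le> depth ?R P"
  proof -
    have "\<forall>i\<in>{1..n}. \<exists>g. g \<in> Q \<and> g \<noteq> 0 \<and> g \<in> polys {i}" using zariski[OF Q] by blast
    then obtain g where g: "\<And>i. i \<in> {1..n} \<Longrightarrow> g i \<in> Q \<and> g i \<noteq> 0 \<and> g i \<in> polys {i}" by metis
    define F where "F i = single (single i 1) 1 * g i" for i
    have F: "F i \<in> polys {i}" "F i \<noteq> 0" "0 \<notin> keys (F i)" "F i \<in> Q" if i: "i \<in> {1..n}" for i
    proof -
      show "F i \<in> polys {i}" unfolding F_def using g[OF i] by (intro polys_mult polys_single) auto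
      have "single (single i (1::nat)) (1::'k) \<noteq> 0" by (metis lookup_single_eq lookup_zero zero_neq_one)
      then show "F i \<noteq> 0" unfolding F_def using g[OF i] by simp
      show "0 \<notin> keys (F i)" unfolding F_def by (rule zero_notin_keys_var_times)
      show "F i \<in> Q" unfolding F_def using g[OF i] i by (intro QD(4) polys_single) auto
    qed
    have n1: "1 \<in> {1..n}" "n \<in> {1..n}" "1 \<noteq> n" using n by auto
    obtain ws where ws: "set ws = W" "distinct ws" using finite_distinct_list[OF finW] by auto
    define zs where "zs = (F 1 + F n) # map g ws"
    have zsQ: "set zs \<subseteq> Q" unfolding zs_def using ws(1) Wn g F(4) n1 QD(3) by auto
    have zsc: "set zs \<subseteq> carrier ?S" using zsQ Q.Icarr by blast
    have takec: "set (take k zs) \<subseteq> carrier ?S" for k using zsc set_take_subset[of k zs] by blast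
    have "regular_sequence ?R (map ?\<pi> zs)"
    proof (rule S.Quot_regular_sequence[OF I zsc])
      have "I \<union> set zs \<subseteq> Q" using IQ zsQ by auto
      then have "genideal ?S (I \<union> set zs) \<subseteq> Q" by (rule S.genideal_minimal[OF Q.is_ideal])
      then show "genideal ?S (I \<union> set zs) \<noteq> carrier ?S" using Q.I_notcarr Q.a_subset by auto
      fix i r assume i: "i < length zs" and r: "r \<in> carrier ?S"
        and mem: "zs ! i \<otimes>\<^bsub>?S\<^esub> r \<in> genideal ?S (I \<union> set (take i zs))"
      show "r \<in> genideal ?S (I \<union> set (take i zs))"
      proof (cases i)
        case 0
        have eq: "genideal ?S (I \<union> set (take i zs)) = I"
          unfolding 0 I_eq using genideal_genideal_Un[OF ring_poly_ring Gic, of "{}"] by simp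
        have fr: "(F 1 + F n) * r \<in> monomial_ideal n U" using mem unfolding eq by (simp add: 0 zs_def I_def)
        have n1': "{1, n} \<subseteq> {1..n}" using n1 by simp
        have rp: "r \<in> polys {1..n}" using r by simp
        have "r \<in> monomial_ideal n U"
          by (rule binomial_nonzerodivisor[OF U n1(3) red sat F(1-3)[OF n1(1)] F(1-3)[OF n1(2)] n1' rp fr])
        then show ?thesis unfolding eq by (simp add: I_def)
      next
        case (Suc k)
        have k: "k < length ws" using i Suc by (simp add: zs_def)
        let ?j = "ws ! k"
        have jW: "?j \<in> W" using k ws(1) nth_mem by blast
        let ?A = "Gi \<union> set (take i zs)"
        have eq: "genideal ?S (I \<union> set (take i zs)) = genideal ?S ?A"
          unfolding I_eq by (rule genideal_genideal_Un[OF ring_poly_ring Gic takec])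
        have jn: "?j \<in> {1..n}" "?j \<noteq> 1" "?j \<noteq> n" using subsetD[OF W jW] n by auto
        have "p \<in> polys ({1..n} - {?j})" if "p \<in> ?A" for p
        proof -
          have "p \<in> Gi \<or> p = F 1 + F n \<or> (\<exists>l<k. p = g (ws ! l))"
          proof (cases "p \<in> Gi")
            case False
            then have "p \<in> insert (F 1 + F n) (g ` set (take k ws))" using that Suc by (simp add: zs_def take_map)
            then have "p = F 1 + F n \<or> (\<exists>x\<in>set (take k ws). p = g x)" by auto
            moreover have "\<exists>l<k. x = ws ! l" if "x \<in> set (take k ws)" for x
              using that by (auto simp: in_set_conv_nth)
            ultimately show ?thesis by metis
          qed simp
          then consider "p \<in> Gi" | "p = F 1 + F n" | "\<exists>l<k. p = g (ws ! l)" by argo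
          then show ?thesis
          proof cases
            case 1
            then show ?thesis using G jW by (auto simp: Gi_def intro!: polys_single)
          next
            case 2
            have "F 1 \<in> polys ({1..n} - {?j})" "F n \<in> polys ({1..n} - {?j})"
              using F(1)[OF n1(1)] F(1)[OF n1(2)] jn n1 polys_mono[of "{1}" "{1..n} - {?j}"]
                polys_mono[of "{n}" "{1..n} - {?j}"] by auto
            then show ?thesis unfolding 2 by (rule polys_add)
          next
            case 3
            then obtain l where 3: "l < k" "p = g (ws ! l)" by blast
            have "ws ! l \<in> {1..n}" using 3 k ws(1) Wn nth_mem[of l ws] by auto
            moreover have "ws ! l \<noteq> ?j" using 3 k ws(2) by (simp add: nth_eq_iff_index_eq)
            ultimately show ?thesis using 3 g polys_mono[of "{ws ! l}" "{1..n} - {?j}"] by auto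
          qed
        qed
        then have A: "?A \<subseteq> polys ({1..n} - {?j})" by blast
        have gr: "g ?j * r \<in> genideal ?S ?A" using mem k unfolding eq by (simp add: Suc zs_def)
        have gj: "g ?j \<in> polys {?j}" "g ?j \<noteq> 0" using g[OF jn(1)] by simp_all
        have rp: "r \<in> polys {1..n}" using r by simp
        show ?thesis unfolding eq by (rule univariate_nonzerodivisor[OF jn(1) A gj rp gr])
      qed
    qed
    moreover have "set (map ?\<pi> zs) \<subseteq> P" using zsQ by (auto simp: Q_def)
    moreover have "length (map ?\<pi> zs) = ?r" using distinct_card[OF ws(2)] ws(1) by (simp add: zs_def)
    ultimately have "enat ?r \<in> {enat (length xs) | xs. set xs \<subseteq> P \<and> regular_sequence ?R xs}"
      by (intro CollectI exI[of _ "map ?\<pi> zs"] conjI) simp_all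
    then show ?thesis unfolding depth_def by (rule Sup_upper)
  qed
  show "depth (?S Quot monomial_ideal n U) P = height (?S Quot monomial_ideal n U) P"
    unfolding I_def[symmetric]
    by (rule antisym[OF depth_le_height[OF cr noeth primeP] order_trans[OF hle dge]])
qed

section \<open>Lexsegments\<close>

lemma mon_degree_eq_sum: "finite A \<Longrightarrow> keys w \<subseteq> A \<Longrightarrow> mon_degree w = (\<Sum>i\<in>A. lookup w i)"
  unfolding mon_degree_def by (rule sum.mono_neutral_left) (auto simp: in_keys_iff)

lemma mon_degree_add: "mon_degree (a + b) = mon_degree a + mon_degree b"
  using mon_degree_eq_sum[of "keys a \<union> keys b" a] mon_degree_eq_sum[of "keys a \<union> keys b" b]
    mon_degree_eq_sum[of "keys a \<union> keys b" "a + b"]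
  by (simp add: monomial_keys_add lookup_add sum.distrib)

lemma mon_degree_single [simp]: "mon_degree (single i k) = k"
  by (simp add: mon_degree_def)

lemma mon_degree_eq_0: "mon_degree w = 0 \<longleftrightarrow> w = 0"
  by (auto simp: mon_degree_def in_keys_iff intro!: poly_mapping_eqI)

lemma monomial_split_var:
  fixes w :: monomial
  assumes "i \<in> keys w"
  obtains w' where "w = single i 1 + w'"
proof -
  have "w = single i 1 + (w - single i 1)"
    by (rule monomial_diff_add) (use assms in \<open>auto simp: lookup_single when_def in_keys_iff\<close>)
  then show thesis by (rule that)
qed

lemma single_antimono: "(i::nat) \<le> j \<Longrightarrow> single j (k::nat) \<le> single i k"
proof (cases "i = j \<or> k = 0")
  case False
  assume "i \<le> j"
  then have "single j k < single i k" using False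
    unfolding less_monomial_iff by (intro exI[of _ i]) (auto simp: lookup_single when_def)
  then show ?thesis by simp
qed auto

lemma lex_bounds:
  assumes "keys w \<subseteq> {i..j}"
  shows "single j (mon_degree w) \<le> w" "w \<le> single i (mon_degree w)"
proof -
  have "single j (mon_degree w) \<le> w \<and> w \<le> single i (mon_degree w)"
    using assms
  proof (induction "mon_degree w" arbitrary: w)
    case 0
    then show ?case using mon_degree_eq_0[of w] by simp
  next
    case (Suc m)
    then have "w \<noteq> 0" using mon_degree_eq_0[of w] by auto
    then obtain k where k: "k \<in> keys w" by (metis all_not_in_conv keys_eq_empty)
    then obtain w' where w': "w = single k 1 + w'" by (rule monomial_split_var)
    have m: "m = mon_degree w'" using Suc.hyps(2) by (simp add: w' mon_degree_add)
    have kw: "keys w' \<subseteq> {i..j}" "k \<in> {i..j}" using Suc.prems k by (auto simp: w' monomial_keys_add)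
    have IH: "single j m \<le> w' \<and> w' \<le> single i m" using Suc.hyps(1)[OF m kw(1)] m by simp
    have s: "single l (Suc m) = single l 1 + single l m" for l :: nat by (simp flip: single_add)
    have "single j 1 + single j m \<le> single k 1 + w'"
      using IH kw(2) by (intro add_mono single_antimono) simp_all
    moreover have "single k 1 + w' \<le> single i 1 + single i m"
      using IH kw(2) by (intro add_mono single_antimono) simp_all
    ultimately show ?case unfolding Suc.hyps(2)[symmetric] s by (simp only: w')
  qed
  then show "single j (mon_degree w) \<le> w" "w \<le> single i (mon_degree w)" by auto
qed

lemma monomial_lessI:
  assumes "lookup w i < lookup w' i" "\<And>j. j < i \<Longrightarrow> lookup w j = lookup w' j"
  shows "w < (w' :: monomial)"
  using assms unfolding less_monomial_iff by blast

lemma ex_step_into: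
  fixes P :: "nat \<Rightarrow> bool"
  assumes "\<not> P 0" "P m"
  shows "\<exists>j. \<not> P j \<and> P (Suc j)"
  using assms(2)
proof (induction m)
  case (Suc m)
  then show ?case by (cases "P m") auto
qed (use assms(1) in simp)

lemma kill_variables:
  assumes U: "upset U" and "finite N" and "\<And>j. j \<in> N \<Longrightarrow> single j d \<in> U" and f: "f \<notin> U"
  shows "\<exists>t. keys t \<subseteq> N \<and> f + t \<notin> U \<and> (\<forall>j\<in>N. f + t + single j 1 \<in> U)"
  using assms(2,3)
proof (induction N)
  case empty
  then show ?case using f by (intro exI[of _ 0]) simp
next
  case (insert i N)
  then obtain t where t: "keys t \<subseteq> N" "f + t \<notin> U" "\<forall>j\<in>N. f + t + single j 1 \<in> U" by blast
  have "f + t + single i d \<in> U" using upsetD2[OF U] insert.prems by blast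
  moreover have "f + t + single i 0 \<notin> U" using t(2) by simp
  ultimately obtain k where k: "f + t + single i k \<notin> U" "f + t + single i (Suc k) \<in> U"
    using ex_step_into[of "\<lambda>k. f + t + single i k \<in> U" d] by auto
  have "f + t + single i k + single i 1 \<in> U" using k(2) by (simp add: add.assoc flip: single_add)
  moreover have "f + t + single i k + single j 1 \<in> U" if "j \<in> N" for j
    using upsetD[OF U t(3)[rule_format, OF that], of "single i k"] by (simp add: add_ac)
  ultimately show ?case using t(1) k(1)
    by (intro exI[of _ "t + single i k"]) (auto simp: monomial_keys_add add.assoc split: if_splits)
qed

lemma krull_dim_ge_1_power_free:
  fixes n :: nat and U :: "monomial set"
  assumes U: "upset U" "0 \<notin> U" and dim: "1 \<le> krull_dim (poly_ring n Quot (monomial_ideal n U :: 'k::field mpoly set))"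
  shows "\<exists>i\<in>{1..n}. \<forall>k. single i k \<notin> U"
proof (rule ccontr)
  assume "\<not> ?thesis"
  then have pow: "\<And>i. i \<in> {1..n} \<Longrightarrow> \<exists>k. single i k \<in> U" by blast
  let ?S = "poly_ring n :: 'k mpoly ring"
  define I where "I = (monomial_ideal n U :: 'k mpoly set)"
  let ?R = "?S Quot I"
  let ?\<pi> = "(+>\<^bsub>?S\<^esub>) I"
  let ?m = "var_prime n {1..n} :: 'k mpoly set"
  interpret S: cring ?S by (rule cring_poly_ring)
  have I: "ideal I ?S" unfolding I_def by (rule monomial_ideal_ideal[OF U(1)])
  have Im: "I \<subseteq> ?m" unfolding I_def by (rule monomial_ideal_subset_origin[OF U(2)])
  interpret h: ring_hom_ring ?S ?R ?\<pi> by (rule ideal.rcos_ring_hom_ring[OF I])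
  have mmax: "maximalideal (?\<pi> ` ?m) ?R" by (rule S.Quot_maximalideal[OF I var_prime_maximalideal Im])
  have only: "P = ?\<pi> ` ?m" if P: "primeideal P ?R" for P
  proof -
    interpret P: primeideal P ?R by fact
    define Q where "Q = {a \<in> carrier ?S. ?\<pi> a \<in> P}"
    note V = S.Quot_vimage[OF I P.is_ideal, folded Q_def]
    note QD = poly_idealD[OF V(1)]
    have x: "single (single i 1) 1 \<in> Q" if i: "i \<in> {1..n}" for i
    proof -
      obtain k where k: "single i k \<in> U" using pow[OF i] by blast
      have xp: "single (single i l) (1::'k) \<in> polys {1..n}" for l using i by (auto intro!: polys_single split: if_splits)
      have "single (single i l) 1 \<in> Q \<Longrightarrow> single (single i 1) 1 \<in> Q" for l
      proof (induction l)
        case 0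
        then have "1 \<in> Q" by simp
        then show ?case using QD(4)[OF xp[of 1], of 1] by simp
      next
        case (Suc l)
        have "single (single i (Suc l)) (1::'k) = single (single i 1) 1 * single (single i l) 1"
          by (simp add: mult_single flip: single_add)
        then have "?\<pi> (single (single i 1) 1 * single (single i l) 1) \<in> P" using Suc.prems by (simp add: Q_def)
        then have "?\<pi> (single (single i 1) 1) \<otimes>\<^bsub>?R\<^esub> ?\<pi> (single (single i l) 1) \<in> P"
          using h.hom_mult[of "single (single i 1) 1" "single (single i l) 1"] xp[of 1] xp[of l] by simp
        then have "?\<pi> (single (single i 1) 1) \<in> P \<or> ?\<pi> (single (single i l) 1) \<in> P"
          using xp by (intro P.I_prime) (auto simp: S.Quot_carrier)
        then show ?case using Suc.IH xp by (auto simp: Q_def)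
      qed
      moreover have "single (single i k) 1 \<in> I" using k xp by (auto simp: I_def monomial_ideal_def)
      ultimately show ?thesis using V(2) by blast
    qed
    have mQ: "?m \<subseteq> Q"
    proof
      fix p :: "'k mpoly" assume p: "p \<in> ?m"
      have "single w (lookup p w) \<in> Q" if w: "w \<in> keys p" for w
      proof -
        have wn: "keys w \<subseteq> {1..n}" using p w by (auto simp: var_prime_def monomial_ideal_def polys_def)
        have "keys w \<inter> {1..n} \<noteq> {}" using p w unfolding var_prime_def monomial_ideal_def by blast
        then obtain i where i: "i \<in> keys w" "i \<in> {1..n}" by blast
        obtain w' where w': "w = single i 1 + w'" using i(1) by (rule monomial_split_var)
        have "single w' (lookup p w) \<in> polys {1..n}" using wn w' by (auto simp: monomial_keys_add intro!: polys_single)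
        then have "single w' (lookup p w) * single (single i 1) 1 \<in> Q" using x[OF i(2)] by (rule QD(4))
        then show ?thesis by (simp add: mult_single w' add.commute)
      qed
      then have "(\<Sum>w\<in>keys p. single w (lookup p w)) \<in> Q" by (rule poly_ideal_sum[OF V(1)])
      then show "p \<in> Q" using poly_mapping_sum_single[of p] by simp
    qed
    then have "?\<pi> ` ?m \<subseteq> P" by (auto simp: Q_def)
    then have "P = ?\<pi> ` ?m \<or> P = carrier ?R"
      by (rule maximalideal.I_maximal[OF mmax P.is_ideal _ P.a_subset])
    then show ?thesis using P.I_notcarr by (elim disjE) simp_all
  qed
  have K: "krull_dim ?R \<le> 0"
    unfolding krull_dim_def
  proof (rule Sup_least)
    fix e assume "e \<in> {enat l | l. \<exists>P. prime_chain ?R l P}"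
    then obtain l P where P: "e = enat l" "prime_chain ?R l P" by blast
    have "l = 0"
    proof (rule ccontr)
      assume "l \<noteq> 0"
      then have *: "primeideal (P 0) ?R" "primeideal (P 1) ?R" and less: "P 0 \<subset> P 1"
        using P(2) by (auto simp: prime_chain_def)
      show False using less unfolding only[OF *(1)] only[OF *(2)] by simp
    qed
    then show "e \<le> 0" using P(1) by (simp add: zero_enat_def)
  qed
  have "1 \<le> krull_dim ?R" using dim by (simp only: I_def)
  then have "(1::enat) \<le> 0" using K by (rule order_trans)
  then show False by (simp add: one_enat_def zero_enat_def)
qed

locale lexsegment_ends =
  fixes n d :: nat and u v :: monomial
  assumes n3: "3 \<le> n" and d2: "2 \<le> d"
    and um: "u \<in> monomials n d" and vm: "v \<in> monomials n d"
    and uv: "lookup v 1 < lookup u 1"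
begin

abbreviation "L \<equiv> lexsegment n d u v"
abbreviation "U \<equiv> multiples L"
abbreviation "x i \<equiv> single i (1::nat) :: monomial"

definition "f0 = u - x 1"

lemma x1_f0: "x 1 + f0 = u"
  unfolding f0_def by (rule monomial_diff_add[symmetric]) (use uv in \<open>auto simp: lookup_single when_def\<close>)

lemma f0_x1: "f0 + x 1 = u"
  using x1_f0 by (simp add: add.commute)

lemma u_keys: "keys u \<subseteq> {1..n}" and v_keys: "keys v \<subseteq> {1..n}"
  and u_deg: "mon_degree u = d" and v_deg: "mon_degree v = d"
  using um vm by (auto simp: monomials_def)

lemma f0_keys: "keys f0 \<subseteq> {1..n}" and f0_deg: "Suc (mon_degree f0) = d"
proof -
  have "keys (x 1 + f0) \<subseteq> {1..n}" "mon_degree (x 1 + f0) = d" by (simp_all only: x1_f0 u_keys u_deg)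
  then show "keys f0 \<subseteq> {1..n}" "Suc (mon_degree f0) = d" by (simp_all add: monomial_keys_add mon_degree_add)
qed

lemma L_iff: "w \<in> L \<longleftrightarrow> keys w \<subseteq> {1..n} \<and> mon_degree w = d \<and> v \<le> w \<and> w \<le> u"
  by (auto simp: lexsegment_def monomials_def)

lemma upset_U: "upset U" by (rule upset_multiples)

lemma L_U: "w \<in> L \<Longrightarrow> w \<in> U" by (rule mem_multiples)

lemma L_U_add: "w \<in> L \<Longrightarrow> w + h \<in> U" using L_U upsetD[OF upset_U] by blast

lemma low_degree: "mon_degree f < d \<Longrightarrow> f \<notin> U"
  by (auto simp: L_iff mon_degree_add elim!: multiplesE)

lemma degree_d: "mon_degree f = d \<Longrightarrow> f \<in> U \<Longrightarrow> f \<in> L"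
  by (erule multiplesE) (auto simp: L_iff mon_degree_add mon_degree_eq_0)

lemma zero_notin_U: "0 \<notin> U"
  using d2 by (intro low_degree) (simp add: mon_degree_def)

lemma lookup_0: "keys w \<subseteq> {1..n} \<Longrightarrow> j < 1 \<Longrightarrow> lookup w j = 0"
  by (auto simp: in_keys_iff subset_iff)

lemma less_by_x1: "keys (w :: monomial) \<subseteq> {1..n} \<Longrightarrow> keys w' \<subseteq> {1..n} \<Longrightarrow> lookup w 1 < lookup w' 1 \<Longrightarrow> w < (w' :: monomial)"
  by (rule monomial_lessI[where i = 1]) (simp_all add: lookup_0)

lemma x1_mono: "keys (w :: monomial) \<subseteq> {1..n} \<Longrightarrow> keys w' \<subseteq> {1..n} \<Longrightarrow> w \<le> (w' :: monomial) \<Longrightarrow> lookup w 1 \<le> lookup w' 1"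
  using less_by_x1[of w' w] by (meson not_le)

lemma not_CM_socle:
  assumes "v \<le> x n + f0" and dim: "1 \<le> krull_dim (poly_ring n Quot (monomial_ideal n U :: 'k::field mpoly set))"
  shows "\<not> cohen_macaulay_ring (poly_ring n Quot (monomial_ideal n U :: 'k::field mpoly set))"
proof -
  obtain i where i: "i \<in> {1..n}" "\<And>k. single i k \<notin> U"
    using krull_dim_ge_1_power_free[OF upset_U zero_notin_U dim] by blast
  let ?Y = "{1..n} - {i}"
  show ?thesis
  proof (rule not_cohen_macaulayI[OF upset_U, of ?Y n "{1..n}" f0])
    show "U \<subseteq> {w. keys w \<inter> ?Y \<noteq> {}}"
    proof
      fix w assume "w \<in> U"
      then obtain g h where g: "w = g + h" "g \<in> L" by (rule multiplesE)
      have "keys g \<inter> ?Y \<noteq> {}"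
      proof
        assume "keys g \<inter> ?Y = {}"
        then have "keys g \<subseteq> {i..i}" using g(2) by (auto simp: L_iff)
        then have "single i (mon_degree g) = g" using lex_bounds[of g i i] by (intro antisym)
        then show False using i(2)[of "mon_degree g"] L_U[OF g(2)] by simp
      qed
      then show "w \<in> {w. keys w \<inter> ?Y \<noteq> {}}" using g(1) by (auto simp: monomial_keys_add)
    qed
    show "card ?Y < card {1..n}" using card_Diff_singleton[OF i(1)] n3 by simp
    show "f0 \<notin> U" using f0_deg by (intro low_degree) simp
    show "f0 + x j \<in> U" if j: "j \<in> {1..n}" for j
    proof (rule L_U, unfold L_iff, intro conjI)
      show "keys (f0 + x j) \<subseteq> {1..n}" using f0_keys j by (auto simp: monomial_keys_add)
      show "mon_degree (f0 + x j) = d" using f0_deg by (simp add: mon_degree_add)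
      have "f0 + x n \<le> f0 + x j" using j by (intro add_left_mono single_antimono) simp
      then show "v \<le> f0 + x j" using assms(1) unfolding add.commute[of "x n"] by (rule order_trans[rotated])
      have "f0 + x j \<le> f0 + x 1" using j by (intro add_left_mono single_antimono) simp
      then show "f0 + x j \<le> u" by (simp only: f0_x1)
    qed
  qed (use f0_keys in auto)
qed

lemma L_low: "keys w \<subseteq> {1..n} \<Longrightarrow> mon_degree w = d \<Longrightarrow> lookup w 1 = lookup v 1 \<Longrightarrow> v \<le> w \<Longrightarrow> w \<in> L"
  using less_by_x1[of w u] u_keys uv by (simp add: L_iff)

lemma L_high: "keys w \<subseteq> {1..n} \<Longrightarrow> mon_degree w = d \<Longrightarrow> lookup w 1 = lookup u 1 \<Longrightarrow> w \<le> u \<Longrightarrow> w \<in> L"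
  using less_by_x1[of v w] v_keys uv by (simp add: L_iff)

lemma L_lookup: "w \<in> L \<Longrightarrow> lookup v 1 \<le> lookup w 1 \<and> lookup w 1 \<le> lookup u 1"
  using x1_mono u_keys v_keys unfolding L_iff by blast

lemma f0_lookup: "Suc (lookup f0 1) = lookup u 1"
proof -
  have "lookup (x 1 + f0) 1 = lookup u 1" by (simp only: x1_f0)
  then show ?thesis by (simp add: lookup_add)
qed

lemma x1_times_red:
  assumes "lookup u 1 = 1" "w + x 1 + x 1 \<in> U"
  shows "w + x 1 \<in> U"
proof -
  obtain g h where g: "w + x 1 + x 1 = g + h" "g \<in> L" using assms(2) by (rule multiplesE)
  have "lookup (w + x 1 + x 1) 1 = lookup (g + h) 1" by (simp only: g(1))
  then have "1 \<in> keys h" using L_lookup[OF g(2)] assms(1) by (simp add: lookup_add in_keys_iff)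
  then obtain h' where "h = x 1 + h'" by (rule monomial_split_var)
  then have "(w + x 1) + x 1 = (g + h') + x 1" using g(1) by (simp add: add_ac)
  then have "w + x 1 = g + h'" by (simp only: add_right_cancel)
  then show ?thesis using L_U_add[OF g(2)] by metis
qed

lemma tail_keys:
  assumes "keys w \<subseteq> {1..n}" "lookup w 1 = 0"
  shows "keys w \<subseteq> {2..n}"
proof
  fix i assume i: "i \<in> keys w"
  then have "i \<noteq> 1" using assms(2) by (auto simp: in_keys_iff)
  then show "i \<in> {2..n}" using i assms(1) by fastforce
qed

lemma x1_xn_power_in_L:
  assumes "lookup u 1 = 1"
  shows "x 1 + single n (d - 1) \<in> L"
proof (rule L_high)
  have "single n (mon_degree f0) \<le> f0" by (rule lex_bounds(1)[OF f0_keys])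
  then have "x 1 + single n (d - 1) \<le> x 1 + f0" using f0_deg by (intro add_left_mono) auto
  then show "x 1 + single n (d - 1) \<le> u" by (simp only: x1_f0)
qed (use n3 d2 assms in \<open>auto simp: monomial_keys_add mon_degree_add lookup_add lookup_single when_def\<close>)

lemma x1_xn_power_in_U:
  assumes "lookup u 1 = 1"
  shows "single 1 1 + single n d \<in> U"
proof -
  have "x 1 + single n d = x 1 + single n (d - 1) + single n 1" using d2 by (simp add: add.assoc flip: single_add)
  then show ?thesis using L_U_add[OF x1_xn_power_in_L[OF assms], of "single n 1"] by simp
qed

lemma var_power_in_L:
  assumes v: "lookup v 1 = 0" "keys v \<subseteq> {m..n}" and j: "2 \<le> j" "j \<le> m" "m \<le> n"
  shows "single j d \<in> L"
proof (rule L_low)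
  have "v \<le> single m d" using lex_bounds(2)[OF v(2)] v_deg by simp
  also have "\<dots> \<le> single j d" using j by (intro single_antimono)
  finally show "v \<le> single j d" .
qed (use j v d2 in \<open>auto simp: lookup_single when_def\<close>)

lemma CM_b:
  assumes v: "v = single (n - 1) \<alpha> + single n (d - \<alpha>)" "0 < \<alpha>" "\<alpha> \<le> d" and less: "x n + f0 < v"
  shows "cohen_macaulay_ring (poly_ring n Quot (monomial_ideal n U :: 'k::field mpoly set))"
proof -
  have v1: "lookup v 1 = 0" using n3 by (auto simp: v(1) lookup_add lookup_single when_def)
  have xf: "keys (x n + f0) \<subseteq> {1..n}" using f0_keys n3 by (auto simp: monomial_keys_add)
  have "lookup (x n + f0) 1 \<le> lookup v 1" using less by (intro x1_mono xf v_keys) simp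
  then have u1: "lookup u 1 = 1" using f0_lookup v1 by (simp add: lookup_add)
  have vk: "keys v \<subseteq> {n - 1..n}" by (auto simp: v(1) monomial_keys_add split: if_splits)
  show ?thesis
  proof (rule monomial_quot_cohen_macaulayI[of n "{}" L d])
    show "L \<subseteq> {w. keys w \<subseteq> {1..n} - {}}" unfolding L_iff subset_iff by simp
    show "single i d \<in> U" if "i \<in> {2..n - 1} - {}" for i
      using that by (intro L_U var_power_in_L[OF v1 vk]) auto
    show "w + single 1 1 \<in> U" if "w + single 1 1 + single 1 1 \<in> U" for w
      using x1_times_red[OF u1 that] .
    fix w assume w: "keys w \<subseteq> {1..n}" "lookup w 1 = 0" "w + x 1 \<in> U" "w + x n \<in> U"
    show "w \<in> U"
    proof (rule ccontr)
      assume wU: "w \<notin> U"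
      obtain g h where g: "w + x n = g + h" "g \<in> L" using w(4) by (rule multiplesE)
      have nh: "n \<notin> keys h"
      proof
        assume "n \<in> keys h"
        then obtain h' where "h = x n + h'" by (rule monomial_split_var)
        then have "w + x n = (g + h') + x n" using g(1) by (simp add: add_ac)
        then have "w = g + h'" by (simp only: add_right_cancel)
        then show False using wU L_U_add[OF g(2)] by metis
      qed
      have "lookup (w + x n) n = lookup (g + h) n" by (simp only: g(1))
      then have "n \<in> keys g" using nh by (simp add: lookup_add in_keys_iff)
      then obtain g' where g': "g = x n + g'" by (rule monomial_split_var)
      have "w + x n = (g' + h) + x n" using g(1) by (simp add: g' add_ac)
      then have wg: "w = g' + h" by (simp only: add_right_cancel)
      have gk: "keys g' \<subseteq> {1..n}" "Suc (mon_degree g') = d" "v \<le> x n + g'"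
        using g(2) by (auto simp: L_iff g' monomial_keys_add mon_degree_add)
      have "h = 0"
      proof (rule ccontr)
        assume "h \<noteq> 0"
        then obtain j where j: "j \<in> keys h" by (metis all_not_in_conv keys_eq_empty)
        then obtain h' where h': "h = x j + h'" by (rule monomial_split_var)
        have j1: "j \<in> keys w" using j by (simp add: wg monomial_keys_add)
        have "g' + x j \<in> L"
        proof (rule L_low)
          show "keys (g' + x j) \<subseteq> {1..n}" using gk(1) j1 w(1) by (auto simp: monomial_keys_add)
          show "mon_degree (g' + x j) = d" using gk(2) by (simp add: mon_degree_add)
          have "lookup g' 1 + lookup h 1 = 0" using w(2) by (simp add: wg lookup_add)
          moreover have "j \<noteq> 1" using j1 w(2) by (auto simp: in_keys_iff)
          ultimately show "lookup (g' + x j) 1 = lookup v 1"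
            using v1 by (simp add: lookup_add lookup_single when_def)
          have "x n \<le> x j" using j1 w(1) by (intro single_antimono) auto
          then have "x n + g' \<le> x j + g'" by (rule add_right_mono)
          then show "v \<le> g' + x j" using gk(3) unfolding add.commute[of g'] by (rule order_trans[rotated])
        qed
        moreover have "w = (g' + x j) + h'" by (simp add: wg h' add_ac)
        ultimately show False using wU L_U_add by metis
      qed
      then have wg: "w = g'" using wg by simp
      have "w + x 1 \<in> L" using w(3) gk(2) by (intro degree_d) (auto simp: wg mon_degree_add)
      then have "w + x 1 \<le> f0 + x 1" unfolding f0_x1 by (simp add: L_iff)
      then have "w \<le> f0" by simp
      then have "x n + g' \<le> x n + f0" unfolding wg by (rule add_left_mono)
      then show False using less gk(3) by (metis leD order_trans)
    qed
  qed (use n3 x1_xn_power_in_U[OF u1] in auto)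
qed

lemma CM_a:
  assumes u: "u = x 1 + single n (d - 1)" and v: "v = single 2 d"
  shows "cohen_macaulay_ring (poly_ring n Quot (monomial_ideal n U :: 'k::field mpoly set))"
proof -
  have u1: "lookup u 1 = 1" and v1: "lookup v 1 = 0"
    using n3 by (auto simp: u v lookup_add lookup_single when_def)
  have f0: "f0 = single n (d - 1)" using x1_f0 u by (metis add_left_cancel)
  have L_cases: "w = u \<or> w = v" if w: "w \<in> L" for w
  proof (cases "lookup w 1 = 0")
    case True
    have wk: "keys w \<subseteq> {2..n}" using w by (intro tail_keys True) (simp add: L_iff)
    have "mon_degree w = d" "v \<le> w" using w unfolding L_iff by blast+
    then show ?thesis using lex_bounds(2)[OF wk] v by simp
  next
    case False
    then have "1 \<in> keys w" by (simp add: in_keys_iff)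
    then obtain w' where w': "w = x 1 + w'" by (rule monomial_split_var)
    have "keys w' \<subseteq> {1..n}" "mon_degree w' = d - 1" using w by (auto simp: L_iff w' monomial_keys_add mon_degree_add)
    then have "f0 \<le> w'" using lex_bounds(1)[of w' 1 n] by (simp add: f0)
    then have "x 1 + f0 \<le> w" unfolding w' by (rule add_left_mono)
    then show ?thesis using w unfolding x1_f0 by (auto simp: L_iff)
  qed
  show ?thesis
  proof (rule monomial_quot_cohen_macaulayI[of n "{3..n - 1}" L d])
    show "L \<subseteq> {w. keys w \<subseteq> {1..n} - {3..n - 1}}"
    proof
      fix w assume "w \<in> L"
      then have "w = u \<or> w = v" by (rule L_cases)
      then show "w \<in> {w. keys w \<subseteq> {1..n} - {3..n - 1}}"
        using n3 by (auto simp: u v monomial_keys_add split: if_splits)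
    qed
    have vU: "single 2 d \<in> U" using v n3 by (intro L_U var_power_in_L[OF v1, of 2]) auto
    show "single i d \<in> U" if "i \<in> {2..n - 1} - {3..n - 1}" for i
    proof -
      have "i = 2" using that by auto
      then show ?thesis using vU by simp
    qed
    show "w + single 1 1 \<in> U" if "w + single 1 1 + single 1 1 \<in> U" for w
      using x1_times_red[OF u1 that] .
    fix w assume w: "keys w \<subseteq> {1..n}" "lookup w 1 = 0" "w + x 1 \<in> U" "w + x n \<in> U"
    obtain g h where g: "w + x n = g + h" "g \<in> L" using w(4) by (rule multiplesE)
    have "lookup (w + x n) 1 = lookup (g + h) 1" by (simp only: g(1))
    then have "lookup g 1 = 0" using w(2) n3 by (simp add: lookup_add lookup_single when_def)
    then have "g = single 2 d" using L_cases[OF g(2)] u1 v by auto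
    then have "lookup (w + x n) 2 = lookup (single 2 d + h) 2" by (simp only: g(1))
    then have "d \<le> lookup w 2" using n3 by (simp add: lookup_add lookup_single when_def)
    then have "w = single 2 d + (w - single 2 d)"
      by (intro monomial_diff_add) (auto simp: lookup_single when_def)
    then show "w \<in> U" using upsetD[OF upset_U vU] by metis
  qed (use n3 x1_xn_power_in_U[OF u1] in auto)
qed

lemma not_CM_divisible:
  assumes v1: "1 \<le> lookup v 1" and u1: "lookup u 1 = Suc (lookup v 1)"
  shows "\<not> cohen_macaulay_ring (poly_ring n Quot (monomial_ideal n U :: 'k::field mpoly set))"
proof -
  let ?b = "lookup v 1"
  have "lookup u 1 \<le> mon_degree u"
    using u1 unfolding mon_degree_def by (intro member_le_sum) (auto simp: in_keys_iff)
  then have bd: "Suc ?b \<le> d" using u_deg u1 by simp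
  define f where "f j = single 1 ?b + single n (d - 1 - ?b) + single 2 j" for j
  have split: "w = single 1 (lookup w 1) + (w - single 1 (lookup w 1))" for w :: monomial
    by (rule monomial_diff_add) (auto simp: lookup_single when_def)
  have "single 1 ?b + single 2 (d - ?b) \<in> L"
  proof (rule L_low)
    define v' where "v' = v - single 1 ?b"
    have v': "v = single 1 ?b + v'" unfolding v'_def by (rule split)
    have "lookup v' 1 = 0" by (simp add: v'_def lookup_minus)
    moreover have "keys (single 1 ?b + v') \<subseteq> {1..n}" "mon_degree (single 1 ?b + v') = d"
      using v_keys v_deg by (simp_all only: v'[symmetric])
    ultimately have "keys v' \<subseteq> {2..n}" "mon_degree v' = d - ?b"
      using tail_keys[of v'] by (simp_all add: monomial_keys_add mon_degree_add)
    then have "v' \<le> single 2 (d - ?b)" using lex_bounds(2)[of v' 2 n] by simp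
    then have "single 1 ?b + v' \<le> single 1 ?b + single 2 (d - ?b)" by (rule add_left_mono)
    then show "v \<le> single 1 ?b + single 2 (d - ?b)" using v' by metis
  qed (use n3 bd in \<open>auto simp: monomial_keys_add mon_degree_add lookup_add lookup_single when_def\<close>)
  then have "single 1 ?b + single 2 (d - ?b) + single n (d - 1 - ?b) \<in> U" by (rule L_U_add)
  then have "f (d - ?b) \<in> U" by (simp add: f_def add_ac)
  moreover have "f 0 \<notin> U" using bd by (intro low_degree) (simp add: f_def mon_degree_add)
  ultimately obtain j where j: "f j \<notin> U" "f (Suc j) \<in> U" using ex_step_into[of "\<lambda>j. f j \<in> U"] by blast
  have top: "single 1 (Suc ?b) + single n (d - 1 - ?b) \<in> L"
  proof (rule L_high)
    define u' where "u' = u - single 1 (Suc ?b)"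
    have u': "u = single 1 (Suc ?b) + u'" unfolding u'_def u1[symmetric] by (rule split)
    have "keys (single 1 (Suc ?b) + u') \<subseteq> {1..n}" "mon_degree (single 1 (Suc ?b) + u') = d"
      using u_keys u_deg by (simp_all only: u'[symmetric])
    then have "keys u' \<subseteq> {1..n}" "mon_degree u' = d - 1 - ?b" by (auto simp: monomial_keys_add mon_degree_add)
    then have "single n (d - 1 - ?b) \<le> u'" using lex_bounds(1)[of u' 1 n] by simp
    then have "single 1 (Suc ?b) + single n (d - 1 - ?b) \<le> single 1 (Suc ?b) + u'" by (rule add_left_mono)
    then show "single 1 (Suc ?b) + single n (d - 1 - ?b) \<le> u" using u' by metis
  qed (use n3 bd u1 in \<open>auto simp: monomial_keys_add mon_degree_add lookup_add lookup_single when_def\<close>)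
  show ?thesis
  proof (rule not_cohen_macaulayI[OF upset_U, of "{1}" n "{1, 2}" "f j"])
    show "U \<subseteq> {w. keys w \<inter> {1} \<noteq> {}}"
    proof
      fix w assume "w \<in> U"
      then obtain g h where g: "w = g + h" "g \<in> L" by (rule multiplesE)
      then have "1 \<in> keys g" using L_lookup[OF g(2)] v1 by (simp add: in_keys_iff)
      then show "w \<in> {w. keys w \<inter> {1} \<noteq> {}}" by (simp add: g(1) monomial_keys_add)
    qed
    show "keys (f j) \<subseteq> {1..n}" using n3 by (auto simp: f_def monomial_keys_add split: if_splits)
    have "f j + x 1 = single 1 (Suc ?b) + single n (d - 1 - ?b) + single 2 j"
    proof -
      have "single 1 (Suc ?b) = single 1 ?b + x 1" by (simp flip: single_add)
      then show ?thesis by (simp add: f_def add_ac)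
    qed
    then have 1: "f j + x 1 \<in> U" using L_U_add[OF top] by metis
    have "f (Suc j) = f j + x 2"
    proof -
      have "single 2 (Suc j) = single 2 j + x 2" by (simp flip: single_add)
      then show ?thesis by (simp add: f_def add.assoc)
    qed
    then have 2: "f j + x 2 \<in> U" using j(2) by metis
    show "f j + single i 1 \<in> U" if "i \<in> {1, 2}" for i using that 1 2 by auto
  qed (use n3 j(1) in auto)
qed

lemma not_CM_two_extra:
  assumes v: "lookup v 1 = 0" "m \<in> keys v" "keys v \<subseteq> {m..n}" and m: "2 \<le> m"
    and g: "keys g \<subseteq> {1..n}" "g \<notin> U" "i1 \<in> {1..n} - {2..m}" "i2 \<in> {1..n} - {2..m}" "i1 \<noteq> i2"
      "g + x i1 \<in> U" "g + x i2 \<in> U"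
  shows "\<not> cohen_macaulay_ring (poly_ring n Quot (monomial_ideal n U :: 'k::field mpoly set))"
proof -
  have mn: "m \<le> n" using v(2,3) by auto
  have "\<exists>t. keys t \<subseteq> {2..m} \<and> g + t \<notin> U \<and> (\<forall>j\<in>{2..m}. g + t + single j 1 \<in> U)"
    using mn by (intro kill_variables[OF upset_U _ _ g(2), of _ d] L_U var_power_in_L[OF v(1,3)]) auto
  then obtain t where t: "keys t \<subseteq> {2..m}" "g + t \<notin> U" "\<And>j. j \<in> {2..m} \<Longrightarrow> g + t + single j 1 \<in> U" by blast
  let ?X = "insert i1 (insert i2 {2..m})"
  show ?thesis
  proof (rule not_cohen_macaulayI[OF upset_U, of "{1..m}" n ?X "g + t"])
    show "U \<subseteq> {w. keys w \<inter> {1..m} \<noteq> {}}"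
    proof
      fix w assume "w \<in> U"
      then obtain a h where a: "w = a + h" "a \<in> L" by (rule multiplesE)
      have "keys a \<inter> {1..m} \<noteq> {}"
      proof
        assume emp: "keys a \<inter> {1..m} = {}"
        have zero: "lookup a i = 0" if "i \<le> m" for i
        proof (rule ccontr)
          assume "lookup a i \<noteq> 0"
          then have "i \<in> keys a" by (simp add: in_keys_iff)
          then show False using emp that a(2) unfolding L_iff by fastforce
        qed
        have "a < v"
        proof (rule monomial_lessI[of a m v])
          show "lookup a m < lookup v m" using v(2) zero[of m] by (simp add: in_keys_iff)
          fix i assume "i < m"
          then have "i \<notin> keys v" using v(3) by auto
          then show "lookup a i = lookup v i" using zero[of i] \<open>i < m\<close> by (simp add: in_keys_iff)
        qed
        then show False using a(2) unfolding L_iff by (metis leD)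
      qed
      then show "w \<in> {w. keys w \<inter> {1..m} \<noteq> {}}" by (auto simp: a(1) monomial_keys_add)
    qed
    have "card ?X = Suc (Suc (m - 1))" using g(3-5) by simp
    then show "card {1..m} < card ?X" using m by simp
    show "keys (g + t) \<subseteq> {1..n}" using g(1) t(1) mn by (fastforce simp: monomial_keys_add)
    show "g + t + single i 1 \<in> U" if i: "i \<in> ?X" for i
    proof -
      have "g + t + x j \<in> U" if "g + x j \<in> U" for j
        using upsetD[OF upset_U that, of t] by (simp add: add_ac)
      then show ?thesis using i g(6,7) t(3) by auto
    qed
  qed (use g mn t(2) in auto)
qed

lemma not_CM_not_a:
  assumes u1: "lookup u 1 = 1" and v: "lookup v 1 = 0" "m \<in> keys v" "keys v \<subseteq> {m..n}"
    and m: "2 \<le> m" "m + 2 \<le> n" and nota: "\<not> (u = x 1 + single n (d - 1) \<and> v = single 2 d)"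
  shows "\<not> cohen_macaulay_ring (poly_ring n Quot (monomial_ideal n U :: 'k::field mpoly set))"
proof -
  note two = not_CM_two_extra[OF v m(1), where 'k = 'k]
  have f01: "lookup f0 1 = 0" using f0_lookup u1 by simp
  show ?thesis
  proof (cases "f0 = single n (d - 1)")
    case False
    have "\<exists>i\<in>keys f0. i \<noteq> n"
    proof (rule ccontr)
      assume "\<not> ?thesis"
      then have "keys f0 \<subseteq> {n..n}" by auto
      then have "f0 = single n (mon_degree f0)" using lex_bounds[of f0 n n] by (intro antisym)
      then show False using False f0_deg by (metis diff_Suc_1)
    qed
    then obtain i where i: "i \<in> keys f0" "i \<noteq> n" by blast
    then obtain f' where f': "f0 = x i + f'" by (metis monomial_split_var)
    have fk: "keys f' \<subseteq> {1..n}" "mon_degree f' = d - 2" "i \<le> n - 1"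
      using f0_keys f0_deg i by (auto simp: f' monomial_keys_add mon_degree_add)
    have "x (n - 1) + single n (d - 2) \<le> x i + f'"
      using lex_bounds(1)[OF fk(1)] fk(2,3) by (intro add_mono single_antimono) auto
    then have "x 1 + (x (n - 1) + single n (d - 2)) \<le> x 1 + f0" unfolding f' by (rule add_left_mono)
    then have le: "x 1 + (x (n - 1) + single n (d - 2)) \<le> u" by (simp only: x1_f0)
    let ?g = "x 1 + single n (d - 2)"
    show ?thesis
    proof (rule two[of ?g n "n - 1"])
      show "?g \<notin> U" using d2 by (intro low_degree) (simp add: mon_degree_add)
      have "?g + x n = x 1 + single n (d - 1)" using d2 by (simp add: add.assoc numeral_2_eq_2 Suc_diff_Suc flip: single_add)
      then show "?g + x n \<in> U" using L_U[OF x1_xn_power_in_L[OF u1]] by simp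
      have "x 1 + (x (n - 1) + single n (d - 2)) \<in> L"
        using le u1 n3 d2
        by (intro L_high) (auto simp: monomial_keys_add mon_degree_add lookup_add lookup_single when_def split: if_splits)
      then have "x 1 + (x (n - 1) + single n (d - 2)) \<in> U" by (rule L_U)
      then show "?g + x (n - 1) \<in> U" by (simp add: add_ac)
    qed (use n3 m in \<open>auto simp: monomial_keys_add split: if_splits\<close>)
  next
    case True
    then have ueq: "u = x 1 + single n (d - 1)" using x1_f0 by simp
    then have vne: "v \<noteq> single 2 d" using nota by blast
    have g2: "single 2 (d - 1) \<notin> U" using d2 by (intro low_degree) simp
    show ?thesis
    proof (cases "m = 2")
      case False
      have kill: "single 2 (d - 1) + x j \<in> U" if "j \<in> {3..n}" for j
      proof (rule L_U, rule L_low)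
        have "v < single 2 (d - 1) + x j"
        proof (rule monomial_lessI[where i = 2])
          have "2 \<notin> keys v" using v(3) False m(1) by auto
          then show "lookup v 2 < lookup (single 2 (d - 1) + x j) 2"
            using d2 by (simp add: in_keys_iff lookup_add)
          fix i :: nat assume "i < 2"
          then have "i \<notin> keys v" using v(3) m(1) by auto
          then show "lookup v i = lookup (single 2 (d - 1) + x j) i"
            using that \<open>i < 2\<close> by (auto simp: in_keys_iff lookup_add lookup_single when_def)
        qed
        then show "v \<le> single 2 (d - 1) + x j" by simp
      qed (use that d2 v(1) in \<open>auto simp: monomial_keys_add mon_degree_add lookup_add lookup_single when_def split: if_splits\<close>)
      show ?thesis
        using n3 m g2 by (intro two[of "single 2 (d - 1)" n "n - 1"] kill) (auto split: if_splits)
    next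
      case True
      have "\<exists>i\<in>keys v. i \<noteq> 2"
      proof (rule ccontr)
        assume "\<not> ?thesis"
        then have "keys v \<subseteq> {2..2}" by auto
        then have "v = single 2 (mon_degree v)" using lex_bounds[of v 2 2] by (intro antisym)
        then show False using vne v_deg by simp
      qed
      then obtain i where i: "i \<in> keys v" "i \<noteq> 2" by blast
      then obtain v' where v': "v = x i + v'" by (metis monomial_split_var)
      have vk: "keys v' \<subseteq> {2..n}" "mon_degree v' = d - 1" "3 \<le> i"
        using v(3) v_deg i True by (auto simp: v' monomial_keys_add mon_degree_add)
      have "x i + v' \<le> x 3 + single 2 (d - 1)"
        using lex_bounds(2)[OF vk(1)] vk(2,3) by (intro add_mono single_antimono) auto
      then have "x 3 + single 2 (d - 1) \<in> L"
        using n3 d2 v(1) v' by (intro L_low) (auto simp: monomial_keys_add mon_degree_add lookup_add lookup_single when_def split: if_splits)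
      then have k3: "single 2 (d - 1) + single n e + x 3 \<in> U" for e
        using L_U_add[of "x 3 + single 2 (d - 1)" "single n e"] by (simp add: add_ac)
      show ?thesis
      proof (cases "\<exists>e. single 2 (d - 1) + single n e \<in> U")
        case ex: True
        then obtain e where e: "single 2 (d - 1) + single n e \<notin> U" "single 2 (d - 1) + single n (Suc e) \<in> U"
          using ex_step_into[of "\<lambda>e. single 2 (d - 1) + single n e \<in> U"] g2 by auto
        have "single 2 (d - 1) + single n e + x n \<in> U" using e(2) by (simp add: add.assoc flip: single_add)
        then show ?thesis
          using n3 m True e(1) by (intro two[of "single 2 (d - 1) + single n e" n 3] k3)
            (auto simp: monomial_keys_add split: if_splits)
      next
        case False
        have "single 2 (d - 1) + single n (d - 1) + x 1 \<in> U"
          using L_U_add[OF x1_xn_power_in_L[OF u1], of "single 2 (d - 1)"] by (simp add: add_ac)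
        then show ?thesis
          using n3 m True False by (intro two[of "single 2 (d - 1) + single n (d - 1)" 1 3] k3)
            (auto simp: monomial_keys_add split: if_splits)
      qed
    qed
  qed
qed

end

theorem theorem3p9:
  fixes n d :: nat
    and u v :: monomial
    and I :: "'k::field mpoly set"
  assumes "n \<ge> 3" and "d \<ge> 2"
    and "u \<in> monomials n d" and "v \<in> monomials n d"
    and "Poly_Mapping.lookup u 1 > Poly_Mapping.lookup v 1"
    and "I = lexsegment_ideal n d u v"
    and "krull_dim (poly_ring n Quot I) \<ge> 1"
  shows "cohen_macaulay_ring (poly_ring n Quot I) \<longleftrightarrow>
    (u = Poly_Mapping.single 1 1 + Poly_Mapping.single n (d - 1) \<and> v = Poly_Mapping.single 2 d) \<or>
    ((\<exists>a>0. a \<le> d \<and> v = Poly_Mapping.single (n - 1) a + Poly_Mapping.single n (d - a)) \<and>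
      Poly_Mapping.single n 1 + u - Poly_Mapping.single 1 1 < v)"
    (is "?CM \<longleftrightarrow> ?a \<or> ?b \<and> _")
proof -
  interpret lexsegment_ends n d u v using assms(1-5) by unfold_locales
  have I: "I = monomial_ideal n U" using assms(6) by (simp only: lexsegment_ideal_eq)
  have "x n + (x 1 + f0) = x 1 + (x n + f0)" by (rule add.left_commute)
  then have "x n + u = x 1 + (x n + f0)" by (simp only: x1_f0)
  then have shift: "single n 1 + u - single 1 1 = x n + f0" by simp
  have a_f0: "f0 = single n (d - 1)" if ?a
    using that x1_f0 by (metis add_left_cancel)
  have xk: "keys (x n + f0) \<subseteq> {1..n}" using f0_keys n3 by (auto simp: monomial_keys_add)
  have nd: "single n d = x n + single n (d - 1)" using d2 by (simp flip: single_add)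
  have v1: "lookup v 1 = 0" if "?a \<or> ?b"
    using that n3 by (auto simp: lookup_add lookup_single when_def)
  show ?thesis
  proof (cases "v \<le> x n + f0")
    case True
    have "\<not> ?a"
    proof
      assume a: ?a
      have "single n d < single 2 d"
        using n3 d2 by (intro monomial_lessI[where i = 2]) (auto simp: lookup_single when_def)
      then show False using True a a_f0[OF a] nd by (metis leD)
    qed
    moreover have "\<not> ?CM" unfolding I by (rule not_CM_socle[OF True assms(7)[unfolded I]])
    ultimately show ?thesis using True unfolding shift by (simp add: leD)
  next
    case False
    then have less: "x n + f0 < v" by simp
    have "lookup (x n + f0) 1 \<le> lookup v 1" using less by (intro x1_mono xk v_keys) simp
    then have u1: "lookup u 1 = Suc (lookup v 1)" using f0_lookup uv n3
      by (simp add: lookup_add lookup_single when_def)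
    show ?thesis
    proof (cases "lookup v 1 = 0")
      case False
      then have "\<not> ?CM" unfolding I using u1 by (intro not_CM_divisible) auto
      then show ?thesis using v1 False by blast
    next
      case True
      have "v \<noteq> 0" using v_deg d2 by (auto simp: mon_degree_def)
      then have ne: "keys v \<noteq> {}" by simp
      define m where "m = Min (keys v)"
      have m: "m \<in> keys v" unfolding m_def using ne by simp
      have vm: "keys v \<subseteq> {m..n}" unfolding m_def using v_keys by auto
      have m2: "2 \<le> m" "m \<le> n" using tail_keys[OF v_keys True] m by auto
      show ?thesis
      proof (cases "m + 2 \<le> n")
        case mn: True
        have "\<not> ?b"
        proof
          assume ?b
          then have "keys v \<subseteq> {n - 1, n}" by (auto simp: monomial_keys_add split: if_splits)
          then show False using m mn by auto
        qed
        moreover have "?CM" if ?a unfolding I using that by (intro CM_a) simp_all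
        moreover have "\<not> ?CM" if "\<not> ?a" unfolding I using that u1 True
          by (intro not_CM_not_a[OF _ True m vm m2(1) mn]) simp_all
        ultimately show ?thesis by blast
      next
        case False
        define \<alpha> where "\<alpha> = lookup v (n - 1)"
        have vk: "keys v \<subseteq> {n - 1..n}" by (rule order_trans[OF vm]) (use False in auto)
        have deg: "d = \<alpha> + lookup v n"
        proof -
          have "d = (\<Sum>i\<in>{n - 1..n}. lookup v i)" using mon_degree_eq_sum[OF _ vk] v_deg by simp
          also have "{n - 1..n} = {n - 1, n}" using n3 by auto
          finally show ?thesis using n3 by (simp add: \<alpha>_def)
        qed
        have v_eq: "v = single (n - 1) \<alpha> + single n (d - \<alpha>)"
        proof (rule poly_mapping_eqI)
          fix i
          show "lookup v i = lookup (single (n - 1) \<alpha> + single n (d - \<alpha>)) i"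
          proof (cases "i \<in> {n - 1, n}")
            case True
            then show ?thesis using n3 deg by (auto simp: lookup_add lookup_single when_def \<alpha>_def)
          next
            case False
            then have "i \<notin> keys v" using subsetD[OF vk, of i] by auto
            then show ?thesis using False by (auto simp: lookup_add lookup_single when_def in_keys_iff)
          qed
        qed
        have "\<alpha> \<noteq> 0"
        proof
          assume "\<alpha> = 0"
          then have "v = x n + single n (d - 1)" using v_eq nd by simp
          moreover have "single n (d - 1) \<le> f0" using lex_bounds(1)[OF f0_keys] f0_deg by auto
          ultimately have "v \<le> x n + f0" by (simp add: add_left_mono)
          then show False using less by simp
        qed
        then have \<alpha>: "0 < \<alpha>" "\<alpha> \<le> d" using deg by simp_all
        have ?CM unfolding I by (rule CM_b[OF v_eq \<alpha> less])
        moreover have ?b using v_eq \<alpha> by blast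
        ultimately show ?thesis using less unfolding shift by blast
      qed
    qed
  qed
qed

end
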